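(* Let $L$ be a relational language with finitely many relation symbols of every arity greater than one and with finitely or countably many unary relation symbols. Let $\mathbf H$ be a countable $L$-hypergraph universal for all countable $L$-hypergraphs. Then $\mathbf H$ has finite big Ramsey degrees.
   Context: Convention: every structure is countable, has vertex set some $n\in\omega$ or $\omega$ (ordered by the natural order $\le$), and all embeddings are embeddings of $L$-structures that are monotone with respect to $\le$; $\binom{\mathbf B}{\mathbf A}$ is the set of such embeddings $\mathbf A\to\mathbf B$. An $L$-hypergraph is an $L$-structure in which every relation is injective (no tuple has a repeated vertex) and symmetric (closed under permutations of tuples), and every tuple lies in at most one relation (in particular each vertex lies in at most one unary relation). For a countably infinite $\mathbf B$ and finite substructure $\mathbf A$, the big Ramsey degree of $\mathbf A$ in $\mathbf B$ is the least $\ell\in\omega+1$ such that for every $k\in\omega$ and every colouring $\chi:\binom{\mathbf B}{\mathbf A}\to k$ there is an embedding $f:\mathbf B\to\mathbf B$ such that $\chi$ takes at most $\ell$ values on embeddings $\mathbf A\to\mathbf B$ with image inside $f[B]$; $\mathbf B$ has finite big Ramsey degrees if this is finite for every finite substructure $\mathbf A$. *)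

theory Defs
  imports Main "HOL-Library.FuncSet" "HOL-Library.Multiset" "HOL-Library.Countable_Set"
begin

record 'r lstruct =
  univ :: "nat set"
  rels :: "'r \<Rightarrow> nat list set"

definition is_struct :: "('r \<Rightarrow> nat) \<Rightarrow> 'r lstruct \<Rightarrow> bool" where
  "is_struct ar A \<longleftrightarrow>
     (univ A = UNIV \<or> (\<exists>n. univ A = {..<n})) \<and>
     (\<forall>r. \<forall>xs \<in> rels A r. length xs = ar r \<and> set xs \<subseteq> univ A)"

definition is_hypergraph :: "('r \<Rightarrow> nat) \<Rightarrow> 'r lstruct \<Rightarrow> bool" where
  "is_hypergraph ar A \<longleftrightarrow> is_struct ar A \<and>
     (\<forall>r. \<forall>xs \<in> rels A r. distinct xs \<and> (\<forall>ys. mset ys = mset xs \<longrightarrow> ys \<in> rels A r)) \<and>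
     (\<forall>r s xs. r \<noteq> s \<longrightarrow> xs \<in> rels A r \<longrightarrow> xs \<notin> rels A s)"

definition is_emb :: "('r \<Rightarrow> nat) \<Rightarrow> 'r lstruct \<Rightarrow> 'r lstruct \<Rightarrow> (nat \<Rightarrow> nat) \<Rightarrow> bool" where
  "is_emb ar A B f \<longleftrightarrow>
     f ` univ A \<subseteq> univ B \<and> strict_mono_on (univ A) f \<and>
     (\<forall>r xs. length xs = ar r \<longrightarrow> set xs \<subseteq> univ A \<longrightarrow>
        (xs \<in> rels A r \<longleftrightarrow> map f xs \<in> rels B r))"

text \<open>The set of embeddings A \<rightarrow> B, each represented canonically (extensional on univ A).\<close>
definition emb_set :: "('r \<Rightarrow> nat) \<Rightarrow> 'r lstruct \<Rightarrow> 'r lstruct \<Rightarrow> (nat \<Rightarrow> nat) set" where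
  "emb_set ar A B = {f \<in> extensional (univ A). is_emb ar A B f}"

definition universal_hypergraph :: "('r \<Rightarrow> nat) \<Rightarrow> 'r lstruct \<Rightarrow> bool" where
  "universal_hypergraph ar H \<longleftrightarrow> is_hypergraph ar H \<and>
     (\<forall>G. is_hypergraph ar G \<longrightarrow> (\<exists>f. is_emb ar G H f))"

definition brd_le :: "('r \<Rightarrow> nat) \<Rightarrow> 'r lstruct \<Rightarrow> 'r lstruct \<Rightarrow> nat \<Rightarrow> bool" where
  "brd_le ar A B l \<longleftrightarrow>
     (\<forall>(k::nat) (\<chi>::(nat \<Rightarrow> nat) \<Rightarrow> nat). (\<forall>e \<in> emb_set ar A B. \<chi> e < k) \<longrightarrow>
        (\<exists>f. is_emb ar B B f \<and>
             card (\<chi> ` {e \<in> emb_set ar A B. e ` univ A \<subseteq> f ` univ B}) \<le> l))"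

definition finite_big_ramsey_degrees :: "('r \<Rightarrow> nat) \<Rightarrow> 'r lstruct \<Rightarrow> bool" where
  "finite_big_ramsey_degrees ar B \<longleftrightarrow>
     (\<forall>A. is_struct ar A \<and> finite (univ A) \<longrightarrow> (\<exists>l. brd_le ar A B l))"

end

theory Submission
  imports Defs
begin

text \<open>
Replace a vertex of a hypergraph by its type over the preceding vertices: the function that maps a
finite set of earlier levels to the colour of the hyperedge they form with the vertex. Types form
trees of the form ``a type at level \<open>m + 1\<close> is a pair of types at level \<open>m\<close>'' (the old type, and the
values on sets containing \<open>m\<close>, which is a type of one arity higher). The trees branch finitely
because every arity above one has finitely many relations; unary relations never branch and are
carried along as labels. The Halpern--Laeuchli theorem and a fusion give a Milliken-type
theorem for embeddings of such trees into themselves: a colouring of finite configurations becomes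
constant on all copies of a configuration. Finally every vertex is coded by a type in which two
branches only separate at special levels where one bit is recorded. Then a set of \<open>n\<close> vertices is
contained in a copy of a configuration whose height is bounded in terms of \<open>n\<close>, and the number of
such configurations bounds the big Ramsey degree.
\<close>

section \<open>The Halpern--Laeuchli theorem\<close>

text \<open>The label of a node is again a node, of the next grade, and this is the obstacle that
  shapes the proof: the image of a node is constrained by the images of its restriction and of its
  label together, so the trees of all grades have to be thinned by one common map. Hence the
  Halpern-Laeuchli theorem is needed for several trees at once, one for each node of the next level.
  Coding vertices by their plain types would not do. Two types may first differ at the level of a
  vertex; keeping that level produces new labels, which must be told apart in turn, and no bound on
  the kept levels is in sight. Recording bits beforehand moves every first difference to a level
  whose labels are constant. Only universality of \<open>H\<close> is given. So the colouring of
  copies in \<open>H\<close> is pulled back along an embedding into \<open>H\<close> of a hypergraph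
  made of nodes, and \<open>H\<close> itself is sent into that hypergraph by codes. Infinitely many
  unary relations are harmless because all copies of \<open>A\<close> agree on them.\<close>

locale tree_order =
  fixes le :: "'a \<Rightarrow> 'a \<Rightarrow> bool"  (infix "\<preceq>" 50)
  assumes le_refl: "x \<preceq> x"
    and le_trans: "x \<preceq> y \<Longrightarrow> y \<preceq> z \<Longrightarrow> x \<preceq> z"
begin

section \<open>Trees given by their levels, and strong subtrees\<close>

definition tree :: "(nat \<Rightarrow> 'a set) \<Rightarrow> bool" where
  "tree X \<longleftrightarrow> (\<forall>n. finite (X n)) \<and> X 0 \<noteq> {} \<and>
     (\<forall>n. \<forall>y\<in>X (Suc n). \<exists>x\<in>X n. x \<preceq> y) \<and>
     (\<forall>n. \<forall>x\<in>X n. \<exists>y\<in>X (Suc n). x \<preceq> y) \<and>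
     (\<forall>n y. \<forall>x\<in>X n. \<forall>x'\<in>X n. x \<preceq> y \<longrightarrow> x' \<preceq> y \<longrightarrow> x = x')"

text \<open>Weaker than the usual notion: an immediate successor may be dominated several times, and
  \<open>S 0\<close> may miss some roots of \<open>X\<close>. One dominating node is all that the
  later choices of images require.\<close>

definition strong :: "(nat \<Rightarrow> 'a set) \<Rightarrow> (nat \<Rightarrow> 'a set) \<Rightarrow> (nat \<Rightarrow> nat) \<Rightarrow> bool" where
  "strong X S p \<longleftrightarrow> strict_mono p \<and> S 0 \<noteq> {} \<and> (\<forall>n. S n \<subseteq> X (p n)) \<and>
     (\<forall>n. \<forall>y\<in>S (Suc n). \<exists>x\<in>S n. x \<preceq> y) \<and>
     (\<forall>n. \<forall>s\<in>S n. \<forall>t\<in>X (Suc (p n)). s \<preceq> t \<longrightarrow> (\<exists>y\<in>S (Suc n). t \<preceq> y))"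

definition dense :: "'a set \<Rightarrow> 'a \<Rightarrow> 'a set \<Rightarrow> bool" where
  "dense Y t D \<longleftrightarrow> (\<forall>z\<in>Y. t \<preceq> z \<longrightarrow> (\<exists>y\<in>D. z \<preceq> y))"

lemma tree_finite: "tree X \<Longrightarrow> finite (X n)"
  and tree_unique: "tree X \<Longrightarrow> x \<in> X n \<Longrightarrow> x' \<in> X n \<Longrightarrow> x \<preceq> y \<Longrightarrow> x' \<preceq> y \<Longrightarrow> x = x'"
  by (auto simp: tree_def)

lemma tree_down:
  assumes "tree X" "m \<le> n" "y \<in> X n"
  shows "\<exists>x\<in>X m. x \<preceq> y"
  using assms(2,3)
proof (induction n arbitrary: y rule: dec_induct)
  case base
  then show ?case using le_refl by blast
next
  case (step n)
  then obtain x where "x \<in> X n" "x \<preceq> y" using assms(1) unfolding tree_def by blast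
  then show ?case using step.IH le_trans by blast
qed

lemma tree_up:
  assumes "tree X" "m \<le> n" "x \<in> X m"
  shows "\<exists>y\<in>X n. x \<preceq> y"
  using assms(2)
proof (induction n rule: dec_induct)
  case base
  then show ?case using le_refl assms(3) by blast
next
  case (step n)
  then obtain y where "y \<in> X n" "x \<preceq> y" by blast
  then show ?case using assms(1) le_trans unfolding tree_def by meson
qed

lemma tree_nonempty:
  assumes "tree X"
  shows "X n \<noteq> {}"
proof -
  obtain x where "x \<in> X 0" using assms unfolding tree_def by auto
  then show ?thesis using tree_up[OF assms le0] by auto
qed

lemma tree_le:
  assumes "tree X" "t \<in> X m" "s \<in> X n" "m \<le> n" "t \<preceq> y" "s \<preceq> y"
  shows "t \<preceq> s"
proof -
  obtain t' where "t' \<in> X m" "t' \<preceq> s" using tree_down[OF assms(1,4,3)] by blast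
  then show ?thesis using tree_unique[OF assms(1,2)] assms(5,6) le_trans by metis
qed

lemma tree_levels:
  assumes "tree X" "strict_mono p"
  shows "tree (\<lambda>n. X (p n))"
proof -
  have "p n \<le> p (Suc n)" for n using assms(2) by (simp add: strict_mono_less_eq)
  then show ?thesis
    unfolding tree_def
    by (intro conjI allI ballI impI; use tree_finite[OF assms(1)] tree_nonempty[OF assms(1)]
      tree_down[OF assms(1)] tree_up[OF assms(1)] tree_unique[OF assms(1)] in metis)
qed

lemma tree_cone:
  assumes "tree X" "t \<in> X n"
  shows "tree (\<lambda>j. {x \<in> X (n + j). t \<preceq> x})"
  unfolding tree_def
proof (intro conjI allI ballI impI)
  show "finite {x \<in> X (n + j). t \<preceq> x}" for j using tree_finite[OF assms(1)] by simp
  show "{x \<in> X (n + 0). t \<preceq> x} \<noteq> {}" using assms(2) le_refl by auto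
next
  fix j y assume y: "y \<in> {x \<in> X (n + Suc j). t \<preceq> x}"
  then obtain x where "x \<in> X (n + j)" "x \<preceq> y"
    using tree_down[OF assms(1), of "n + j" "n + Suc j"] by auto
  then show "\<exists>x\<in>{x \<in> X (n + j). t \<preceq> x}. x \<preceq> y"
    using tree_le[OF assms, of x "n + j" y] y by auto
next
  fix j x assume x: "x \<in> {x \<in> X (n + j). t \<preceq> x}"
  then obtain y where "y \<in> X (n + Suc j)" "x \<preceq> y"
    using tree_up[OF assms(1), of "n + j" "n + Suc j"] by auto
  then show "\<exists>y\<in>{x \<in> X (n + Suc j). t \<preceq> x}. x \<preceq> y"
    using x le_trans by blast
next
  fix j y x x' assume "x \<in> {x \<in> X (n + j). t \<preceq> x}" "x' \<in> {x \<in> X (n + j). t \<preceq> x}" "x \<preceq> y" "x' \<preceq> y"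
  then show "x = x'" using tree_unique[OF assms(1)] by blast
qed

lemma strong_sub: "strong X S p \<Longrightarrow> S n \<subseteq> X (p n)"
  and strong_succ: "strong X S p \<Longrightarrow> s \<in> S n \<Longrightarrow> t \<in> X (Suc (p n)) \<Longrightarrow> s \<preceq> t \<Longrightarrow> \<exists>y\<in>S (Suc n). t \<preceq> y"
  by (auto simp: strong_def)

lemma strong_tree:
  assumes "tree X" "strong X S p"
  shows "tree S"
  unfolding tree_def
proof (intro conjI allI ballI impI)
  show "finite (S n)" for n using strong_sub[OF assms(2)] tree_finite[OF assms(1)] finite_subset by blast
  show "S 0 \<noteq> {}" using assms(2) by (simp add: strong_def)
  show "\<exists>x\<in>S n. x \<preceq> y" if "y \<in> S (Suc n)" for n y using assms(2) that by (simp add: strong_def)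
  show "\<exists>y\<in>S (Suc n). x \<preceq> y" if x: "x \<in> S n" for n x
  proof -
    obtain t where "t \<in> X (Suc (p n))" "x \<preceq> t"
      using tree_up[OF assms(1), of "p n" "Suc (p n)" x] x strong_sub[OF assms(2), of n] by auto
    then show ?thesis using strong_succ[OF assms(2) x] le_trans by blast
  qed
  show "x = x'" if "x \<in> S n" "x' \<in> S n" "x \<preceq> y" "x' \<preceq> y" for n x x' y
    using tree_unique[OF assms(1)] strong_sub[OF assms(2), of n] that by blast
qed

lemma strong_refl: "tree X \<Longrightarrow> strong X X (\<lambda>n. n)"
  unfolding strong_def tree_def by (auto intro: le_refl simp: strict_mono_def)

lemma strong_trans:
  assumes "strong X S p" "strong S R p'"
  shows "strong X R (\<lambda>n. p (p' n))"
  unfolding strong_def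
proof (intro conjI allI ballI impI)
  show "strict_mono (\<lambda>n. p (p' n))" using assms by (simp add: strong_def strict_mono_def)
  show "R 0 \<noteq> {}" using assms by (simp add: strong_def)
  show "R n \<subseteq> X (p (p' n))" for n using assms by (meson strong_sub subset_trans)
  show "\<exists>x\<in>R n. x \<preceq> y" if "y \<in> R (Suc n)" for n y using assms that by (simp add: strong_def)
  show "\<exists>y\<in>R (Suc n). t \<preceq> y" if s: "s \<in> R n" "t \<in> X (Suc (p (p' n)))" "s \<preceq> t" for n s t
  proof -
    obtain y where y: "y \<in> S (Suc (p' n))" "t \<preceq> y"
      using strong_succ[OF assms(1), of s "p' n" t] s strong_sub[OF assms(2)] by blast
    then obtain z where "z \<in> R (Suc n)" "y \<preceq> z"
      using strong_succ[OF assms(2), of s n y] s le_trans by blast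
    then show ?thesis using y le_trans by blast
  qed
qed

text \<open>
The weakest form of the theorem: only one level of branching has to be dominated. Since it is
claimed for all trees, it may be applied after passing to a sparse set of levels, which makes it as
strong as the dense form \<open>dense_HL\<close>. This is the form in which the induction is carried out.
\<close>

definition one_step :: "'i set \<Rightarrow> bool" where
  "one_step I \<longleftrightarrow> (\<forall>X (c :: nat \<Rightarrow> ('i \<Rightarrow> 'a) \<Rightarrow> nat) K.
     (\<forall>i\<in>I. tree (X i)) \<longrightarrow> (\<forall>n x. c n x < K) \<longrightarrow>
     (\<exists>p k s D \<epsilon>. p < k \<and> s \<in> Pi\<^sub>E I (\<lambda>i. X i p) \<and>
        (\<forall>i\<in>I. D i \<subseteq> X i k \<and> dense (X i (Suc p)) (s i) (D i)) \<and>
        (\<forall>x\<in>Pi\<^sub>E I D. c k x = \<epsilon>)))"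

section \<open>From one dominated level to dense sets and strong subtrees\<close>

lemma dense_antimono:
  assumes "tree X" "m \<le> n" "dense (X n) t D"
  shows "dense (X m) t D"
  unfolding dense_def
proof (intro ballI impI)
  fix z assume z: "z \<in> X m" "t \<preceq> z"
  obtain z' where z': "z' \<in> X n" "z \<preceq> z'" using tree_up[OF assms(1,2) z(1)] by blast
  then obtain y where "y \<in> D" "z' \<preceq> y" using assms(3) z le_trans unfolding dense_def by blast
  then show "\<exists>y\<in>D. z \<preceq> y" using z' le_trans by blast
qed

definition dense_mono ::
  "'i set \<Rightarrow> ('i \<Rightarrow> nat \<Rightarrow> 'a set) \<Rightarrow> (nat \<Rightarrow> ('i \<Rightarrow> 'a) \<Rightarrow> nat) \<Rightarrow> nat \<Rightarrow> ('i \<Rightarrow> 'a) \<Rightarrow> nat \<Rightarrow> bool" where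
  "dense_mono I X c \<epsilon> t m \<longleftrightarrow> (\<exists>k\<ge>m. \<exists>D.
     (\<forall>i\<in>I. D i \<subseteq> X i k \<and> dense (X i m) (t i) (D i)) \<and> (\<forall>x\<in>Pi\<^sub>E I D. c k x = \<epsilon>))"

lemma dense_mono_antimono:
  assumes "\<forall>i\<in>I. tree (X i)" "dense_mono I X c \<epsilon> t n" "m \<le> n"
  shows "dense_mono I X c \<epsilon> t m"
proof -
  obtain k D where "k \<ge> n" "\<forall>i\<in>I. D i \<subseteq> X i k \<and> dense (X i n) (t i) (D i)" "\<forall>x\<in>Pi\<^sub>E I D. c k x = \<epsilon>"
    using assms(2) unfolding dense_mono_def by blast
  moreover from this have "\<forall>i\<in>I. dense (X i m) (t i) (D i)"
    using assms(1,3) dense_antimono by metis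
  ultimately show ?thesis unfolding dense_mono_def using assms(3)
    by (intro exI[of _ k] conjI exI[of _ D]) auto
qed

text \<open>If every colour and root failed, finiteness of the levels and antimonotonicity in
  \<open>m\<close> would give one level \<open>M e\<close> at which all roots of level
  \<open>e\<close> fail for all colours. On the levels \<open>0\<close>, \<open>M 0\<close>,
  \<open>M (M 0)\<close>, ... a single step of branching already reaches the failing level, contrary
  to \<open>one_step\<close>.\<close>

lemma dense_HL:
  assumes "one_step I" "finite I" and tr: "\<forall>i\<in>I. tree (X i)"
    and c: "\<And>n x. c n x < (K::nat)"
  shows "\<exists>\<epsilon> e t. \<epsilon> < K \<and> t \<in> Pi\<^sub>E I (\<lambda>i. X i e) \<and> (\<forall>m\<ge>e. dense_mono I X c \<epsilon> t m)"
proof (rule ccontr)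
  let ?good = "dense_mono I X c"
  assume "\<not> ?thesis"
  then have neg: "\<exists>m\<ge>e. \<not> ?good \<epsilon> t m" if "\<epsilon> < K" "t \<in> Pi\<^sub>E I (\<lambda>i. X i e)" for \<epsilon> e t
    using that by blast
  note anti = dense_mono_antimono[OF tr]
  have "\<exists>m>e. \<forall>\<epsilon><K. \<forall>t\<in>Pi\<^sub>E I (\<lambda>i. X i e). \<not> ?good \<epsilon> t m" for e
  proof -
    let ?A = "{..<K} \<times> Pi\<^sub>E I (\<lambda>i. X i e)"
    have "\<forall>a\<in>?A. \<exists>m. \<not> ?good (fst a) (snd a) m"
      using neg by fastforce
    then obtain M where M: "\<And>a. a \<in> ?A \<Longrightarrow> \<not> ?good (fst a) (snd a) (M a)" by metis
    have fin: "finite ?A" using assms(2) tree_finite tr by (simp add: finite_PiE)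
    define m where "m = Suc e + sum M ?A"
    have "M a \<le> m" if "a \<in> ?A" for a
      unfolding m_def using member_le_sum[OF that _ fin, of M] by simp
    then have "\<not> ?good (fst a) (snd a) m" if "a \<in> ?A" for a using that M anti by meson
    moreover have "e < m" unfolding m_def by simp
    ultimately show ?thesis by (metis fst_conv lessThan_iff mem_Sigma_iff snd_conv)
  qed
  then obtain M where M: "\<And>e. M e > e" "\<And>e \<epsilon> t. \<epsilon> < K \<Longrightarrow> t \<in> Pi\<^sub>E I (\<lambda>i. X i e) \<Longrightarrow> \<not> ?good \<epsilon> t (M e)"
    by metis
  define p where "p n = (M ^^ n) 0" for n
  have pS: "p (Suc n) = M (p n)" for n by (simp add: p_def)
  have sm: "strict_mono p" using M(1) pS by (simp add: strict_mono_Suc_iff)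
  have "\<exists>n k s D \<epsilon>. n < k \<and> s \<in> Pi\<^sub>E I (\<lambda>i. X i (p n)) \<and>
        (\<forall>i\<in>I. D i \<subseteq> X i (p k) \<and> dense (X i (p (Suc n))) (s i) (D i)) \<and>
        (\<forall>x\<in>Pi\<^sub>E I D. c (p k) x = \<epsilon>)"
    using assms(1)[unfolded one_step_def, rule_format, of "\<lambda>i n. X i (p n)" "\<lambda>n. c (p n)" K]
      tree_levels[OF _ sm] tr c by auto
  then obtain n k s D \<epsilon> where *: "n < k" "s \<in> Pi\<^sub>E I (\<lambda>i. X i (p n))"
        "\<forall>i\<in>I. D i \<subseteq> X i (p k) \<and> dense (X i (p (Suc n))) (s i) (D i)"
        "\<forall>x\<in>Pi\<^sub>E I D. c (p k) x = \<epsilon>" by blast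
  \<comment> \<open>A point of the product is required: only then is \<open>\<epsilon>\<close> a
    value of the colouring, hence below \<open>K\<close>.\<close>
  have "\<exists>y. y \<in> D i" if i: "i \<in> I" for i
  proof -
    have "s i \<in> X i (p n)" using *(2) i by blast
    moreover have "p n \<le> p (Suc n)" using sm by (simp add: strict_mono_less_eq)
    ultimately obtain z where "z \<in> X i (p (Suc n))" "s i \<preceq> z"
      using tree_up tr i by blast
    then show ?thesis using *(3) i unfolding dense_def by blast
  qed
  then obtain y where y: "\<And>i. i \<in> I \<Longrightarrow> y i \<in> D i" by metis
  then have "restrict y I \<in> Pi\<^sub>E I D" by simp
  then have "\<epsilon> < K" using *(4) c by metis
  moreover have "?good \<epsilon> s (M (p n))"
    unfolding dense_mono_def using *(1,3,4) sm pS by (metis Suc_leI strict_mono_less_eq)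
  ultimately show False using M(2)[of \<epsilon> s "p n"] *(2) by simp
qed

text \<open>The next level of the subtree is taken from the monochromatic set that is dense over
  level \<open>Suc (p n)\<close>, so it dominates all immediate successors of the nodes of level
  \<open>p n\<close> above \<open>t\<close>.\<close>

lemma strong_HL:
  assumes "one_step I" "finite I" and tr: "\<forall>i\<in>I. tree (X i)"
    and c: "\<And>n x. c n x < (K::nat)"
  shows "\<exists>S p \<epsilon>. strict_mono p \<and> (\<forall>i\<in>I. strong (X i) (S i) p) \<and> (\<forall>n. \<forall>x\<in>Pi\<^sub>E I (\<lambda>i. S i n). c (p n) x = \<epsilon>)"
proof -
  obtain \<epsilon> e t where t: "t \<in> Pi\<^sub>E I (\<lambda>i. X i e)" and *: "\<forall>m\<ge>e. dense_mono I X c \<epsilon> t m"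
    using dense_HL[where X=X and c=c and K=K, OF assms] by blast
  from * have "\<exists>k D. m \<ge> e \<longrightarrow> m \<le> k \<and>
     (\<forall>i\<in>I. D i \<subseteq> X i k \<and> dense (X i m) (t i) (D i)) \<and> (\<forall>x\<in>Pi\<^sub>E I D. c k x = \<epsilon>)" for m
    by (cases "m \<ge> e") (auto simp: dense_mono_def)
  then obtain k D where kD: "\<And>m. m \<ge> e \<Longrightarrow> m \<le> k m"
    "\<And>m i. m \<ge> e \<Longrightarrow> i \<in> I \<Longrightarrow> D m i \<subseteq> X i (k m)"
    "\<And>m i. m \<ge> e \<Longrightarrow> i \<in> I \<Longrightarrow> dense (X i m) (t i) (D m i)"
    "\<And>m x. m \<ge> e \<Longrightarrow> x \<in> Pi\<^sub>E I (D m) \<Longrightarrow> c (k m) x = \<epsilon>"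
    by metis
  define p where "p n = ((\<lambda>q. k (Suc q)) ^^ n) (k e)" for n
  have p0: "p 0 = k e" and pS: "p (Suc n) = k (Suc (p n))" for n by (simp_all add: p_def)
  have pe: "e \<le> p n" for n
  proof (induction n)
    case (Suc n) then show ?case using kD(1)[of "Suc (p n)"] pS by simp
  qed (use kD(1)[of e] p0 in simp)
  have sm: "strict_mono p"
    using kD(1)[of "Suc (p n)" for n] pe by (simp add: strict_mono_Suc_iff pS Suc_le_eq le_SucI)
  define S where "S i n = rec_nat {y \<in> D e i. t i \<preceq> y}
     (\<lambda>n Y. {y \<in> D (Suc (p n)) i. \<exists>s\<in>Y. s \<preceq> y}) n" for i n
  have S0: "S i 0 = {y \<in> D e i. t i \<preceq> y}"
    and SS: "S i (Suc n) = {y \<in> D (Suc (p n)) i. \<exists>s\<in>S i n. s \<preceq> y}" for i n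
    by (simp_all add: S_def)
  have St: "t i \<preceq> y" if "y \<in> S i n" for i n y
    using that by (induction n arbitrary: y) (use le_trans in \<open>auto simp: S0 SS\<close>)
  have "strong (X i) (S i) p" if i: "i \<in> I" for i
    unfolding strong_def
  proof (intro conjI allI ballI impI)
    show "strict_mono p" by (rule sm)
    have "t i \<in> X i e" using t i by blast
    then show "S i 0 \<noteq> {}" using kD(3)[OF order_refl i] le_refl unfolding S0 dense_def by blast
    show "S i n \<subseteq> X i (p n)" for n
      using kD(2)[OF _ i] pe by (cases n) (auto simp: S0 SS p0 pS le_SucI subset_iff)
    show "\<exists>x\<in>S i n. x \<preceq> y" if "y \<in> S i (Suc n)" for n y using that by (simp add: SS)
    show "\<exists>y\<in>S i (Suc n). u \<preceq> y" if s: "s \<in> S i n" "u \<in> X i (Suc (p n))" "s \<preceq> u" for n s u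
    proof -
      have "t i \<preceq> u" using St s le_trans by blast
      then obtain y where "y \<in> D (Suc (p n)) i" "u \<preceq> y"
        using kD(3)[of "Suc (p n)" i] pe[of n] i s unfolding dense_def by auto
      then show ?thesis using s le_trans unfolding SS by blast
    qed
  qed
  moreover have "c (p n) x = \<epsilon>" if x: "x \<in> Pi\<^sub>E I (\<lambda>i. S i n)" for n x
  proof (cases n)
    case 0
    then have "x \<in> Pi\<^sub>E I (D e)" using x S0 by (auto simp: PiE_iff)
    then show ?thesis using kD(4)[of e x] p0 0 by simp
  next
    case (Suc m)
    then have "x \<in> Pi\<^sub>E I (D (Suc (p m)))" using x SS by (auto simp: PiE_iff)
    then show ?thesis using kD(4)[of "Suc (p m)" x] pS Suc pe[of m] by simp
  qed
  ultimately show ?thesis using sm by blast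
qed

text \<open>The root \<open>t\<close> comes from level \<open>n\<close> of the original
  \<open>Y\<close>, while level \<open>n\<close> of the already thinned \<open>X\<close> may lie
  higher. The hypothesis \<open>above\<close> provides nodes of \<open>X\<close> over every root.
  The conclusion repeats it for \<open>S\<close>, so that further roots can be treated and the step
  from level \<open>n - 1\<close> to \<open>n\<close> remains strong.\<close>

lemma freeze_one:
  assumes one: "one_step I" "finite I" and tr: "\<forall>i\<in>I. tree (Y i)"
    and c: "\<And>k x. c k x < (K::nat)"
    and q: "strict_mono q" and st: "\<forall>i\<in>I. strong (Y i) (X i) q"
    and fr: "\<forall>j<n. q j = j \<and> (\<forall>i\<in>I. X i j = Y i j)"
    and above: "\<forall>i\<in>I. \<forall>u\<in>Y i n. \<exists>y\<in>X i n. u \<preceq> y"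
    and t: "t \<in> Pi\<^sub>E I (\<lambda>i. Y i n)"
  shows "\<exists>S p \<epsilon>. strict_mono p \<and> (\<forall>i\<in>I. strong (Y i) (S i) (\<lambda>j. q (p j))) \<and>
     (\<forall>j<n. p j = j \<and> (\<forall>i\<in>I. S i j = Y i j)) \<and>
     (\<forall>i\<in>I. \<forall>u\<in>Y i n. \<exists>y\<in>S i n. u \<preceq> y) \<and> (\<forall>i\<in>I. \<forall>j. S i j \<subseteq> X i (p j)) \<and>
     (\<forall>j\<ge>n. \<forall>x\<in>Pi\<^sub>E I (\<lambda>i. S i j). (\<forall>i\<in>I. t i \<preceq> x i) \<longrightarrow> c (q (p j)) x = \<epsilon>)"
proof -
  have trX: "tree (X i)" if "i \<in> I" for i using strong_tree tr st that by blast
  have "\<forall>i\<in>I. \<exists>y\<in>X i n. t i \<preceq> y" using above t by blast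
  then obtain r where r: "\<And>i. i \<in> I \<Longrightarrow> r i \<in> X i n" "\<And>i. i \<in> I \<Longrightarrow> t i \<preceq> r i" by metis
  define C where "C i j = {x \<in> X i (n + j). r i \<preceq> x}" for i j
  have trC: "\<forall>i\<in>I. tree (C i)" using tree_cone[OF trX r(1)] unfolding C_def by simp
  obtain S' p' \<epsilon> where p': "strict_mono p'" and S': "\<forall>i\<in>I. strong (C i) (S' i) p'"
    and mono: "\<forall>k. \<forall>x\<in>Pi\<^sub>E I (\<lambda>i. S' i k). c (q (n + p' k)) x = \<epsilon>"
    using strong_HL[where X=C and c="\<lambda>k. c (q (n + k))" and K=K, OF one trC c] by auto
  define p where "p j = (if j < n then j else n + p' (j - n))" for j
  \<comment> \<open>Nothing is thinned out outside the cone above \<open>t\<close>.\<close>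
  define S where "S i j = (if j < n then X i j
     else S' i (j - n) \<union> {x \<in> X i (n + p' (j - n)). \<not> t i \<preceq> x})" for i j
  have p: "strict_mono p"
    unfolding strict_mono_Suc_iff
  proof
    fix j show "p j < p (Suc j)"
      using p' by (auto simp: p_def Suc_diff_le strict_mono_less)
  qed
  have S'_sub: "S' i k \<subseteq> X i (n + p' k)" "x \<in> S' i k \<Longrightarrow> r i \<preceq> x" if "i \<in> I" for i k x
    using strong_sub[of "C i" "S' i" p' k] S' that unfolding C_def by auto
  have S_sub: "S i j \<subseteq> X i (p j)" if "i \<in> I" for i j
    using S'_sub[OF that] by (auto simp: S_def p_def)
  \<comment> \<open>A node from level \<open>n\<close> or higher that is not above \<open>t\<close>
    has no extension above \<open>t\<close>, so its extensions survive.\<close>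
  have keep: "\<exists>y\<in>S i k. u \<preceq> y"
    if i: "i \<in> I" and k: "n \<le> k" and m: "m \<le> p k" "n \<le> m" and u: "u \<in> X i m" "\<not> t i \<preceq> u" for i k m u
  proof -
    obtain y where y: "y \<in> X i (p k)" "u \<preceq> y" using tree_up[OF trX[OF i] m(1) u(1)] by blast
    have "u \<in> Y i (q m)" using u(1) st i strong_sub by blast
    moreover have "n \<le> q m" using m(2) q strict_mono_imp_increasing order_trans by blast
    ultimately have "\<not> t i \<preceq> y"
      using tree_le[of "Y i" "t i" n u "q m" y] tr i t u(2) y(2) by blast
    then show ?thesis using y k by (auto simp: S_def p_def)
  qed
  have root: "\<exists>y\<in>S i n. u \<preceq> y" if i: "i \<in> I" and u: "u \<in> Y i n" for i u
  proof (cases "u = t i")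
    case True
    have "S' i 0 \<noteq> {}" using S' i unfolding strong_def by blast
    then obtain y where "y \<in> S' i 0" by blast
    then have "y \<in> S i n" "u \<preceq> y"
      using S'_sub(2)[OF i] r(2)[OF i] True le_trans[of "t i" "r i" y] by (auto simp: S_def)
    then show ?thesis by blast
  next
    case False
    obtain y where y: "y \<in> X i n" "u \<preceq> y" using above i u by blast
    have "\<not> t i \<preceq> y" using tree_unique[of "Y i" u n "t i" y] tr i u t y(2) False by blast
    moreover have "n \<le> p n" by (simp add: p_def)
    ultimately obtain z where "z \<in> S i n" "y \<preceq> z" using keep[of i n n y] i y by blast
    then show ?thesis using y le_trans by blast
  qed
  have frS: "\<forall>j<n. p j = j \<and> (\<forall>i\<in>I. S i j = Y i j)"
    using fr by (auto simp: p_def S_def)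
  have "strong (Y i) (S i) (\<lambda>j. q (p j))" if i: "i \<in> I" for i
    unfolding strong_def
  proof (intro conjI allI ballI impI)
    show "strict_mono (\<lambda>j. q (p j))" using p q by (simp add: strict_mono_def)
    have trY: "tree (Y i)" using tr i by blast
    show "S i 0 \<noteq> {}"
    proof (cases n)
      case 0
      then show ?thesis using root[OF i, of "t i"] t i by blast
    next
      case (Suc n')
      then show ?thesis using frS i trY by (auto simp: tree_def)
    qed
    show "S i j \<subseteq> Y i (q (p j))" for j using S_sub[OF i] st i strong_sub by blast
    show "\<exists>x\<in>S i j. x \<preceq> y" if y: "y \<in> S i (Suc j)" for j y
    proof (cases "j < n")
      case True
      have "y \<in> Y i (q (p (Suc j)))" using y S_sub[OF i, of "Suc j"] st i strong_sub by blast
      moreover have "j \<le> q (p (Suc j))"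
        using \<open>strict_mono (\<lambda>j. q (p j))\<close> strict_mono_imp_increasing[of "\<lambda>j. q (p j)" "Suc j"] by simp
      ultimately obtain x where "x \<in> Y i j" "x \<preceq> y" using tree_down[OF trY] by blast
      then show ?thesis using frS True i by auto
    next
      case False
      then have Sj: "Suc j - n = Suc (j - n)" by simp
      show ?thesis
      proof (cases "y \<in> S' i (Suc j - n)")
        case True
        then obtain x where "x \<in> S' i (j - n)" "x \<preceq> y" using S' i Sj unfolding strong_def by metis
        then show ?thesis using False by (auto simp: S_def)
      next
        case nin: False
        then have y': "y \<in> X i (p (Suc j))" "\<not> t i \<preceq> y" using y False by (auto simp: S_def p_def)
        have "p j \<le> p (Suc j)" using p by (simp add: strict_mono_less_eq)
        then obtain x where "x \<in> X i (p j)" "x \<preceq> y" using tree_down[OF trX[OF i] _ y'(1)] by blast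
        then show ?thesis using y' False le_trans by (auto simp: S_def p_def)
      qed
    qed
    show "\<exists>y\<in>S i (Suc j). u \<preceq> y" if s: "s \<in> S i j" "u \<in> Y i (Suc (q (p j)))" "s \<preceq> u" for j s u
    proof (cases "j < n")
      case True
      then have j: "q (p j) = j" using fr by (simp add: p_def)
      show ?thesis
      proof (cases "Suc j = n")
        case True
        then show ?thesis using root[OF i] s j by auto
      next
        case False
        then show ?thesis using frS i s True j le_refl by (metis Suc_lessI)
      qed
    next
      case False
      have sX: "s \<in> X i (p j)" using s(1) S_sub i by blast
      then obtain u' where u': "u' \<in> X i (Suc (p j))" "u \<preceq> u'"
        using strong_succ[of "Y i" "X i" q s "p j" u] st i s by blast
      have su': "s \<preceq> u'" using s(3) u'(2) le_trans by blast
      have "\<exists>y\<in>S i (Suc j). u' \<preceq> y"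
      proof (cases "s \<in> S' i (j - n)")
        case True
        have "r i \<preceq> u'" using S'_sub(2)[OF i True] su' le_trans by blast
        then have "u' \<in> C i (Suc (p' (j - n)))" using u'(1) False by (simp add: C_def p_def)
        then obtain y where "y \<in> S' i (Suc (j - n))" "u' \<preceq> y"
          using strong_succ[of "C i" "S' i" p' s "j - n" u'] S' i True su' by blast
        then show ?thesis using False by (auto simp: S_def Suc_diff_le)
      next
        case nin: False
        then have "\<not> t i \<preceq> s" using s(1) False by (simp add: S_def)
        moreover have npj: "n \<le> p j" using False by (simp add: p_def)
        then have "n \<le> q (p j)" using q strict_mono_imp_increasing order_trans by blast
        moreover have "s \<in> Y i (q (p j))" using sX st i strong_sub by blast
        ultimately have "\<not> t i \<preceq> u'" using tree_le[OF trY _ _ _ _ su'] t i by blast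
        moreover have "Suc (p j) \<le> p (Suc j)" using p by (simp add: Suc_le_eq strict_mono_less)
        ultimately show ?thesis using keep[OF i, of "Suc j" "Suc (p j)" u'] u' npj False by simp
      qed
      then show ?thesis using u' le_trans by blast
    qed
  qed
  moreover have "c (q (p j)) x = \<epsilon>"
    if "j \<ge> n" "x \<in> Pi\<^sub>E I (\<lambda>i. S i j)" "\<forall>i\<in>I. t i \<preceq> x i" for j x
  proof -
    have "x \<in> Pi\<^sub>E I (\<lambda>i. S' i (j - n))" using that by (auto simp: PiE_iff S_def)
    then show ?thesis using mono that(1) by (simp add: p_def)
  qed
  ultimately show ?thesis using p frS root S_sub
    by (intro exI[of _ S] exI[of _ p] exI[of _ \<epsilon>]) simp
qed

text \<open>The finitely many roots are treated in turn; thinning further keeps the colour constant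
  over the earlier ones.\<close>

lemma freeze_step:
  assumes one: "one_step I" "finite I" and tr: "\<forall>i\<in>I. tree (Y i)"
    and c: "\<And>k x. c k x < (K::nat)"
  shows "\<exists>S p. strict_mono p \<and> (\<forall>i\<in>I. strong (Y i) (S i) p) \<and>
     (\<forall>j<n. p j = j \<and> (\<forall>i\<in>I. S i j = Y i j)) \<and>
     (\<forall>t\<in>Pi\<^sub>E I (\<lambda>i. Y i n). \<exists>\<epsilon>. \<forall>j\<ge>n. \<forall>x\<in>Pi\<^sub>E I (\<lambda>i. S i j).
        (\<forall>i\<in>I. t i \<preceq> x i) \<longrightarrow> c (p j) x = \<epsilon>)"
proof -
  have fin: "finite (Pi\<^sub>E I (\<lambda>i. Y i n))" using one(2) tr tree_finite by (simp add: finite_PiE)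
  have main: "A \<subseteq> Pi\<^sub>E I (\<lambda>i. Y i n) \<Longrightarrow> \<exists>S p. strict_mono p \<and> (\<forall>i\<in>I. strong (Y i) (S i) p) \<and>
     (\<forall>j<n. p j = j \<and> (\<forall>i\<in>I. S i j = Y i j)) \<and>
     (\<forall>i\<in>I. \<forall>u\<in>Y i n. \<exists>y\<in>S i n. u \<preceq> y) \<and>
     (\<forall>t\<in>A. \<exists>\<epsilon>. \<forall>j\<ge>n. \<forall>x\<in>Pi\<^sub>E I (\<lambda>i. S i j). (\<forall>i\<in>I. t i \<preceq> x i) \<longrightarrow> c (p j) x = \<epsilon>)"
    if "finite A" for A
    using that
  proof (induction A rule: finite_induct)
    case empty
    show ?case
      using strong_refl tr le_refl
      by (intro exI[of _ Y] exI[of _ "\<lambda>n. n"]) (auto simp: strict_mono_def)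
  next
    case (insert t A)
    then obtain X q where q: "strict_mono q" "\<forall>i\<in>I. strong (Y i) (X i) q"
      "\<forall>j<n. q j = j \<and> (\<forall>i\<in>I. X i j = Y i j)" "\<forall>i\<in>I. \<forall>u\<in>Y i n. \<exists>y\<in>X i n. u \<preceq> y"
      and old: "\<And>t. t\<in>A \<Longrightarrow> \<exists>\<epsilon>. \<forall>j\<ge>n. \<forall>x\<in>Pi\<^sub>E I (\<lambda>i. X i j). (\<forall>i\<in>I. t i \<preceq> x i) \<longrightarrow> c (q j) x = \<epsilon>"
      by auto
    have t: "t \<in> Pi\<^sub>E I (\<lambda>i. Y i n)" using insert by blast
    obtain S p \<epsilon> where S: "strict_mono p" "\<forall>i\<in>I. strong (Y i) (S i) (\<lambda>j. q (p j))"
     "\<forall>j<n. p j = j \<and> (\<forall>i\<in>I. S i j = Y i j)"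
     "\<forall>i\<in>I. \<forall>u\<in>Y i n. \<exists>y\<in>S i n. u \<preceq> y"
     and sub: "\<forall>i\<in>I. \<forall>j. S i j \<subseteq> X i (p j)"
     and new: "\<forall>j\<ge>n. \<forall>x\<in>Pi\<^sub>E I (\<lambda>i. S i j). (\<forall>i\<in>I. t i \<preceq> x i) \<longrightarrow> c (q (p j)) x = \<epsilon>"
      using freeze_one[where c=c and K=K, OF one tr c q t] by blast
    have "\<exists>\<epsilon>. \<forall>j\<ge>n. \<forall>x\<in>Pi\<^sub>E I (\<lambda>i. S i j). (\<forall>i\<in>I. t' i \<preceq> x i) \<longrightarrow> c (q (p j)) x = \<epsilon>"
      if "t' \<in> insert t A" for t'
    proof (cases "t' = t")
      case True
      then show ?thesis using new by blast
    next
      case False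
      then obtain \<delta> where \<delta>: "\<forall>j\<ge>n. \<forall>x\<in>Pi\<^sub>E I (\<lambda>i. X i j). (\<forall>i\<in>I. t' i \<preceq> x i) \<longrightarrow> c (q j) x = \<delta>"
        using \<open>t' \<in> insert t A\<close> old[of t'] by blast
      have "c (q (p j)) x = \<delta>" if "j \<ge> n" "x \<in> Pi\<^sub>E I (\<lambda>i. S i j)" "\<forall>i\<in>I. t' i \<preceq> x i" for j x
      proof -
        have "n \<le> p j" using that(1) S(1) strict_mono_imp_increasing order_trans by blast
        moreover have "x \<in> Pi\<^sub>E I (\<lambda>i. X i (p j))" using that(2) sub by (auto simp: PiE_iff)
        ultimately show ?thesis using \<delta> that(3) by blast
      qed
      then show ?thesis by blast
    qed
    moreover have "strict_mono (\<lambda>j. q (p j))" using S(1) q(1) by (simp add: strict_mono_def)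
    moreover have "\<forall>j<n. q (p j) = j \<and> (\<forall>i\<in>I. S i j = Y i j)" using S(3) q(3) by simp
    ultimately show ?case using S(2,4) by (intro exI[of _ S] exI[of _ "\<lambda>j. q (p j)"]) blast
  qed
  from main[OF fin subset_refl] show ?thesis
    by (elim exE conjE) (intro exI conjI; assumption)
qed

text \<open>Stage \<open>n\<close> does not touch the levels below \<open>n\<close>, so the stages
  have a limit. The limit is a strong subtree of every stage and inherits the constancy obtained
  there. The number of colours may depend on \<open>n\<close> because each stage handles only its
  own colouring.\<close>

lemma strong_fusion:
  assumes one: "one_step I" "finite I" and tr: "\<forall>i\<in>I. tree (X i)"
    and c: "\<And>n k x. c n k x < (K n :: nat)"
  shows "\<exists>S p. strict_mono p \<and> (\<forall>i\<in>I. strong (X i) (S i) p) \<and>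
     (\<forall>n. \<forall>y\<in>Pi\<^sub>E I (\<lambda>i. S i n). \<exists>\<epsilon>. \<forall>j\<ge>n. \<forall>x\<in>Pi\<^sub>E I (\<lambda>i. S i j).
        (\<forall>i\<in>I. y i \<preceq> x i) \<longrightarrow> c n (p j) x = \<epsilon>)"
proof -
  define good where "good a \<longleftrightarrow> strict_mono (snd a) \<and> (\<forall>i\<in>I. strong (X i) (fst a i) (snd a))" for a
  define step where "step n a b p \<longleftrightarrow> strict_mono p \<and> (\<forall>i\<in>I. strong (fst a i) (fst b i) p) \<and>
     (\<forall>j<n. p j = j \<and> (\<forall>i\<in>I. fst b i j = fst a i j)) \<and> snd b = (\<lambda>j. snd a (p j)) \<and>
     (\<forall>t\<in>Pi\<^sub>E I (\<lambda>i. fst a i n). \<exists>\<epsilon>. \<forall>j\<ge>n. \<forall>x\<in>Pi\<^sub>E I (\<lambda>i. fst b i j).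
        (\<forall>i\<in>I. t i \<preceq> x i) \<longrightarrow> c n (snd b j) x = \<epsilon>)" for n a b p
  have ex: "\<exists>b. good b \<and> (\<exists>p. step n a b p)" if "good a" for a n
  proof -
    have a: "strict_mono (snd a)" "\<forall>i\<in>I. strong (X i) (fst a i) (snd a)"
      using that by (auto simp: good_def)
    have "\<forall>i\<in>I. tree (fst a i)" using a(2) tr strong_tree by blast
    then obtain S p where S: "strict_mono p" "\<forall>i\<in>I. strong (fst a i) (S i) p"
     "\<forall>j<n. p j = j \<and> (\<forall>i\<in>I. S i j = fst a i j)"
     "\<forall>t\<in>Pi\<^sub>E I (\<lambda>i. fst a i n). \<exists>\<epsilon>. \<forall>j\<ge>n. \<forall>x\<in>Pi\<^sub>E I (\<lambda>i. S i j).
        (\<forall>i\<in>I. t i \<preceq> x i) \<longrightarrow> c n (snd a (p j)) x = \<epsilon>"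
      using freeze_step[where Y="fst a" and c="\<lambda>k. c n (snd a k)" and K="K n" and n=n, OF one _ c] by blast
    have "good (S, \<lambda>j. snd a (p j))"
      using S(1,2) a strong_trans unfolding good_def by (auto simp: strict_mono_def)
    moreover have "step n a (S, \<lambda>j. snd a (p j)) p"
      using S unfolding step_def by simp
    ultimately show ?thesis by blast
  qed
  define a0 where "a0 = (X, \<lambda>n::nat. n)"
  have a0: "good a0" using tr strong_refl by (auto simp: good_def a0_def strict_mono_def)
  have "\<exists>f. \<forall>n. (good (f n) \<and> (n = 0 \<longrightarrow> a0 = f n)) \<and> (\<exists>p. step n (f n) (f (Suc n)) p)"
  proof (rule dependent_nat_choice)
    show "\<exists>x. good x \<and> (0 = 0 \<longrightarrow> a0 = x)" using a0 by blast
    show "\<exists>y. (good y \<and> (Suc n = 0 \<longrightarrow> a0 = y)) \<and> (\<exists>p. step n x y p)"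
      if "good x \<and> (n = 0 \<longrightarrow> a0 = x)" for x n
      using ex[of x n] that by simp
  qed
  then obtain f where f: "\<And>n. good (f n)" "f 0 = a0" "\<And>n. \<exists>p. step n (f n) (f (Suc n)) p" by metis
  then obtain p where p: "\<And>n. step n (f n) (f (Suc n)) (p n)" by metis
  define T where "T n = fst (f n)" for n
  define q where "q n = snd (f n)" for n
  have T0: "T 0 = X" and q0: "q 0 = (\<lambda>n. n)" using f(2) by (simp_all add: T_def q_def a0_def)
  have pm: "strict_mono (p n)" and Ts: "i \<in> I \<Longrightarrow> strong (T n i) (T (Suc n) i) (p n)"
    and pf: "j < n \<Longrightarrow> p n j = j" and Tf: "j < n \<Longrightarrow> i \<in> I \<Longrightarrow> T (Suc n) i j = T n i j"
    and qS: "q (Suc n) j = q n (p n j)"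
    and col: "t\<in>Pi\<^sub>E I (\<lambda>i. T n i n) \<Longrightarrow> \<exists>\<epsilon>. \<forall>j\<ge>n. \<forall>x\<in>Pi\<^sub>E I (\<lambda>i. T (Suc n) i j).
        (\<forall>i\<in>I. t i \<preceq> x i) \<longrightarrow> c n (q (Suc n) j) x = \<epsilon>" for n i j t
    using p[of n] unfolding step_def T_def q_def by auto
  \<comment> \<open>\<open>R n d\<close> sends levels of stage \<open>n + d\<close> to levels of
    stage \<open>n\<close>; its value at \<open>j\<close> is final as soon as
    \<open>j < n + d\<close>.\<close>
  define R where "R n d = rec_nat (\<lambda>j. j) (\<lambda>d g j. g (p (n + d) j)) d" for n d
  have R0: "R n 0 j = j" and RS: "R n (Suc d) j = R n d (p (n + d) j)" for n d j
    by (simp_all add: R_def)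
  have RT: "(\<forall>i\<in>I. strong (T n i) (T (n + d) i) (R n d)) \<and> (\<forall>j. q n (R n d j) = q (n + d) j) \<and> strict_mono (R n d)" for n d
  proof (induction d)
    case 0
    have "tree (T n i)" if "i \<in> I" for i
      using f(1)[of n] tr that strong_tree unfolding good_def T_def by blast
    then show ?case using strong_refl by (simp add: R0 strict_mono_def)
  next
    case (Suc d)
    have "R n (Suc d) = (\<lambda>j. R n d (p (n + d) j))" using RS by blast
    then show ?case
      using Suc Ts[of _ "n + d"] strong_trans pm[of "n + d"] qS[of "n + d"] by (auto simp: strict_mono_def)
  qed
  \<comment> \<open>The step from stage \<open>j\<close> may still change level \<open>j\<close>;
    all later steps leave it alone.\<close>
  define S where "S i j = T (Suc j) i j" for i j
  have TS: "T (Suc j + d) i j = S i j" if "i \<in> I" for i j d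
    by (induction d) (use that Tf in \<open>auto simp: S_def\<close>)
  have Tm: "T m i j = S i j" if "i \<in> I" "j < m" for i j m
    using TS[of i j "m - Suc j"] that by simp
  have Rf: "R n d' j = R n d j" if "d \<le> d'" "j < n + d" for n d d' j
    using that(1) by (induction d' rule: dec_induct) (use that(2) pf RS in auto)
  define P where "P n j = R n (Suc j) j" for n j
  have PR: "P n j = R n d j" if "Suc j \<le> d" for n j d
    unfolding P_def using Rf[of "Suc j" d j n] that by simp
  have PP: "P 0 j = q n (P n j)" for n j
  proof -
    have "P 0 j = R 0 (n + Suc j) j" using PR[of j "n + Suc j"] by simp
    also have "\<dots> = q (n + Suc j) j" using RT[of 0 "n + Suc j"] q0 by simp
    also have "\<dots> = q n (P n j)" using RT[of n "Suc j"] P_def by simp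
    finally show ?thesis .
  qed
  have Pm: "strict_mono (P n)" for n
    unfolding strict_mono_Suc_iff
  proof
    fix j
    show "P n j < P n (Suc j)"
      using RT[of n "Suc (Suc j)"] by (simp add: PR[of j "Suc (Suc j)"] PR[of "Suc j" "Suc (Suc j)"] strict_mono_less)
  qed
  have PS: "strong (T n i) (S i) (P n)" if i: "i \<in> I" for n i
    unfolding strong_def
  proof (intro conjI allI ballI impI)
    show "strict_mono (P n)" by (rule Pm)
    have R: "strong (T n i) (T (n + Suc (Suc j)) i) (R n (Suc (Suc j)))" for j using RT i by blast
    note e = Tm[OF i]
    have e1: "T (n + Suc (Suc j)) i j = S i j" "T (n + Suc (Suc j)) i (Suc j) = S i (Suc j)"
      "R n (Suc (Suc j)) j = P n j" for j
      using e[of j "n + Suc (Suc j)"] e[of "Suc j" "n + Suc (Suc j)"] PR[of j "Suc (Suc j)"] by simp_all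
    show "S i 0 \<noteq> {}" using R[of 0] e1(1)[of 0] unfolding strong_def by simp
    show "S i j \<subseteq> T n i (P n j)" for j
      using strong_sub[OF R[of j], of j] e1[of j] by simp
    show "\<exists>x\<in>S i j. x \<preceq> y" if "y \<in> S i (Suc j)" for j y
      using R[of j] that e1[of j] unfolding strong_def by metis
    show "\<exists>y\<in>S i (Suc j). t \<preceq> y" if "s \<in> S i j" "t \<in> T n i (Suc (P n j))" "s \<preceq> t" for j s t
      using strong_succ[OF R[of j], of s j t] that e1[of j] by simp
  qed
  have "\<exists>\<epsilon>. \<forall>j\<ge>n. \<forall>x\<in>Pi\<^sub>E I (\<lambda>i. S i j). (\<forall>i\<in>I. y i \<preceq> x i) \<longrightarrow> c n (P 0 j) x = \<epsilon>"
    if y: "y \<in> Pi\<^sub>E I (\<lambda>i. S i n)" for n y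
  proof -
    have "\<exists>t\<in>T n i n. t \<preceq> y i" if i: "i \<in> I" for i
    proof -
      have "y i \<in> T n i (P n n)" using y i strong_sub[OF PS[OF i]] by blast
      moreover have "n \<le> P n n" using Pm strict_mono_imp_increasing by blast
      moreover have "tree (T n i)" using f(1)[of n] tr that strong_tree unfolding good_def T_def by blast
      ultimately show ?thesis using tree_down by blast
    qed
    then obtain t where t: "\<And>i. i \<in> I \<Longrightarrow> t i \<in> T n i n" "\<And>i. i \<in> I \<Longrightarrow> t i \<preceq> y i" by metis
    then have "restrict t I \<in> Pi\<^sub>E I (\<lambda>i. T n i n)" by simp
    from col[OF this] obtain \<epsilon> where \<epsilon>: "\<forall>j\<ge>n. \<forall>x\<in>Pi\<^sub>E I (\<lambda>i. T (Suc n) i j).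
        (\<forall>i\<in>I. t i \<preceq> x i) \<longrightarrow> c n (q (Suc n) j) x = \<epsilon>" by auto
    have "c n (P 0 j) x = \<epsilon>" if x: "j \<ge> n" "x \<in> Pi\<^sub>E I (\<lambda>i. S i j)" "\<forall>i\<in>I. y i \<preceq> x i" for j x
    proof -
      have "x \<in> Pi\<^sub>E I (\<lambda>i. T (Suc n) i (P (Suc n) j))"
        using x(2) by (auto simp: PiE_iff intro!: subsetD[OF strong_sub[OF PS]])
      moreover have "n \<le> P (Suc n) j" using x(1) Pm strict_mono_imp_increasing order_trans by blast
      moreover have "\<forall>i\<in>I. t i \<preceq> x i" using t(2) x(3) le_trans by blast
      ultimately show ?thesis using \<epsilon> PP[of j "Suc n"] by simp
    qed
    then show ?thesis by blast
  qed
  then show ?thesis using Pm[of 0] PS[of _ 0] T0 by (intro exI[of _ S] exI[of _ "P 0"]) simp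
qed

section \<open>Induction on the number of trees\<close>

lemma one_step_empty: "one_step {}"
  unfolding one_step_def by (intro allI impI exI[of _ 0] exI[of _ 1]) auto

text \<open>
Fix a branch through every node \<open>v\<close> of the new tree. After a fusion of the trees in \<open>I\<close>, the colour of
a product node together with the branch through \<open>v\<close> no longer changes above the level of \<open>v\<close>; this
defines the colour \<open>cs\<close>. If no pair of a colour and a root were good, one could build a branch of the
new tree that blocks all of them, against the dense theorem for \<open>I\<close>.
\<close>

lemma one_step_insert:
  fixes I :: "'i set"
  assumes one: "one_step I" "finite I" and i0: "i0 \<notin> I"
  shows "one_step (insert i0 I)"
  unfolding one_step_def
proof (intro allI impI)
  fix X :: "'i \<Rightarrow> nat \<Rightarrow> 'a set" and c :: "nat \<Rightarrow> ('i \<Rightarrow> 'a) \<Rightarrow> nat" and K :: nat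
  assume trX: "\<forall>i\<in>insert i0 I. tree (X i)" and c: "\<forall>n x. c n x < K"
  define V where "V = X i0"
  have V: "tree V" using trX by (simp add: V_def)
  have tr: "\<forall>i\<in>I. tree (X i)" using trX by simp
  define b where "b v m = (SOME y. y \<in> V m \<and> v \<preceq> y)" for v m
  have b: "b v m \<in> V m" "v \<preceq> b v m" if "v \<in> V n" "n \<le> m" for n v m
    using someI_ex[of "\<lambda>y. y \<in> V m \<and> v \<preceq> y"] tree_up[OF V that(2,1)] unfolding b_def by auto
  \<comment> \<open>The whole pattern of colours over \<open>V n\<close> is frozen at once, coded as
    a number because the fusion expects numbers as colours.\<close>
  define A where "A n = Pi\<^sub>E (V n) (\<lambda>_. {..<K})" for n
  have "\<exists>g N. g ` A n = {i. i < (N::nat)} \<and> inj_on g (A n)" for n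
    unfolding A_def by (rule finite_imp_inj_to_nat_seg) (simp add: finite_PiE tree_finite[OF V])
  then obtain g \<kappa> where g: "\<And>n. g n ` A n = {i. i < (\<kappa> n :: nat)}" "\<And>n. inj_on (g n) (A n)"
    by metis
  define pat where "pat n m x = restrict (\<lambda>v. c m (x(i0 := b v m))) (V n)" for n m x
  have pat: "pat n m x \<in> A n" for n m x using c by (simp add: pat_def A_def)
  then have "g n (pat n m x) < \<kappa> n" for n m x using g(1) by blast
  then obtain S P where P: "strict_mono P" and S: "\<forall>i\<in>I. strong (X i) (S i) P"
    and st: "\<And>n y. y \<in> Pi\<^sub>E I (\<lambda>i. S i n) \<Longrightarrow> \<exists>\<epsilon>. \<forall>j\<ge>n. \<forall>x\<in>Pi\<^sub>E I (\<lambda>i. S i j).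
        (\<forall>i\<in>I. y i \<preceq> x i) \<longrightarrow> g n (pat n (P j) x) = \<epsilon>"
    using strong_fusion[where X=X and c="\<lambda>n k x. g n (pat n k x)" and K=\<kappa>, OF one tr] by auto
  have trS: "\<forall>i\<in>I. tree (S i)" using S tr strong_tree by blast
  have Pge: "n \<le> P n" for n using P strict_mono_imp_increasing by blast
  define cs where "cs n y v = c (P n) (y(i0 := b v (P n)))" for n y v
  have stable: "c (P j) (x(i0 := b v (P j))) = cs n y v"
    if y: "y \<in> Pi\<^sub>E I (\<lambda>i. S i n)" and that': "n \<le> j" "x \<in> Pi\<^sub>E I (\<lambda>i. S i j)" "\<forall>i\<in>I. y i \<preceq> x i" "v \<in> V n" for n j x y v
  proof -
    obtain \<epsilon> where \<epsilon>: "\<forall>j\<ge>n. \<forall>x\<in>Pi\<^sub>E I (\<lambda>i. S i j).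
        (\<forall>i\<in>I. y i \<preceq> x i) \<longrightarrow> g n (pat n (P j) x) = \<epsilon>" using st[OF y] by blast
    have "g n (pat n (P j) x) = g n (pat n (P n) y)" using \<epsilon> y that' le_refl by simp
    then have "pat n (P j) x v = pat n (P n) y v" using inj_onD[OF g(2) _ pat pat] by metis
    then show ?thesis using that'(4) by (simp add: pat_def cs_def)
  qed
  define hit where "hit \<epsilon> t m j v' \<longleftrightarrow>
     (\<exists>D. (\<forall>i\<in>I. D i \<subseteq> S i j \<and> dense (S i m) (t i) (D i)) \<and> (\<forall>y\<in>Pi\<^sub>E I D. cs j y v' = \<epsilon>))"
    for \<epsilon> t m j v'
  \<comment> \<open>\<open>v\<close> blocks a colour and a root if some fixed density level
    \<open>m\<close> is never reached in this colour over any node above \<open>v\<close> from level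
    \<open>m\<close> on. Blocking passes to all nodes above \<open>v\<close>.\<close>
  define block where "block \<epsilon> t n v \<longleftrightarrow> (\<exists>m. \<forall>j\<ge>n. m \<le> j \<longrightarrow> (\<forall>v'\<in>V j. v \<preceq> v' \<longrightarrow>
     \<not> hit \<epsilon> t m j v'))"
    for \<epsilon> t n v
  have block_up: "block \<epsilon> t n' v'" if bl: "block \<epsilon> t n v" and n: "n \<le> n'" and v: "v \<preceq> v'" for \<epsilon> t n v n' v'
  proof -
    obtain m where "\<forall>j\<ge>n. m \<le> j \<longrightarrow> (\<forall>v'\<in>V j. v \<preceq> v' \<longrightarrow>
     \<not> hit \<epsilon> t m j v')"
      using bl unfolding block_def by blast
    moreover have "v \<preceq> w" if "v' \<preceq> w" for w using le_trans[OF v that] .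
    ultimately show ?thesis
      unfolding block_def using n order_trans[of n n'] by (intro exI[of _ m]) metis
  qed
  have "\<exists>\<epsilon> e n t v0. t \<in> Pi\<^sub>E I (\<lambda>i. S i e) \<and> v0 \<in> V n \<and> e \<le> n \<and>
     (\<forall>n'\<ge>n. \<forall>v\<in>V n'. v0 \<preceq> v \<longrightarrow> \<not> block \<epsilon> t n' v)"
  proof (rule ccontr)
    assume "\<not> ?thesis"
    then have neg: "\<exists>n'\<ge>n. \<exists>v\<in>V n'. v0 \<preceq> v \<and> block \<epsilon> t n' v"
      if "t \<in> Pi\<^sub>E I (\<lambda>i. S i e)" "v0 \<in> V n" "e \<le> n" for \<epsilon> e n t v0 using that by metis
    have all: "\<exists>n'\<ge>n. \<exists>v\<in>V n'. v0 \<preceq> v \<and> (\<forall>(\<epsilon>, t)\<in>B. block \<epsilon> t n' v)"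
      if B: "finite B" "B \<subseteq> UNIV \<times> Pi\<^sub>E I (\<lambda>i. S i e)" and v0: "v0 \<in> V n" "e \<le> n" for B e n v0
      using B
    proof (induction B rule: finite_induct)
      case empty
      then show ?case using v0 le_refl by blast
    next
      case (insert a B)
      obtain \<epsilon> t where a: "a = (\<epsilon>, t)" by fastforce
      from insert obtain n1 v1 where 1: "n1 \<ge> n" "v1 \<in> V n1" "v0 \<preceq> v1" "\<forall>(\<epsilon>, t)\<in>B. block \<epsilon> t n1 v1"
        by auto
      have t: "t \<in> Pi\<^sub>E I (\<lambda>i. S i e)" using insert a by simp
      obtain n2 v2 where 2: "n2 \<ge> n1" "v2 \<in> V n2" "v1 \<preceq> v2" "block \<epsilon> t n2 v2"
        using neg[OF t 1(2) order_trans[OF v0(2) 1(1)]] by blast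
      have "\<forall>(\<epsilon>, t)\<in>insert a B. block \<epsilon> t n2 v2"
        using a 2 1(4) block_up by blast
      then show ?case
        using order_trans[OF 1(1) 2(1)] 2(2) le_trans[OF 1(3) 2(3)] by blast
    qed
    have step: "\<exists>n'>n. \<exists>v\<in>V n'. v0 \<preceq> v \<and> (\<forall>\<epsilon><K. \<forall>t\<in>Pi\<^sub>E I (\<lambda>i. S i e). block \<epsilon> t n' v)"
      if v0: "v0 \<in> V n" "e \<le> n" for e n v0
    proof -
      let ?B = "{..<K} \<times> Pi\<^sub>E I (\<lambda>i. S i e)"
      obtain w where w: "w \<in> V (Suc n)" "v0 \<preceq> w" using tree_up[OF V, of n "Suc n"] v0(1) by auto
      have "finite ?B" using one(2) trS tree_finite by (simp add: finite_PiE)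
      then obtain n' v where "n' \<ge> Suc n" "v \<in> V n'" "w \<preceq> v" "\<forall>(\<epsilon>, t)\<in>?B. block \<epsilon> t n' v"
        using all[of ?B e w "Suc n"] w v0(2) by auto
      then show ?thesis using w le_trans by (intro exI[of _ n'] conjI bexI[of _ v]) auto
    qed
    obtain v00 where v00: "v00 \<in> V 0" using V unfolding tree_def by blast
    \<comment> \<open>The node chosen at stage \<open>e + 1\<close> blocks every colour and every
      root of level \<open>e\<close>. The predecessors \<open>B\<close> of the chosen nodes form the
      branch along which the dense theorem for \<open>I\<close> is contradicted.\<close>
    have "\<exists>f. \<forall>e. (snd (f e) \<in> V (fst (f e)) \<and> e \<le> fst (f e)) \<and>
       (fst (f e) < fst (f (Suc e)) \<and> snd (f e) \<preceq> snd (f (Suc e)) \<and>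
         (\<forall>\<epsilon><K. \<forall>t\<in>Pi\<^sub>E I (\<lambda>i. S i e). block \<epsilon> t (fst (f (Suc e))) (snd (f (Suc e)))))"
    proof (rule dependent_nat_choice)
      show "\<exists>x. snd x \<in> V (fst x) \<and> 0 \<le> fst x" using v00 by (intro exI[of _ "(0, v00)"]) simp
      fix x e assume x: "snd x \<in> V (fst x) \<and> e \<le> fst x"
      then obtain n' v where "n' > fst x" "v \<in> V n'" "snd x \<preceq> v"
        "\<forall>\<epsilon><K. \<forall>t\<in>Pi\<^sub>E I (\<lambda>i. S i e). block \<epsilon> t n' v" using step by blast
      then show "\<exists>y. (snd y \<in> V (fst y) \<and> Suc e \<le> fst y) \<and> (fst x < fst y \<and> snd x \<preceq> snd y \<and>
         (\<forall>\<epsilon><K. \<forall>t\<in>Pi\<^sub>E I (\<lambda>i. S i e). block \<epsilon> t (fst y) (snd y)))"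
        using x by (intro exI[of _ "(n', v)"]) simp
    qed
    then obtain f where f: "\<And>e. snd (f e) \<in> V (fst (f e))" "\<And>e. e \<le> fst (f e)"
      "\<And>e. snd (f e) \<preceq> snd (f (Suc e))"
      "\<And>e \<epsilon> t. \<epsilon> < K \<Longrightarrow> t\<in>Pi\<^sub>E I (\<lambda>i. S i e) \<Longrightarrow> block \<epsilon> t (fst (f (Suc e))) (snd (f (Suc e)))"
      by metis
    have fle: "snd (f e) \<preceq> snd (f k)" if "e \<le> k" for e k
      using that by (induction k rule: dec_induct) (use le_refl f(3) le_trans in blast)+
    have "\<exists>x\<in>V k. x \<preceq> snd (f k)" for k using tree_down[OF V f(2) f(1)] .
    then obtain B where B: "\<And>k. B k \<in> V k" "\<And>k. B k \<preceq> snd (f k)" by metis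
    have fB: "snd (f e) \<preceq> B k" if "fst (f e) \<le> k" for e k
      using tree_le[OF V f(1) B(1) that _ B(2)] fle f(2)[of e] that by (meson order_trans)
    have "cs n x v < K" for n x v using c by (simp add: cs_def)
    then obtain \<epsilon> e t where *: "\<epsilon> < K" "t \<in> Pi\<^sub>E I (\<lambda>i. S i e)"
      "\<And>m. m \<ge> e \<Longrightarrow> dense_mono I S (\<lambda>k y. cs k y (B k)) \<epsilon> t m"
      using dense_HL[where X=S and c="\<lambda>k y. cs k y (B k)" and K=K, OF one trS] by blast
    let ?n = "fst (f (Suc e))" and ?v = "snd (f (Suc e))"
    obtain m where m: "\<And>j v'. j \<ge> ?n \<Longrightarrow> m \<le> j \<Longrightarrow> v' \<in> V j \<Longrightarrow> ?v \<preceq> v' \<Longrightarrow>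
     \<not> hit \<epsilon> t m j v'"
      using f(4)[OF *(1,2)] unfolding block_def by blast
    define M where "M = max m (max ?n e)"
    have eM: "e \<le> M" by (simp add: M_def)
    obtain k D where kD: "k \<ge> M" "\<forall>i\<in>I. D i \<subseteq> S i k \<and> dense (S i M) (t i) (D i)"
      "\<forall>y\<in>Pi\<^sub>E I D. cs k y (B k) = \<epsilon>"
      using *(3)[OF eM] unfolding dense_mono_def by blast
    have "\<forall>i\<in>I. dense (S i m) (t i) (D i)"
      using kD(2) trS dense_antimono[of "S i" m M for i] unfolding M_def by simp
    moreover have "k \<ge> ?n" "m \<le> k" using kD(1) by (auto simp: M_def)
    ultimately have "hit \<epsilon> t m k (B k)" using kD(2,3) unfolding hit_def by blast
    then show False using m[of k "B k"] B(1) fB[of "Suc e" k] \<open>k \<ge> ?n\<close> \<open>m \<le> k\<close> by blast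
  qed
  then obtain \<epsilon> e n t v0 where t: "t \<in> Pi\<^sub>E I (\<lambda>i. S i e)" and v0: "v0 \<in> V n" and en: "e \<le> n"
    and nb: "\<And>n' v. n \<le> n' \<Longrightarrow> v \<in> V n' \<Longrightarrow> v0 \<preceq> v \<Longrightarrow> \<not> block \<epsilon> t n' v" by blast
  have "\<exists>y. i \<in> I \<longrightarrow> y \<in> S i n \<and> t i \<preceq> y" for i
    using tree_up[of "S i" e n "t i"] trS t en by (cases "i \<in> I") blast+
  then obtain t' where t': "\<And>i. i \<in> I \<Longrightarrow> t' i \<in> S i n" "\<And>i. i \<in> I \<Longrightarrow> t i \<preceq> t' i" by metis
  \<comment> \<open>The tree \<open>V\<close> itself was not thinned, so its root is taken at level
    \<open>P n\<close>, where level \<open>n\<close> of the subtrees lies.\<close>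
  obtain vs where vs: "vs \<in> V (P n)" "v0 \<preceq> vs" using tree_up[OF V Pge v0] by blast
  define W where "W = {w \<in> V (Suc (P n)). vs \<preceq> w}"
  have "finite W" using tree_finite[OF V] by (simp add: W_def)
  \<comment> \<open>The colour is demanded at all points above \<open>D\<close> on all later levels;
    in this form it survives when \<open>D\<close> is replaced by a set further up.\<close>
  define goal where "goal A j D \<longleftrightarrow> Suc n \<le> j \<and>
     (\<forall>i\<in>I. D i \<subseteq> S i j \<and> dense (S i (Suc n)) (t' i) (D i)) \<and>
     (\<forall>w\<in>A. \<exists>h\<le>j. \<exists>v\<in>V h. w \<preceq> v \<and> (\<forall>y\<in>Pi\<^sub>E I D. \<forall>l\<ge>j. \<forall>x\<in>Pi\<^sub>E I (\<lambda>i. S i l).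
        (\<forall>i\<in>I. y i \<preceq> x i) \<longrightarrow> c (P l) (x(i0 := b v (P l))) = \<epsilon>))" for A j D
  have "\<exists>j D. goal A j D" if "finite A" "A \<subseteq> W" for A
    using that
  proof (induction A rule: finite_induct)
    case empty
    have "goal {} (Suc n) (\<lambda>i. S i (Suc n))"
      using le_refl unfolding goal_def dense_def by blast
    then show ?case by blast
  next
    case (insert w A)
    then obtain j D where jD: "goal A j D" by blast
    have w: "w \<in> V (Suc (P n))" "v0 \<preceq> w" using insert vs(2) le_trans by (auto simp: W_def)
    have "\<not> block \<epsilon> t (Suc (P n)) w" using nb[OF _ w] Pge le_SucI by blast
    \<comment> \<open>Taking \<open>m = j\<close> yields a set that is dense over the level of
      \<open>D\<close>, so its part above \<open>D\<close> is still dense over level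
      \<open>Suc n\<close>.\<close>
    then obtain j' v' where j': "j' \<ge> Suc (P n)" "j \<le> j'" "v' \<in> V j'" "w \<preceq> v'"
      and "hit \<epsilon> t j j' v'"
      unfolding block_def by blast
    then obtain D' where D': "\<forall>i\<in>I. D' i \<subseteq> S i j' \<and> dense (S i j) (t i) (D' i)" "\<forall>y\<in>Pi\<^sub>E I D'. cs j' y v' = \<epsilon>"
      unfolding hit_def by blast
    define E where "E i = {y \<in> D' i. \<exists>x\<in>D i. x \<preceq> y}" for i
    have "goal (insert w A) j' E"
      unfolding goal_def
    proof (intro conjI ballI)
      show "Suc n \<le> j'" using jD j'(2) unfolding goal_def by simp
      show "E i \<subseteq> S i j'" if "i \<in> I" for i using D' that by (auto simp: E_def)
      show "dense (S i (Suc n)) (t' i) (E i)" if i: "i \<in> I" for i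
        unfolding dense_def
      proof (intro ballI impI)
        fix z assume z: "z \<in> S i (Suc n)" "t' i \<preceq> z"
        then obtain x where x: "x \<in> D i" "z \<preceq> x" using jD i unfolding goal_def dense_def by blast
        have "t i \<preceq> x" using t'(2)[OF i] z(2) x(2) le_trans by metis
        moreover have "x \<in> S i j" using jD i x(1) unfolding goal_def by blast
        ultimately obtain y where "y \<in> D' i" "x \<preceq> y" using D'(1) i unfolding dense_def by blast
        then show "\<exists>y\<in>E i. z \<preceq> y" using x le_trans[of z x y] unfolding E_def by blast
      qed
      fix w' assume w': "w' \<in> insert w A"
      show "\<exists>h\<le>j'. \<exists>v\<in>V h. w' \<preceq> v \<and> (\<forall>y\<in>Pi\<^sub>E I E. \<forall>l\<ge>j'. \<forall>x\<in>Pi\<^sub>E I (\<lambda>i. S i l).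
        (\<forall>i\<in>I. y i \<preceq> x i) \<longrightarrow> c (P l) (x(i0 := b v (P l))) = \<epsilon>)"
      proof (cases "w' = w")
        case True
        have "c (P l) (x(i0 := b v' (P l))) = \<epsilon>"
          if "y \<in> Pi\<^sub>E I E" "l \<ge> j'" "x \<in> Pi\<^sub>E I (\<lambda>i. S i l)" "\<forall>i\<in>I. y i \<preceq> x i" for y l x
        proof -
          have y: "y \<in> Pi\<^sub>E I D'" using that(1) by (auto simp: PiE_iff E_def)
          then have "y \<in> Pi\<^sub>E I (\<lambda>i. S i j')" using D'(1) by (auto simp: PiE_iff)
          then show ?thesis using stable[of y j' l x v'] that j'(3) D'(2) y by simp
        qed
        then show ?thesis using True j' by blast
      next
        case False
        then obtain h v where hv: "h \<le> j" "v \<in> V h" "w' \<preceq> v" and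
          col: "\<And>y l x. y\<in>Pi\<^sub>E I D \<Longrightarrow> l\<ge>j \<Longrightarrow> x\<in>Pi\<^sub>E I (\<lambda>i. S i l) \<Longrightarrow>
             (\<forall>i\<in>I. y i \<preceq> x i) \<Longrightarrow> c (P l) (x(i0 := b v (P l))) = \<epsilon>"
          using jD w' unfolding goal_def by blast
        have "c (P l) (x(i0 := b v (P l))) = \<epsilon>"
          if y: "y \<in> Pi\<^sub>E I E" "l \<ge> j'" "x \<in> Pi\<^sub>E I (\<lambda>i. S i l)" "\<forall>i\<in>I. y i \<preceq> x i" for y l x
        proof -
          have "\<exists>u\<in>D i. u \<preceq> y i" if "i \<in> I" for i using y(1) that by (auto simp: PiE_iff E_def)
          then obtain u where u: "\<And>i. i \<in> I \<Longrightarrow> u i \<in> D i" "\<And>i. i \<in> I \<Longrightarrow> u i \<preceq> y i" by metis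
          then have "restrict u I \<in> Pi\<^sub>E I D" by simp
          moreover have "\<forall>i\<in>I. restrict u I i \<preceq> x i" using u(2) y(4) le_trans by (metis restrict_apply')
          ultimately show ?thesis using col[of "restrict u I" l x] y j'(2) by simp
        qed
        then show ?thesis using hv j'(2) order_trans by blast
      qed
    qed
    then show ?case by blast
  qed
  then obtain j D where jD: "goal W j D" using \<open>finite W\<close> by blast
  define ok where "ok w h v \<longleftrightarrow> h \<le> j \<and> v \<in> V h \<and> w \<preceq> v \<and> (\<forall>y\<in>Pi\<^sub>E I D. \<forall>l\<ge>j. \<forall>x\<in>Pi\<^sub>E I (\<lambda>i. S i l).
        (\<forall>i\<in>I. y i \<preceq> x i) \<longrightarrow> c (P l) (x(i0 := b v (P l))) = \<epsilon>)" for w h v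
  have "\<forall>w\<in>W. \<exists>h v. ok w h v" using jD unfolding goal_def ok_def by blast
  then obtain h v where ok: "\<And>w. w \<in> W \<Longrightarrow> ok w (h w) (v w)" by metis
  then have hv: "\<And>w. w \<in> W \<Longrightarrow> h w \<le> j" "\<And>w. w \<in> W \<Longrightarrow> v w \<in> V (h w)"
      "\<And>w. w \<in> W \<Longrightarrow> w \<preceq> v w" and
      col: "\<And>w y l x. w \<in> W \<Longrightarrow> y\<in>Pi\<^sub>E I D \<Longrightarrow> l\<ge>j \<Longrightarrow> x\<in>Pi\<^sub>E I (\<lambda>i. S i l) \<Longrightarrow>
             (\<forall>i\<in>I. y i \<preceq> x i) \<Longrightarrow> c (P l) (x(i0 := b (v w) (P l))) = \<epsilon>"
    unfolding ok_def by blast+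
  have hP: "h w \<le> P j" if "w \<in> W" for w using hv(1)[OF that] Pge order_trans by blast
  \<comment> \<open>In the new coordinate every \<open>v w\<close> is moved up to the common level
    \<open>P j\<close>.\<close>
  define D' where "D' = D(i0 := (\<lambda>w. b (v w) (P j)) ` W)"
  define s where "s = restrict (t'(i0 := vs)) (insert i0 I)"
  have f1: "P n < P j" using jD P unfolding goal_def by (simp add: strict_mono_less)
  have f2: "s \<in> Pi\<^sub>E (insert i0 I) (\<lambda>i. X i (P n))"
  proof -
    have "t' i \<in> X i (P n)" if "i \<in> I" for i using t'(1)[OF that] S that strong_sub by blast
    then show ?thesis using vs(1) by (auto simp: s_def V_def)
  qed
  have f3: "D' i \<subseteq> X i (P j) \<and> dense (X i (Suc (P n))) (s i) (D' i)" if "i \<in> insert i0 I" for i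
  proof (cases "i = i0")
    case True
    have "D' i0 \<subseteq> V (P j)" using b(1)[OF hv(2) hP] by (auto simp: D'_def)
    moreover have "dense (V (Suc (P n))) vs (D' i0)"
      unfolding dense_def
    proof (intro ballI impI)
      fix z assume "z \<in> V (Suc (P n))" "vs \<preceq> z"
      then have z: "z \<in> W" by (simp add: W_def)
      then have "z \<preceq> b (v z) (P j)" using hv(3) b(2)[OF hv(2) hP] le_trans by blast
      then show "\<exists>y\<in>D' i0. z \<preceq> y" using z by (auto simp: D'_def)
    qed
    ultimately show ?thesis using True by (simp add: V_def s_def)
  next
    case False
    then have i: "i \<in> I" using that by simp
    have D: "D i \<subseteq> S i j" "dense (S i (Suc n)) (t' i) (D i)" using jD i unfolding goal_def by auto
    have "dense (X i (Suc (P n))) (t' i) (D i)"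
      unfolding dense_def
    proof (intro ballI impI)
      fix u assume u: "u \<in> X i (Suc (P n))" "t' i \<preceq> u"
      then obtain z where z: "z \<in> S i (Suc n)" "u \<preceq> z"
        using strong_succ[of "X i" "S i" P] S i t'(1)[OF i] by blast
      then obtain y where "y \<in> D i" "z \<preceq> y" using D(2) u(2) le_trans unfolding dense_def by metis
      then show "\<exists>y\<in>D i. u \<preceq> y" using z(2) le_trans by blast
    qed
    moreover have "D i \<subseteq> X i (P j)" using D(1) S i strong_sub by blast
    ultimately show ?thesis using i False by (simp add: s_def D'_def)
  qed
  have f4: "c (P j) x = \<epsilon>" if x: "x \<in> Pi\<^sub>E (insert i0 I) D'" for x
  proof -
    have "x i0 \<in> D' i0" using x by blast
    then obtain w where w: "w \<in> W" "x i0 = b (v w) (P j)" by (auto simp: D'_def)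
    have y: "restrict x I \<in> Pi\<^sub>E I D" using x i0 by (auto simp: PiE_iff D'_def split: if_splits)
    then have "restrict x I \<in> Pi\<^sub>E I (\<lambda>i. S i j)" using jD unfolding goal_def by (auto simp: PiE_iff)
    then have "c (P j) ((restrict x I)(i0 := x i0)) = \<epsilon>" using col[OF w(1) y, of j] w(2) le_refl by simp
    moreover have "(restrict x I)(i0 := x i0) = x"
      using x by (auto simp: PiE_iff extensional_def fun_eq_iff)
    ultimately show ?thesis by simp
  qed
  show "\<exists>p k s D \<epsilon>. p < k \<and> s \<in> Pi\<^sub>E (insert i0 I) (\<lambda>i. X i p) \<and>
        (\<forall>i\<in>insert i0 I. D i \<subseteq> X i k \<and> dense (X i (Suc p)) (s i) (D i)) \<and>
        (\<forall>x\<in>Pi\<^sub>E (insert i0 I) D. c k x = \<epsilon>)"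
    by (intro exI[of _ "P n"] exI[of _ "P j"] exI[of _ s] exI[of _ D'] exI[of _ \<epsilon>] conjI f1 f2 ballI f3 f4)
qed

theorem halpern_lauchli:
  assumes "finite I" "\<forall>i\<in>I. tree (X i)" "\<And>n x. c n x < (K::nat)"
  shows "\<exists>S p \<epsilon>. strict_mono p \<and> (\<forall>i\<in>I. strong (X i) (S i) p) \<and>
    (\<forall>n. \<forall>x\<in>Pi\<^sub>E I (\<lambda>i. S i n). c (p n) x = \<epsilon>)"
proof -
  have "one_step I"
    using assms(1) by (induction I rule: finite_induct) (auto intro: one_step_empty one_step_insert)
  then show ?thesis using strong_HL[of I X c K] assms by blast
qed

end

section \<open>Self-similar trees and their embeddings\<close>

text \<open>
A node of level \<open>m\<close> and grade \<open>k\<close> stands for a function on the subsets \<open>F\<close> of \<open>{..<m}\<close> with values below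
\<open>q (k + card F)\<close>. In \<open>Node x s\<close> with \<open>x\<close> of level \<open>m\<close>, the part \<open>x\<close> is the restriction to subsets of \<open>{..<m}\<close>
and \<open>s\<close>, of grade \<open>k + 1\<close>, lists the values at the sets \<open>insert m F\<close>.
\<close>

datatype node = Leaf nat nat | Node node node

primrec lev :: "node \<Rightarrow> nat" where
  "lev (Leaf k c) = 0"
| "lev (Node x s) = Suc (lev x)"

primrec grade :: "node \<Rightarrow> nat" where
  "grade (Leaf k c) = k"
| "grade (Node x s) = grade x"

primrec res :: "nat \<Rightarrow> node \<Rightarrow> node" where
  "res i (Leaf k c) = Leaf k c"
| "res i (Node x s) = (if i \<le> lev x then res i x else Node x s)"

definition ext :: "node \<Rightarrow> node \<Rightarrow> bool"  (infix "\<sqsubseteq>" 50) where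
  "x \<sqsubseteq> y \<longleftrightarrow> res (lev x) y = x"

text \<open>\<open>F\<close> is passed on unchanged; elements at or above the level of the node are
  ignored.\<close>

primrec val :: "node \<Rightarrow> nat set \<Rightarrow> nat" where
  "val (Leaf k c) F = c"
| "val (Node x s) F = (if lev x \<in> F then val s F else val x F)"

text \<open>Embeddings are built level by level: \<open>pick x z\<close> chooses the image of
  \<open>x\<close> above \<open>z\<close>, the node forced by the images of the two components of
  \<open>x\<close>.\<close>

primrec lift :: "(node \<Rightarrow> node \<Rightarrow> node) \<Rightarrow> node \<Rightarrow> node" where
  "lift pick (Leaf k c) = pick (Leaf k c) (Leaf k c)"
| "lift pick (Node x s) = pick (Node x s) (Node (lift pick x) (lift pick s))"

lemma lev_res: "lev (res i x) = min i (lev x)"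
  by (induction x) auto

lemma res_id: "lev x \<le> i \<Longrightarrow> res i x = x"
  by (induction x) auto

lemma res_res: "res i (res j x) = res (min i j) x"
  by (induction x) (auto simp: lev_res min_def res_id)

lemma ext_refl: "x \<sqsubseteq> x"
  by (simp add: ext_def res_id)

lemma ext_lev: "x \<sqsubseteq> y \<Longrightarrow> lev x \<le> lev y"
  unfolding ext_def using lev_res[of "lev x" y] by simp

lemma ext_trans: "x \<sqsubseteq> y \<Longrightarrow> y \<sqsubseteq> z \<Longrightarrow> x \<sqsubseteq> z"
  using ext_lev[of x y] unfolding ext_def by (metis min.absorb1 res_res)

interpretation ext: tree_order ext
  by unfold_locales (fact ext_refl, fact ext_trans)

lemma res_ext: "res i x \<sqsubseteq> x"
  by (simp add: ext_def lev_res min_def res_id)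

lemma grade_res: "grade (res i x) = grade x"
  by (induction x) auto

section \<open>The finitely branching trees of nodes and their embeddings\<close>

locale palette =
  fixes q :: "nat \<Rightarrow> nat"
  assumes q_ge_2: "2 \<le> q k"
begin

fun nodes :: "nat \<Rightarrow> nat \<Rightarrow> node set" where
  "nodes k 0 = {Leaf k c | c. c < q k}"
| "nodes k (Suc m) = {Node x s | x s. x \<in> nodes k m \<and> s \<in> nodes (Suc k) m}"

lemma nodes_lev: "x \<in> nodes k m \<Longrightarrow> lev x = m"
  by (induction k m arbitrary: x rule: nodes.induct) auto

lemma nodes_grade: "x \<in> nodes k m \<Longrightarrow> grade x = k"
  by (induction k m arbitrary: x rule: nodes.induct) auto

lemma nodes_finite: "finite (nodes k m)"
proof (induction k m rule: nodes.induct)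
  case (2 k m)
  have "nodes k (Suc m) = (\<lambda>(x, s). Node x s) ` (nodes k m \<times> nodes (Suc k) m)" by auto
  then show ?case using 2 by simp
qed auto

lemma nodes_nonempty: "\<exists>x. x \<in> nodes k m"
proof (induction k m rule: nodes.induct)
  case (1 k)
  then show ?case using q_ge_2[of k] by (auto intro!: exI[of _ 0])
next
  case (2 k m)
  then show ?case by auto
qed

lemma nodes_SucE:
  assumes "y \<in> nodes k (Suc m)"
  obtains x s where "y = Node x s" "x \<in> nodes k m" "s \<in> nodes (Suc k) m"
  using assms by auto

lemma nodes_res: "x \<in> nodes k m \<Longrightarrow> i \<le> m \<Longrightarrow> res i x \<in> nodes k i"
proof (induction m arbitrary: x)
  case (Suc m)
  then obtain y s where "x = Node y s" "y \<in> nodes k m" "s \<in> nodes (Suc k) m" by (auto elim: nodes_SucE)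
  then show ?case using Suc by (cases "i = Suc m") (auto simp: nodes_lev le_Suc_eq)
qed auto

lemma nodes_extend:
  assumes "x \<in> nodes k i" "i \<le> m"
  shows "\<exists>y\<in>nodes k m. x \<sqsubseteq> y"
  using assms(2)
proof (induction m rule: dec_induct)
  case base
  then show ?case using assms(1) ext_refl by blast
next
  case (step m)
  then obtain y where y: "y \<in> nodes k m" "x \<sqsubseteq> y" by blast
  obtain s where "s \<in> nodes (Suc k) m" using nodes_nonempty by blast
  moreover have "y \<sqsubseteq> Node y s" by (simp add: ext_def res_id)
  ultimately show ?case using y ext_trans by (intro bexI[of _ "Node y s"]) auto
qed

lemma nodes_tree: "ext.tree (nodes k)"
  unfolding ext.tree_def
proof (intro conjI allI ballI impI)
  show "finite (nodes k n)" for n by (rule nodes_finite)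
  show "nodes k 0 \<noteq> {}" using nodes_nonempty by blast
  show "\<exists>x\<in>nodes k n. x \<sqsubseteq> y" if "y \<in> nodes k (Suc n)" for n y
    using nodes_res[OF that, of n] res_ext[of n y] by auto
  show "\<exists>y\<in>nodes k (Suc n). x \<sqsubseteq> y" if "x \<in> nodes k n" for n x
    using nodes_extend[OF that, of "Suc n"] by (simp del: nodes.simps)
  show "x = x'" if "x \<in> nodes k n" "x' \<in> nodes k n" "x \<sqsubseteq> y" "x' \<sqsubseteq> y" for n x x' y
    using that by (metis ext_def nodes_lev)
qed

lemma val_cong:
  "x \<in> nodes k m \<Longrightarrow> (\<And>i. i < m \<Longrightarrow> i \<in> F \<longleftrightarrow> i \<in> G) \<Longrightarrow> val x F = val x G"
proof (induction m arbitrary: k x)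
  case (Suc m)
  obtain y s where x: "x = Node y s" "y \<in> nodes k m" "s \<in> nodes (Suc k) m"
    using Suc.prems(1) by (rule nodes_SucE)
  have "val y F = val y G" "val s F = val s G" using Suc.IH x Suc.prems(2) by simp_all
  then show ?case using x Suc.prems(2)[of m] by (simp add: nodes_lev)
qed auto

lemma val_res: "x \<in> nodes k m \<Longrightarrow> F \<subseteq> {..<i} \<Longrightarrow> val (res i x) F = val x F"
proof (induction m arbitrary: x)
  case (Suc m)
  then obtain y s where x: "x = Node y s" "y \<in> nodes k m" "s \<in> nodes (Suc k) m"
    using nodes_SucE by blast
  then show ?case using Suc by (auto simp: nodes_lev)
qed auto

text \<open>
An embedding also acts on the labels \<open>s\<close> of the successors of a node. This is why it preserves
\<open>val\<close> along \<open>l\<close>.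
\<close>

definition emb :: "(nat \<Rightarrow> nat) \<Rightarrow> (node \<Rightarrow> node) \<Rightarrow> bool" where
  "emb l \<Phi> \<longleftrightarrow> strict_mono l \<and> (\<forall>k m. \<forall>x\<in>nodes k m. \<Phi> x \<in> nodes k (l m)) \<and>
     (\<forall>k. \<forall>x\<in>nodes k 0. x \<sqsubseteq> \<Phi> x) \<and>
     (\<forall>k m. \<forall>x\<in>nodes k m. \<forall>s\<in>nodes (Suc k) m. Node (\<Phi> x) (\<Phi> s) \<sqsubseteq> \<Phi> (Node x s))"

lemma emb_mono: "emb l \<Phi> \<Longrightarrow> strict_mono l"
  and emb_nodes: "emb l \<Phi> \<Longrightarrow> x \<in> nodes k m \<Longrightarrow> \<Phi> x \<in> nodes k (l m)"
  and emb_Leaf: "emb l \<Phi> \<Longrightarrow> x \<in> nodes k 0 \<Longrightarrow> x \<sqsubseteq> \<Phi> x"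
  and emb_Node: "emb l \<Phi> \<Longrightarrow> x \<in> nodes k m \<Longrightarrow> s \<in> nodes (Suc k) m \<Longrightarrow> Node (\<Phi> x) (\<Phi> s) \<sqsubseteq> \<Phi> (Node x s)"
  by (auto simp: emb_def)

lemma emb_id: "emb (\<lambda>m. m) (\<lambda>x. x)"
  by (auto simp: emb_def ext_refl strict_mono_def)

lemma emb_ext:
  assumes "emb l \<Phi>" "x \<in> nodes k m" "y \<in> nodes k n" "x \<sqsubseteq> y"
  shows "\<Phi> x \<sqsubseteq> \<Phi> y"
  using assms(3,4)
proof (induction n arbitrary: y)
  case 0
  then have "m = 0" using ext_lev[of x y] assms(2) nodes_lev by fastforce
  then have "x = y" using 0 assms(2) nodes_lev by (auto simp: ext_def)
  then show ?case by (simp add: ext_refl)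
next
  case (Suc n)
  then obtain y' s where y: "y = Node y' s" "y' \<in> nodes k n" "s \<in> nodes (Suc k) n" by (auto elim: nodes_SucE)
  show ?case
  proof (cases "m \<le> n")
    case True
    then have "x \<sqsubseteq> y'" using Suc.prems y assms(2) by (simp add: ext_def nodes_lev)
    then have "\<Phi> x \<sqsubseteq> \<Phi> y'" using Suc.IH y by blast
    moreover have "\<Phi> y' \<sqsubseteq> Node (\<Phi> y') (\<Phi> s)" by (simp add: ext_def res_id)
    moreover have "Node (\<Phi> y') (\<Phi> s) \<sqsubseteq> \<Phi> y" using emb_Node[OF assms(1)] y by simp
    ultimately show ?thesis using ext_trans by blast
  next
    case False
    then have "x = y" using Suc.prems nodes_lev[OF assms(2)] nodes_lev[OF y(2)] by (simp add: ext_def y(1))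
    then show ?thesis by (simp add: ext_refl)
  qed
qed

lemma emb_comp:
  assumes "emb l \<Phi>" "emb l' \<Psi>"
  shows "emb (l \<circ> l') (\<Phi> \<circ> \<Psi>)"
  unfolding emb_def
proof (intro conjI allI ballI)
  show "strict_mono (l \<circ> l')" using assms by (simp add: emb_def strict_mono_def)
  show "(\<Phi> \<circ> \<Psi>) x \<in> nodes k ((l \<circ> l') m)" if "x \<in> nodes k m" for k m x
    using emb_nodes assms that by simp
  show "x \<sqsubseteq> (\<Phi> \<circ> \<Psi>) x" if "x \<in> nodes k 0" for k x
    using emb_ext[OF assms(1) that emb_nodes[OF assms(2) that] emb_Leaf[OF assms(2) that]]
      emb_Leaf[OF assms(1) that] ext_trans by simp
  fix k m x s assume xs: "x \<in> nodes k m" "s \<in> nodes (Suc k) m"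
  let ?y = "Node (\<Psi> x) (\<Psi> s)"
  have y: "\<Psi> x \<in> nodes k (l' m)" "\<Psi> s \<in> nodes (Suc k) (l' m)" using emb_nodes[OF assms(2)] xs by auto
  then have "?y \<in> nodes k (Suc (l' m))" by simp
  moreover have "\<Psi> (Node x s) \<in> nodes k (l' (Suc m))" using xs by (intro emb_nodes[OF assms(2)]) simp
  ultimately have "\<Phi> ?y \<sqsubseteq> \<Phi> (\<Psi> (Node x s))"
    using emb_ext[OF assms(1)] emb_Node[OF assms(2) xs] by blast
  then show "Node ((\<Phi> \<circ> \<Psi>) x) ((\<Phi> \<circ> \<Psi>) s) \<sqsubseteq> (\<Phi> \<circ> \<Psi>) (Node x s)"
    using emb_Node[OF assms(1) y] ext_trans by simp
qed

text \<open>If \<open>m\<close> lies in \<open>F\<close>, the value is read from the label. The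
  label of the image at level \<open>l m\<close> is the image of the label, so the induction applies
  at the next grade.\<close>

lemma emb_val:
  assumes "emb l \<Phi>"
  shows "x \<in> nodes k m \<Longrightarrow> F \<subseteq> {..<m} \<Longrightarrow> val (\<Phi> x) (l ` F) = val x F"
proof (induction m arbitrary: k x F)
  case 0
  then have "\<Phi> x \<in> nodes k (l 0)" "res 0 (\<Phi> x) = x"
    using emb_nodes[OF assms] emb_Leaf[OF assms, of x k] nodes_lev[of x k 0] by (simp_all add: ext_def)
  then show ?case using val_res[of "\<Phi> x" k "l 0" "{}" 0] 0 by simp
next
  case (Suc m)
  then obtain y s where x: "x = Node y s" "y \<in> nodes k m" "s \<in> nodes (Suc k) m"
    using nodes_SucE by blast
  let ?z = "Node (\<Phi> y) (\<Phi> s)"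
  have z: "\<Phi> y \<in> nodes k (l m)" "\<Phi> s \<in> nodes (Suc k) (l m)" using emb_nodes[OF assms] x by auto
  have l: "strict_mono l" using assms by (rule emb_mono)
  have "res (Suc (l m)) (\<Phi> x) = ?z"
    using emb_Node[OF assms x(2,3)] x(1) z by (simp add: ext_def nodes_lev)
  moreover have "\<Phi> x \<in> nodes k (l (Suc m))" using emb_nodes[OF assms] Suc.prems by blast
  moreover have "l ` F \<subseteq> {..<Suc (l m)}"
    using Suc.prems(2) l by (auto simp: less_Suc_eq_le strict_mono_less_eq)
  ultimately have 1: "val (\<Phi> x) (l ` F) = val ?z (l ` F)" using val_res by metis
  have F: "i \<in> l ` F \<longleftrightarrow> i \<in> l ` (F - {m})" if "i < l m" for i using that by auto
  have F': "F - {m} \<subseteq> {..<m}" using Suc.prems(2) by auto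
  have 2: "val y F = val y (F - {m})" "val s F = val s (F - {m})"
    by (rule val_cong[OF x(2)], simp) (rule val_cong[OF x(3)], simp)
  have 3: "val (\<Phi> y) (l ` F) = val (\<Phi> y) (l ` (F - {m}))"
    "val (\<Phi> s) (l ` F) = val (\<Phi> s) (l ` (F - {m}))"
    using val_cong[OF z(1)] val_cong[OF z(2)] F by blast+
  have "l m \<in> l ` F \<longleftrightarrow> m \<in> F" using l by (auto simp: strict_mono_eq)
  then have "val ?z (l ` F) = (if m \<in> F then val (\<Phi> s) (l ` F) else val (\<Phi> y) (l ` F))"
    using z by (simp add: nodes_lev)
  also have "\<dots> = (if m \<in> F then val s (F - {m}) else val y (F - {m}))"
    using Suc.IH[OF x(2) F'] Suc.IH[OF x(3) F'] by (simp only: 3)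
  also have "\<dots> = val x F" using nodes_lev[OF x(2)] by (simp only: 2[symmetric] x(1) val.simps)
  finally show ?case using 1 by simp
qed

lemma emb_inj:
  assumes "emb l \<Phi>"
  shows "x \<in> nodes k m \<Longrightarrow> x' \<in> nodes k m \<Longrightarrow> \<Phi> x = \<Phi> x' \<Longrightarrow> x = x'"
proof (induction m arbitrary: k x x')
  case 0
  then show ?case using emb_Leaf[OF assms] nodes_lev by (metis ext_def)
next
  case (Suc m)
  obtain y s where x: "x = Node y s" "y \<in> nodes k m" "s \<in> nodes (Suc k) m"
    using Suc.prems(1) by (rule nodes_SucE)
  obtain y' s' where x': "x' = Node y' s'" "y' \<in> nodes k m" "s' \<in> nodes (Suc k) m"
    using Suc.prems(2) by (rule nodes_SucE)
  have "lev (Node (\<Phi> y) (\<Phi> s)) = lev (Node (\<Phi> y') (\<Phi> s'))"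
    using emb_nodes[OF assms x(2)] emb_nodes[OF assms x'(2)] by (simp add: nodes_lev)
  then have "Node (\<Phi> y) (\<Phi> s) = Node (\<Phi> y') (\<Phi> s')"
    using emb_Node[OF assms x(2,3)] emb_Node[OF assms x'(2,3)] x(1) x'(1) Suc.prems(3)
    unfolding ext_def by metis
  then show ?case using Suc.IH x x' by simp
qed

text \<open>The invariant holds what the choices must remember about a node and its image; it is
  available for both components when the next image is chosen.\<close>

lemma lift_inv:
  assumes l: "strict_mono l"
    and leaf: "\<And>k x. x \<in> nodes k 0 \<Longrightarrow> pick x x \<in> nodes k (l 0) \<and> x \<sqsubseteq> pick x x \<and> Inv x (pick x x)"
    and node: "\<And>k m x s y t. x \<in> nodes k m \<Longrightarrow> s \<in> nodes (Suc k) m \<Longrightarrow> y \<in> nodes k (l m) \<Longrightarrow>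
       t \<in> nodes (Suc k) (l m) \<Longrightarrow> Inv x y \<Longrightarrow> Inv s t \<Longrightarrow>
       pick (Node x s) (Node y t) \<in> nodes k (l (Suc m)) \<and> Node y t \<sqsubseteq> pick (Node x s) (Node y t) \<and>
       Inv (Node x s) (pick (Node x s) (Node y t))"
  shows "emb l (lift pick) \<and> (\<forall>k m. \<forall>x\<in>nodes k m. Inv x (lift pick x))"
proof -
  have main: "x \<in> nodes k m \<Longrightarrow> lift pick x \<in> nodes k (l m) \<and> Inv x (lift pick x)" for k m x
  proof (induction m arbitrary: k x)
    case 0
    then show ?case using leaf[OF 0] by auto
  next
    case (Suc m)
    then obtain y s where x: "x = Node y s" "y \<in> nodes k m" "s \<in> nodes (Suc k) m"
    using nodes_SucE by blast
    then show ?case using node[OF x(2,3)] Suc.IH[OF x(2)] Suc.IH[OF x(3)] by simp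
  qed
  have "x \<sqsubseteq> lift pick x" if "x \<in> nodes k 0" for k x using leaf[OF that] that by auto
  moreover have "Node (lift pick x) (lift pick s) \<sqsubseteq> lift pick (Node x s)"
    if "x \<in> nodes k m" "s \<in> nodes (Suc k) m" for k m x s
    using node[OF that] main that by simp
  ultimately show ?thesis using main l unfolding emb_def by blast
qed

section \<open>Homogeneity over finitely many cones\<close>

definition fixes_below :: "nat \<Rightarrow> (nat \<Rightarrow> nat) \<Rightarrow> (node \<Rightarrow> node) \<Rightarrow> bool" where
  "fixes_below j l \<Psi> \<longleftrightarrow> (\<forall>m<j. l m = m \<and> (\<forall>k. \<forall>x\<in>nodes k m. \<Psi> x = x))"

text \<open>The Halpern-Laeuchli theorem is applied to the cones over \<open>R\<close>, whose roots
  may have different grades. Nodes above a root are sent into its strong subtree, which has an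
  element above every forced node \<open>Node y t\<close>; other nodes are extended
  arbitrarily.\<close>

lemma cone_homogeneous:
  fixes c :: "(node \<Rightarrow> node) \<Rightarrow> nat"
  assumes fin: "finite R" and R: "\<And>r. r \<in> R \<Longrightarrow> r \<in> nodes (grade r) j" and c: "\<And>x. c x < K"
  shows "\<exists>l \<Psi> \<epsilon>. emb l \<Psi> \<and> fixes_below j l \<Psi> \<and>
    (\<forall>m\<ge>j. \<forall>x\<in>Pi\<^sub>E R (\<lambda>r. \<Psi> ` {y \<in> nodes (grade r) m. r \<sqsubseteq> y}). c x = \<epsilon>)"
proof -
  define X where "X r n = {y \<in> nodes (grade r) (j + n). r \<sqsubseteq> y}" for r n
  have "\<forall>r\<in>R. ext.tree (X r)"
    using ext.tree_cone[OF nodes_tree R] unfolding X_def by simp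
  then obtain S p \<epsilon> where p: "strict_mono p" and S: "\<And>r. r \<in> R \<Longrightarrow> ext.strong (X r) (S r) p"
    and col: "\<And>n x. x \<in> Pi\<^sub>E R (\<lambda>r. S r n) \<Longrightarrow> c x = \<epsilon>"
    using ext.halpern_lauchli[where I=R and X=X and c="\<lambda>n. c" and K=K] fin c by blast
  define l where "l m = (if m < j then m else j + p (m - j))" for m
  have l: "strict_mono l"
    unfolding strict_mono_Suc_iff using p by (auto simp: l_def Suc_diff_le strict_mono_less)
  have S_nodes: "y \<in> nodes (grade r) (j + p n)" "r \<sqsubseteq> y" if "r \<in> R" "y \<in> S r n" for r y n
    using ext.strong_sub[OF S[OF that(1)], of n] that(2) by (auto simp: X_def)
  have S0: "\<exists>y. y \<in> S r 0" if "r \<in> R" for r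
    using S[OF that] unfolding ext.strong_def by blast
  define Inv where "Inv x y \<longleftrightarrow> (lev x < j \<longrightarrow> y = x) \<and>
     (lev x \<ge> j \<longrightarrow> res j x \<in> R \<longrightarrow> y \<in> S (res j x) (lev x - j))" for x y
  define pick where "pick x z = (SOME y. y \<in> nodes (grade x) (l (lev x)) \<and> z \<sqsubseteq> y \<and> Inv x y)" for x z
  have pickI: "pick x z \<in> nodes (grade x) (l (lev x)) \<and> z \<sqsubseteq> pick x z \<and> Inv x (pick x z)"
    if "y \<in> nodes (grade x) (l (lev x))" "z \<sqsubseteq> y" "Inv x y" for x y z
    unfolding pick_def by (rule someI[where x=y]) (use that in blast)
  have base: "pick x x \<in> nodes k (l m) \<and> x \<sqsubseteq> pick x x \<and> Inv x (pick x x)"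
    if x: "x \<in> nodes k m" and m: "m \<le> j" for k m x
  proof -
    have "\<exists>y. y \<in> nodes k (l m) \<and> x \<sqsubseteq> y \<and> Inv x y"
    proof (cases "m = j \<and> x \<in> R")
      case True
      then obtain y where "y \<in> S x 0" using S0 by blast
      then show ?thesis using True S_nodes[of x y 0] x
        by (intro exI[of _ y]) (auto simp: Inv_def l_def nodes_lev nodes_grade res_id)
    next
      case False
      show ?thesis
      proof (cases "m < j")
        case True
        then show ?thesis using x by (intro exI[of _ x]) (auto simp: Inv_def l_def nodes_lev ext_refl)
      next
        case nl: False
        have "m \<le> l m" using l strict_mono_imp_increasing by blast
        then obtain y where "y \<in> nodes k (l m)" "x \<sqsubseteq> y" using nodes_extend[OF x] by blast
        then show ?thesis using False nl m x
          by (intro exI[of _ y]) (auto simp: Inv_def nodes_lev res_id)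
      qed
    qed
    then show ?thesis using pickI[of _ x x] x by (auto simp: nodes_lev nodes_grade)
  qed
  have "emb l (lift pick) \<and> (\<forall>k m. \<forall>x\<in>nodes k m. Inv x (lift pick x))"
  proof (rule lift_inv[OF l])
    show "pick x x \<in> nodes k (l 0) \<and> x \<sqsubseteq> pick x x \<and> Inv x (pick x x)" if "x \<in> nodes k 0" for k x
      using base[OF that] by simp
    fix k m x s y t
    assume x: "x \<in> nodes k m" "s \<in> nodes (Suc k) m" and y: "y \<in> nodes k (l m)" "t \<in> nodes (Suc k) (l m)"
      and I: "Inv x y" "Inv s t"
    have x': "Node x s \<in> nodes k (Suc m)" using x by simp
    show "pick (Node x s) (Node y t) \<in> nodes k (l (Suc m)) \<and> Node y t \<sqsubseteq> pick (Node x s) (Node y t) \<and>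
       Inv (Node x s) (pick (Node x s) (Node y t))"
    proof (cases "Suc m \<le> j")
      case True
      then have "y = x" "t = s" using I x by (auto simp: Inv_def nodes_lev)
      then show ?thesis using base[OF x' True] by simp
    next
      case False
      then have m: "j \<le> m" by simp
      then have lm: "l m = j + p (m - j)" "l (Suc m) = j + p (Suc (m - j))"
        by (auto simp: l_def Suc_diff_le)
      have z: "Node y t \<in> nodes k (Suc (l m))" using y by simp
      have r: "res j (Node x s) = res j x" using x m by (simp add: nodes_lev)
      have "\<exists>w. w \<in> nodes k (l (Suc m)) \<and> Node y t \<sqsubseteq> w \<and> Inv (Node x s) w"
      proof (cases "res j x \<in> R")
        case True
        let ?r = "res j x"
        have g: "grade ?r = k" using x by (simp add: grade_res nodes_grade)
        have yS: "y \<in> S ?r (m - j)" using I True m x by (auto simp: Inv_def nodes_lev)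
        have yz: "y \<sqsubseteq> Node y t" by (simp add: ext_def res_id)
        have "?r \<sqsubseteq> Node y t" using S_nodes(2)[OF True yS] yz ext_trans by blast
        then have "Node y t \<in> X ?r (Suc (p (m - j)))" using z g lm by (simp add: X_def)
        then obtain w where w: "w \<in> S ?r (Suc (m - j))" "Node y t \<sqsubseteq> w"
          using ext.strong_succ[OF S[OF True] yS _ yz] by blast
        then have "w \<in> nodes k (l (Suc m))" using S_nodes(1)[OF True w(1)] g lm by simp
        then show ?thesis using w r m x by (intro exI[of _ w]) (auto simp: Inv_def Suc_diff_le nodes_lev)
      next
        case nR: False
        have "Suc (l m) \<le> l (Suc m)" using l by (simp add: Suc_le_eq strict_mono_less)
        then obtain w where "w \<in> nodes k (l (Suc m))" "Node y t \<sqsubseteq> w" using nodes_extend[OF z] by blast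
        then show ?thesis using nR r m x by (intro exI[of _ w]) (auto simp: Inv_def nodes_lev)
      qed
      then show ?thesis using pickI[of _ "Node x s" "Node y t"] x by (auto simp: nodes_lev nodes_grade)
    qed
  qed
  then have E: "emb l (lift pick)" and I: "\<And>k m x. x \<in> nodes k m \<Longrightarrow> Inv x (lift pick x)" by auto
  have "fixes_below j l (lift pick)"
    using I by (auto simp: fixes_below_def l_def Inv_def nodes_lev)
  moreover have "c x = \<epsilon>"
    if m: "m \<ge> j" and x: "x \<in> Pi\<^sub>E R (\<lambda>r. lift pick ` {y \<in> nodes (grade r) m. r \<sqsubseteq> y})" for m x
  proof -
    have "x r \<in> S r (m - j)" if r: "r \<in> R" for r
    proof -
      obtain y where y: "y \<in> nodes (grade r) m" "r \<sqsubseteq> y" "x r = lift pick y" using x r by blast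
      have "res j y = r" using y(2) R[OF r] by (simp add: ext_def nodes_lev)
      then show ?thesis using I[OF y(1)] y m r by (auto simp: Inv_def nodes_lev)
    qed
    then show ?thesis using col[of x "m - j"] x by (auto simp: PiE_iff)
  qed
  ultimately show ?thesis using E by blast
qed

subsection \<open>A Milliken-type theorem\<close>

text \<open>The bound on \<open>k + m\<close> makes this finite set closed under both components of a node.\<close>

definition below :: "nat \<Rightarrow> nat \<Rightarrow> node set" where
  "below G N = {x. \<exists>k m. m < N \<and> k + m \<le> G \<and> x \<in> nodes k m}"

text \<open>All images of nodes of level below \<open>N\<close> lie below this level, so a map that
  fixes the levels under it does not change them.\<close>

definition top_level :: "(nat \<Rightarrow> nat) \<Rightarrow> nat \<Rightarrow> nat" where
  "top_level l N = (case N of 0 \<Rightarrow> 0 | Suc n \<Rightarrow> Suc (l n))"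

lemma below_finite: "finite (below G N)"
proof (rule finite_subset)
  show "below G N \<subseteq> (\<Union>m<N. \<Union>k\<le>G. nodes k m)"
  proof
    fix x assume "x \<in> below G N"
    then obtain k m where "m < N" "k + m \<le> G" "x \<in> nodes k m" by (auto simp: below_def)
    moreover from this have "k \<le> G" by simp
    ultimately show "x \<in> (\<Union>m<N. \<Union>k\<le>G. nodes k m)" by blast
  qed
qed (simp add: nodes_finite)

lemma emb_level_below: "emb l \<phi> \<Longrightarrow> m < N \<Longrightarrow> l m < top_level l N"
  using emb_mono[of l \<phi>] by (cases N) (auto simp: top_level_def less_Suc_eq_le strict_mono_less_eq)

lemma emb_top_level: "emb l \<phi> \<Longrightarrow> top_level l N \<le> l N"
  using emb_mono[of l \<phi>] by (cases N) (auto simp: top_level_def Suc_le_eq strict_mono_less)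

text \<open>This is the infinite composition of \<open>\<Psi> n\<close>,
  \<open>\<Psi> (Suc n)\<close>, and so on. It makes sense because on nodes of level
  \<open>m\<close> all factors with index above \<open>m\<close> are the identity.\<close>

lemma emb_sequence_product:
  assumes e: "\<And>n. emb (l n) (\<Psi> n)" and f: "\<And>n. fixes_below n (l n) (\<Psi> n)"
  shows "\<exists>L \<Omega>. \<forall>n. emb (L n) (\<Omega> n) \<and> fixes_below n (L n) (\<Omega> n) \<and>
    (\<forall>k m. \<forall>x\<in>nodes k m. \<Omega> n x = \<Psi> n (\<Omega> (Suc n) x)) \<and> (\<forall>m. L n m = l n (L (Suc n) m))"
proof -
  define R where "R n d = rec_nat (\<lambda>n x. x) (\<lambda>d f n x. \<Psi> n (f (Suc n) x)) d n" for n d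
  define Rl where "Rl n d = rec_nat (\<lambda>n x. x) (\<lambda>d f n x. l n (f (Suc n) x)) d n" for n d
  have R: "R n 0 = (\<lambda>x. x)" "R n (Suc d) = \<Psi> n \<circ> R (Suc n) d"
    and Rl: "Rl n 0 = (\<lambda>x. x)" "Rl n (Suc d) = l n \<circ> Rl (Suc n) d" for n d
    by (auto simp: R_def Rl_def)
  have fl: "m < n \<Longrightarrow> l n m = m" and f\<Psi>: "m < n \<Longrightarrow> x \<in> nodes k m \<Longrightarrow> \<Psi> n x = x" for n m k x
    using f unfolding fixes_below_def by auto
  have RE: "emb (Rl n d) (R n d)" for n d
    by (induction d arbitrary: n) (auto simp: R Rl emb_id intro: emb_comp e)
  have Rst1: "R n (Suc d) x = R n d x" if "x \<in> nodes k m" "m < n + d" for n d x k m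
    using that
  proof (induction d arbitrary: n)
    case 0
    then show ?case using f\<Psi>[of m n x k] by (simp add: R)
  next
    case (Suc d)
    have "R n (Suc (Suc d)) x = \<Psi> n (R (Suc n) (Suc d) x)" by (simp add: R(2)[of n "Suc d"])
    also have "\<dots> = \<Psi> n (R (Suc n) d x)" using Suc.IH[of "Suc n"] Suc.prems by simp
    finally show ?case by (simp add: R(2)[of n d])
  qed
  have Rlst1: "Rl n (Suc d) m = Rl n d m" if "m < n + d" for n d m
    using that
  proof (induction d arbitrary: n)
    case 0
    then show ?case using fl[of m n] by (simp add: Rl)
  next
    case (Suc d)
    have "Rl n (Suc (Suc d)) m = l n (Rl (Suc n) (Suc d) m)" by (simp add: Rl(2)[of n "Suc d"])
    also have "\<dots> = l n (Rl (Suc n) d m)" using Suc.IH[of "Suc n"] Suc.prems by simp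
    finally show ?case by (simp add: Rl(2)[of n d])
  qed
  \<comment> \<open>\<open>Suc (lev x)\<close> factors suffice for every \<open>n\<close>, since the
    next factor has index \<open>n + Suc (lev x)\<close>, above the level of
    \<open>x\<close>.\<close>
  define \<Omega> where "\<Omega> n x = R n (Suc (lev x)) x" for n x
  define L where "L n m = Rl n (Suc m) m" for n m
  have \<Omega>R: "R n d x = \<Omega> n x" if "x \<in> nodes k m" "m < d" for n d x k m
  proof -
    have "Suc m \<le> d" using that by simp
    then show ?thesis
    proof (induction d rule: dec_induct)
      case base
      then show ?case using that by (simp add: \<Omega>_def nodes_lev)
    next
      case (step d)
      then show ?case using Rst1[OF that(1), of n d] by simp
    qed
  qed
  have LR: "Rl n d m = L n m" if "m < d" for n d m
  proof -
    have "Suc m \<le> d" using that by simp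
    then show ?thesis
    proof (induction d rule: dec_induct)
      case base
      then show ?case by (simp add: L_def)
    next
      case (step d)
      then show ?case using Rlst1[of m n d] by simp
    qed
  qed
  have "emb (L n) (\<Omega> n)" for n
    unfolding emb_def
  proof (intro conjI allI ballI)
    show "strict_mono (L n)"
      unfolding strict_mono_Suc_iff
    proof
      fix m show "L n m < L n (Suc m)"
        using emb_mono[OF RE[of n "Suc (Suc m)"]] LR[of m "Suc (Suc m)" n] LR[of "Suc m" "Suc (Suc m)" n]
        by (metis less_Suc_eq strict_mono_def)
    qed
    show "\<Omega> n x \<in> nodes k (L n m)" if "x \<in> nodes k m" for k m x
      using emb_nodes[OF RE[of n "Suc m"] that] \<Omega>R[OF that, of "Suc m" n] LR[of m "Suc m" n] by simp
    show "x \<sqsubseteq> \<Omega> n x" if "x \<in> nodes k 0" for k x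
      using emb_Leaf[OF RE[of n "Suc 0"] that] \<Omega>R[OF that, of "Suc 0" n] by simp
    show "Node (\<Omega> n x) (\<Omega> n s) \<sqsubseteq> \<Omega> n (Node x s)" if xs: "x \<in> nodes k m" "s \<in> nodes (Suc k) m" for k m x s
    proof -
      have "Node x s \<in> nodes k (Suc m)" using xs by simp
      then show ?thesis
        using emb_Node[OF RE[of n "Suc (Suc m)"] xs] \<Omega>R[OF xs(1), of "Suc (Suc m)" n]
          \<Omega>R[OF xs(2), of "Suc (Suc m)" n] \<Omega>R[of "Node x s" k "Suc m" "Suc (Suc m)" n] by simp
    qed
  qed
  moreover have "fixes_below n (L n) (\<Omega> n)" for n
    unfolding fixes_below_def
  proof (intro allI impI conjI ballI)
    fix m assume m: "m < n"
    have "Rl n' d m = m" if "m < n'" for n' d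
      using that by (induction d arbitrary: n') (auto simp: Rl fl)
    then show "L n m = m" using m by (simp add: L_def)
    fix k x assume x: "x \<in> nodes k m"
    have "R n' d x = x" if "m < n'" for n' d
      using that by (induction d arbitrary: n') (auto simp: R f\<Psi>[OF _ x])
    then show "\<Omega> n x = x" using m by (simp add: \<Omega>_def)
  qed
  moreover have "\<Omega> n x = \<Psi> n (\<Omega> (Suc n) x)" if x: "x \<in> nodes k m" for n k m x
    using \<Omega>R[OF x, of "Suc (Suc m)" n] \<Omega>R[OF x, of "Suc m" "Suc n"] R(2)[of n "Suc m"] by simp
  moreover have "L n m = l n (L (Suc n) m)" for n m
    using LR[of m "Suc (Suc m)" n] LR[of m "Suc m" "Suc n"] Rl(2)[of n "Suc m"] by simp
  ultimately show ?thesis by blast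
qed

text \<open>Once the part of \<open>\<phi>\<close> below level \<open>N\<close> is known to be
  \<open>e\<close>, the images of the nodes of level \<open>N\<close> range over cones with known
  roots, all at level \<open>j\<close>. The colour becomes a colouring of a product of
  cones.\<close>

lemma milliken_one:
  fixes \<chi> :: "(node \<Rightarrow> node) \<Rightarrow> nat"
  assumes loc: "\<And>\<phi> \<phi>'. (\<And>x. x \<in> below G (Suc N) \<Longrightarrow> \<phi> x = \<phi>' x) \<Longrightarrow> \<chi> \<phi> = \<chi> \<phi>'"
    and bd: "\<And>\<phi>. \<chi> \<phi> < K"
  shows "\<exists>l \<Psi> \<epsilon>. emb l \<Psi> \<and> fixes_below j l \<Psi> \<and> (\<forall>l' \<phi>. emb l' \<phi> \<longrightarrow> top_level l' N = j \<longrightarrow>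
    (\<forall>x\<in>below G N. \<phi> x = e x) \<longrightarrow> \<chi> (\<Theta> \<circ> \<Psi> \<circ> \<phi>) = \<epsilon>)"
proof (cases "\<exists>l0 \<phi>0. emb l0 \<phi>0 \<and> top_level l0 N = j \<and> (\<forall>x\<in>below G N. \<phi>0 x = e x)")
  case False
  moreover have "emb (\<lambda>m. m) (\<lambda>x. x) \<and> fixes_below j (\<lambda>m. m) (\<lambda>x. x)"
    using emb_id by (simp add: fixes_below_def)
  ultimately show ?thesis by blast
next
  case True
  then obtain l0 \<phi>0 where \<phi>0: "emb l0 \<phi>0" "top_level l0 N = j" "\<forall>x\<in>below G N. \<phi>0 x = e x" by blast
  define Y where "Y = {y. \<exists>k. k + N \<le> G \<and> y \<in> nodes k N}"
  \<comment> \<open>The root of the cone in which the image of \<open>y\<close> must lie; the images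
    of the two components of \<open>y\<close> force it.\<close>
  define r where "r y = (case y of Leaf k c \<Rightarrow> y | Node y' s \<Rightarrow> Node (\<phi>0 y') (\<phi>0 s))" for y
  have r: "r y \<in> nodes k j \<and> r y \<sqsubseteq> \<phi> y"
    if y: "y \<in> nodes k N" "k + N \<le> G" and \<phi>: "emb l' \<phi>" "top_level l' N = j" "\<forall>x\<in>below G N. \<phi> x = e x" for y k l' \<phi>
  proof (cases N)
    case 0
    then show ?thesis using y emb_Leaf[OF \<phi>(1), of y k] \<phi>(2) by (auto simp: r_def top_level_def)
  next
    case (Suc n)
    then obtain y' s where y': "y = Node y' s" "y' \<in> nodes k n" "s \<in> nodes (Suc k) n"
      using y(1) nodes_SucE by blast
    have "y' \<in> below G N" "s \<in> below G N" using y' y(2) Suc unfolding below_def by force+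
    then have "\<phi>0 y' = \<phi> y'" "\<phi>0 s = \<phi> s" using \<phi>0(3) \<phi>(3) by auto
    then show ?thesis
      using emb_Node[OF \<phi>(1) y'(2,3)] emb_nodes[OF \<phi>(1) y'(2)] emb_nodes[OF \<phi>(1) y'(3)] y'(1) \<phi>(2) Suc
      by (auto simp: r_def top_level_def)
  qed
  \<comment> \<open>Different nodes have different roots, so the tuple of images can be indexed by
    the roots.\<close>
  have inj: "inj_on r Y"
  proof (rule inj_onI)
    fix y y' assume y: "y \<in> Y" "y' \<in> Y" "r y = r y'"
    obtain k k' where k: "k + N \<le> G" "y \<in> nodes k N" "k' + N \<le> G" "y' \<in> nodes k' N"
      using y by (auto simp: Y_def)
    have "k = k'" using r[OF k(2,1) \<phi>0] r[OF k(4,3) \<phi>0] y(3) nodes_grade by metis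
    show "y = y'"
    proof (cases N)
      case 0
      then show ?thesis using k y(3) by (auto simp: r_def)
    next
      case (Suc n)
      then obtain u s u' s' where "y = Node u s" "y' = Node u' s'" "u \<in> nodes k n" "u' \<in> nodes k n"
        "s \<in> nodes (Suc k) n" "s' \<in> nodes (Suc k) n"
        using k(2,4) \<open>k = k'\<close> nodes_SucE by metis
      then show ?thesis using y(3) emb_inj[OF \<phi>0(1)] by (simp add: r_def)
    qed
  qed
  define c where "c x = \<chi> (\<lambda>y. \<Theta> (if lev y < N then \<phi>0 y else x (r y)))" for x
  have "Y \<subseteq> below G (Suc N)" by (auto simp: Y_def below_def)
  then have fin: "finite (r ` Y)" using below_finite finite_subset by blast
  have R: "\<rho> \<in> nodes (grade \<rho>) j" if "\<rho> \<in> r ` Y" for \<rho>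
    using that r[OF _ _ \<phi>0] nodes_grade by (fastforce simp: Y_def)
  have bdc: "c x < K" for x using bd by (simp add: c_def)
  have "\<exists>l \<Psi> \<epsilon>. emb l \<Psi> \<and> fixes_below j l \<Psi> \<and>
    (\<forall>m\<ge>j. \<forall>x\<in>Pi\<^sub>E (r ` Y) (\<lambda>\<rho>. \<Psi> ` {y \<in> nodes (grade \<rho>) m. \<rho> \<sqsubseteq> y}). c x = \<epsilon>)"
    by (rule cone_homogeneous[OF fin]) (fact R, fact bdc)
  then obtain l \<Psi> \<epsilon> where \<Psi>: "emb l \<Psi>" "fixes_below j l \<Psi>" and
    col: "\<forall>m\<ge>j. \<forall>x\<in>Pi\<^sub>E (r ` Y) (\<lambda>\<rho>. \<Psi> ` {y \<in> nodes (grade \<rho>) m. \<rho> \<sqsubseteq> y}). c x = \<epsilon>"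
    by (elim exE conjE) (rule that)
  have "\<chi> (\<Theta> \<circ> \<Psi> \<circ> \<phi>) = \<epsilon>" if \<phi>: "emb l' \<phi>" "top_level l' N = j" "\<forall>x\<in>below G N. \<phi> x = e x" for l' \<phi>
  proof -
    define x where "x = restrict (\<lambda>\<rho>. \<Psi> (\<phi> (inv_into Y r \<rho>))) (r ` Y)"
    have xr: "x (r y) = \<Psi> (\<phi> y)" if "y \<in> Y" for y using that inj by (simp add: x_def)
    have "x \<rho> \<in> \<Psi> ` {y \<in> nodes (grade \<rho>) (l' N). \<rho> \<sqsubseteq> y}" if \<rho>: "\<rho> \<in> r ` Y" for \<rho>
    proof -
      obtain y k where y: "\<rho> = r y" "y \<in> Y" "k + N \<le> G" "y \<in> nodes k N" using \<rho> by (auto simp: Y_def)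
      have "\<rho> \<in> nodes k j" "\<rho> \<sqsubseteq> \<phi> y" using r[OF y(4,3) \<phi>] y(1) by auto
      then show ?thesis using xr[OF y(2)] emb_nodes[OF \<phi>(1) y(4)] nodes_grade[of \<rho> k j] y(1) by simp
    qed
    then have "x \<in> Pi\<^sub>E (r ` Y) (\<lambda>\<rho>. \<Psi> ` {y \<in> nodes (grade \<rho>) (l' N). \<rho> \<sqsubseteq> y})"
      by (simp add: PiE_iff x_def)
    moreover have "j \<le> l' N" using emb_top_level[OF \<phi>(1), of N] \<phi>(2) by simp
    ultimately have "c x = \<epsilon>" using col by blast
    moreover have "\<chi> (\<Theta> \<circ> \<Psi> \<circ> \<phi>) = c x"
      unfolding c_def
    proof (rule loc)
      fix y assume "y \<in> below G (Suc N)"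
      then obtain k m where y: "m < Suc N" "k + m \<le> G" "y \<in> nodes k m" by (auto simp: below_def)
      show "(\<Theta> \<circ> \<Psi> \<circ> \<phi>) y = \<Theta> (if lev y < N then \<phi>0 y else x (r y))"
      proof (cases "m < N")
        case True
        have "y \<in> below G N" using y True by (auto simp: below_def)
        then have "\<phi> y = \<phi>0 y" using \<phi>0(3) \<phi>(3) by simp
        moreover have "\<Psi> (\<phi> y) = \<phi> y"
          using emb_nodes[OF \<phi>(1) y(3)] emb_level_below[OF \<phi>(1) True] \<phi>(2) \<Psi>(2)
          unfolding fixes_below_def by blast
        ultimately show ?thesis using True y(3) by (simp add: nodes_lev)
      next
        case False
        then have "m = N" using y(1) by simp
        then have "y \<in> Y" using y by (auto simp: Y_def)
        then show ?thesis using False y(3) xr by (simp add: nodes_lev)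
      qed
    qed
    ultimately show ?thesis by simp
  qed
  then show ?thesis using \<Psi> by blast
qed

text \<open>Only finitely many \<open>e\<close> occur for a given \<open>j\<close>, and they are
  treated in turn: a further map that fixes the levels below \<open>j\<close> changes neither
  \<open>e\<close> nor \<open>j\<close>, so constancy reached earlier is kept.\<close>

lemma milliken_stage:
  fixes \<chi> :: "(node \<Rightarrow> node) \<Rightarrow> nat"
  assumes loc: "\<And>\<phi> \<phi>'. (\<And>x. x \<in> below G (Suc N) \<Longrightarrow> \<phi> x = \<phi>' x) \<Longrightarrow> \<chi> \<phi> = \<chi> \<phi>'"
    and bd: "\<And>\<phi>. \<chi> \<phi> < K"
  shows "\<exists>l \<Psi>. emb l \<Psi> \<and> fixes_below j l \<Psi> \<and> (\<forall>e. \<exists>\<epsilon>. \<forall>l' \<phi>. emb l' \<phi> \<longrightarrow> top_level l' N = j \<longrightarrow>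
    (\<forall>x\<in>below G N. \<phi> x = e x) \<longrightarrow> \<chi> (\<Theta> \<circ> \<Psi> \<circ> \<phi>) = \<epsilon>)"
proof -
  let ?good = "\<lambda>\<Psi> e \<epsilon>. \<forall>l' \<phi>. emb l' \<phi> \<longrightarrow> top_level l' N = j \<longrightarrow>
    (\<forall>x\<in>below G N. \<phi> x = e x) \<longrightarrow> \<chi> (\<Theta> \<circ> \<Psi> \<circ> \<phi>) = \<epsilon>"
  define E where "E = Pi\<^sub>E (below G N) (\<lambda>_. \<Union>m<j. \<Union>k\<le>G. nodes k m)"
  have main: "\<exists>l \<Psi>. emb l \<Psi> \<and> fixes_below j l \<Psi> \<and> (\<forall>e\<in>A. \<exists>\<epsilon>. ?good \<Psi> e \<epsilon>)" if "finite A" for A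
    using that
  proof (induction A rule: finite_induct)
    case empty
    then show ?case using emb_id by (intro exI[of _ "\<lambda>m. m"] exI[of _ "\<lambda>x. x"]) (auto simp: fixes_below_def)
  next
    case (insert e A)
    then obtain l \<Psi> where \<Psi>: "emb l \<Psi>" "fixes_below j l \<Psi>" and old: "\<And>e. e \<in> A \<Longrightarrow> \<exists>\<epsilon>. ?good \<Psi> e \<epsilon>"
      by blast
    obtain l' \<Psi>' \<epsilon>' where \<Psi>': "emb l' \<Psi>'" "fixes_below j l' \<Psi>'" and new: "?good (\<Psi> \<circ> \<Psi>') e \<epsilon>'"
      using milliken_one[of G N \<chi> K j e "\<Theta> \<circ> \<Psi>", OF loc bd] by (auto simp: comp_assoc)
    have "\<exists>\<epsilon>. ?good (\<Psi> \<circ> \<Psi>') e' \<epsilon>" if e': "e' \<in> insert e A" for e'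
    proof (cases "e' = e")
      case True
      then show ?thesis using new by blast
    next
      case False
      then obtain \<epsilon> where \<epsilon>: "?good \<Psi> e' \<epsilon>" using old[of e'] e' by blast
      have "\<chi> (\<Theta> \<circ> (\<Psi> \<circ> \<Psi>') \<circ> \<phi>) = \<epsilon>"
        if \<phi>: "emb m \<phi>" "top_level m N = j" "\<forall>x\<in>below G N. \<phi> x = e' x" for m \<phi>
      proof -
        have "emb (l' \<circ> m) (\<Psi>' \<circ> \<phi>)" using emb_comp[OF \<Psi>'(1) \<phi>(1)] .
        moreover have "top_level (l' \<circ> m) N = j"
          using \<phi>(2) emb_level_below[OF \<phi>(1)] \<Psi>'(2) unfolding fixes_below_def top_level_def
          by (cases N) auto
        moreover have "(\<Psi>' \<circ> \<phi>) x = e' x" if x: "x \<in> below G N" for x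
        proof -
          obtain k n where "n < N" "x \<in> nodes k n" using x by (auto simp: below_def)
          then have "\<Psi>' (\<phi> x) = \<phi> x"
            using emb_nodes[OF \<phi>(1)] emb_level_below[OF \<phi>(1)] \<phi>(2) \<Psi>'(2)
            unfolding fixes_below_def by blast
          then show ?thesis using \<phi>(3) x by simp
        qed
        ultimately show ?thesis using \<epsilon> by (simp add: comp_assoc)
      qed
      then show ?thesis by blast
    qed
    moreover have "emb (l \<circ> l') (\<Psi> \<circ> \<Psi>')" using emb_comp \<Psi> \<Psi>' by blast
    moreover have "fixes_below j (l \<circ> l') (\<Psi> \<circ> \<Psi>')" using \<Psi>(2) \<Psi>'(2) by (simp add: fixes_below_def)
    ultimately show ?case by blast
  qed
  have "finite E" unfolding E_def by (intro finite_PiE below_finite) (simp add: nodes_finite)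
  from main[OF this] obtain l \<Psi> where \<Psi>: "emb l \<Psi>" "fixes_below j l \<Psi>"
    and good: "\<And>e. e \<in> E \<Longrightarrow> \<exists>\<epsilon>. ?good \<Psi> e \<epsilon>" by blast
  have "\<exists>\<epsilon>. ?good \<Psi> e \<epsilon>" for e
  proof (cases "\<exists>l' \<phi>. emb l' \<phi> \<and> top_level l' N = j \<and> (\<forall>x\<in>below G N. \<phi> x = e x)")
    case True
    then obtain l' \<phi> where \<phi>: "emb l' \<phi>" "top_level l' N = j" "\<forall>x\<in>below G N. \<phi> x = e x" by blast
    have "e x \<in> (\<Union>m<j. \<Union>k\<le>G. nodes k m)" if x: "x \<in> below G N" for x
    proof -
      obtain k m where "m < N" "k + m \<le> G" "x \<in> nodes k m" using x by (auto simp: below_def)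
      then have "e x \<in> nodes k (l' m)" "l' m < j" "k \<le> G"
        using emb_nodes[OF \<phi>(1)] emb_level_below[OF \<phi>(1)] \<phi>(2,3) x by force+
      then show ?thesis by blast
    qed
    then have "restrict e (below G N) \<in> E" by (simp add: E_def)
    from good[OF this] show ?thesis by simp
  qed blast
  then show ?thesis using \<Psi> by blast
qed

text \<open>Composing over all stages \<open>j\<close> makes the colour depend only on the part of
  the embedding below level \<open>N\<close>. This gives a colouring with one level less, to which
  the induction hypothesis applies.\<close>

theorem milliken:
  fixes \<chi> :: "(node \<Rightarrow> node) \<Rightarrow> nat"
  assumes "N \<le> Suc G"
    and "\<And>\<phi> \<phi>'. (\<And>x. x \<in> below G N \<Longrightarrow> \<phi> x = \<phi>' x) \<Longrightarrow> \<chi> \<phi> = \<chi> \<phi>'"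
    and "\<And>\<phi>. \<chi> \<phi> < K"
  shows "\<exists>l \<Phi> \<epsilon>. emb l \<Phi> \<and> (\<forall>l' \<phi>. emb l' \<phi> \<longrightarrow> \<chi> (\<Phi> \<circ> \<phi>) = \<epsilon>)"
  using assms
proof (induction N arbitrary: \<chi>)
  case 0
  have "\<chi> \<phi> = \<chi> id" for \<phi> by (rule "0.prems"(2)) (simp add: below_def)
  then show ?case using emb_id by blast
next
  case (Suc N)
  note loc = Suc.prems(2) and bd = Suc.prems(3)
  let ?good = "\<lambda>\<Phi> j e \<epsilon>. \<forall>l' \<phi>. emb l' \<phi> \<longrightarrow> top_level l' N = j \<longrightarrow>
    (\<forall>x\<in>below G N. \<phi> x = e x) \<longrightarrow> \<chi> (\<Phi> \<circ> \<phi>) = \<epsilon>"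
  define step where "step n a b l \<Psi> \<longleftrightarrow> emb l \<Psi> \<and> fixes_below n l \<Psi> \<and> b = a \<circ> \<Psi> \<and>
    (\<forall>e. \<exists>\<epsilon>. ?good b n e \<epsilon>)" for n a b l \<Psi>
  have "\<exists>f. \<forall>n. (n = 0 \<longrightarrow> f n = id) \<and> (\<exists>l \<Psi>. step n (f n) (f (Suc n)) l \<Psi>)"
  proof (rule dependent_nat_choice)
    show "\<exists>x. 0 = 0 \<longrightarrow> x = id" by blast
    fix a :: "node \<Rightarrow> node" and n :: nat
    obtain l \<Psi> where \<Psi>: "emb l \<Psi>" "fixes_below n l \<Psi>" "\<forall>e. \<exists>\<epsilon>. ?good (a \<circ> \<Psi>) n e \<epsilon>"
      using milliken_stage[of G N \<chi> K n a, OF loc bd] by blast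
    then have "step n a (a \<circ> \<Psi>) l \<Psi>" unfolding step_def by blast
    then show "\<exists>y. (Suc n = 0 \<longrightarrow> y = id) \<and> (\<exists>l \<Psi>. step n a y l \<Psi>)" by blast
  qed
  then obtain f where f0: "f 0 = id" and f: "\<And>n. \<exists>l \<Psi>. step n (f n) (f (Suc n)) l \<Psi>" by blast
  from f obtain l \<Psi> where st: "\<And>n. step n (f n) (f (Suc n)) (l n) (\<Psi> n)" by metis
  have e: "\<And>n. emb (l n) (\<Psi> n)" and fb: "\<And>n. fixes_below n (l n) (\<Psi> n)"
    and fS: "\<And>n. f (Suc n) = f n \<circ> \<Psi> n" and good: "\<And>n e. \<exists>\<epsilon>. ?good (f (Suc n)) n e \<epsilon>"
    using st unfolding step_def by blast+
  obtain L \<Omega> where \<Omega>: "\<And>n. emb (L n) (\<Omega> n)" "\<And>n. fixes_below n (L n) (\<Omega> n)"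
    "\<And>n k m x. x \<in> nodes k m \<Longrightarrow> \<Omega> n x = \<Psi> n (\<Omega> (Suc n) x)"
    using emb_sequence_product[of l \<Psi>, OF e fb] by blast
  have f\<Omega>: "\<Omega> 0 x = f n (\<Omega> n x)" if "x \<in> nodes k m" for n k m x
    by (induction n) (use that in \<open>simp_all add: f0 fS \<Omega>(3)[symmetric]\<close>)
  have homog: "\<exists>\<epsilon>. ?good (\<Omega> 0) j e \<epsilon>" for j e
  proof -
    obtain \<epsilon> where \<epsilon>: "?good (f (Suc j)) j e \<epsilon>" using good by blast
    have "\<chi> (\<Omega> 0 \<circ> \<phi>) = \<epsilon>"
      if \<phi>: "emb l' \<phi>" "top_level l' N = j" "\<forall>x\<in>below G N. \<phi> x = e x" for l' \<phi>
    proof -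
      let ?\<Omega> = "\<Omega> (Suc j)"
      have "emb (L (Suc j) \<circ> l') (?\<Omega> \<circ> \<phi>)" using emb_comp[OF \<Omega>(1) \<phi>(1)] .
      moreover have "top_level (L (Suc j) \<circ> l') N = j"
        using \<phi>(2) emb_level_below[OF \<phi>(1)] \<Omega>(2)[of "Suc j"] unfolding fixes_below_def top_level_def
        by (cases N) auto
      moreover have "(?\<Omega> \<circ> \<phi>) x = e x" if x: "x \<in> below G N" for x
      proof -
        obtain k n where n: "n < N" "x \<in> nodes k n" using x by (auto simp: below_def)
        have "l' n < Suc j" using emb_level_below[OF \<phi>(1) n(1)] \<phi>(2) by simp
        then have "?\<Omega> (\<phi> x) = \<phi> x"
          using emb_nodes[OF \<phi>(1) n(2)] \<Omega>(2)[of "Suc j"] unfolding fixes_below_def by blast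
        then show ?thesis using \<phi>(3) x by simp
      qed
      ultimately have "\<chi> (f (Suc j) \<circ> (?\<Omega> \<circ> \<phi>)) = \<epsilon>" using \<epsilon> by blast
      moreover have "\<chi> (\<Omega> 0 \<circ> \<phi>) = \<chi> (f (Suc j) \<circ> (?\<Omega> \<circ> \<phi>))"
      proof (rule loc)
        fix x assume "x \<in> below G (Suc N)"
        then obtain k n where n: "x \<in> nodes k n" by (auto simp: below_def)
        show "(\<Omega> 0 \<circ> \<phi>) x = (f (Suc j) \<circ> (?\<Omega> \<circ> \<phi>)) x"
          using f\<Omega>[OF emb_nodes[OF \<phi>(1) n]] by simp
      qed
      ultimately show ?thesis by simp
    qed
    then show ?thesis by blast
  qed
  have agree: "\<chi> (\<Omega> 0 \<circ> \<phi>1) = \<chi> (\<Omega> 0 \<circ> \<phi>2)"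
    if \<phi>: "emb l1 \<phi>1" "emb l2 \<phi>2" "\<forall>x\<in>below G N. \<phi>1 x = \<phi>2 x" for l1 \<phi>1 l2 \<phi>2
  proof -
    have "top_level l1 N = top_level l2 N"
    proof (cases N)
      case 0
      then show ?thesis by (simp add: top_level_def)
    next
      case (Suc n)
      \<comment> \<open>Here the bound on \<open>N\<close> in terms of \<open>G\<close> enters: a
        node of grade 0 and level \<open>n\<close> belongs to \<open>below G N\<close>, so equal
        restrictions have equal top levels.\<close>
      obtain x where x: "x \<in> nodes 0 n" using nodes_nonempty by blast
      have "x \<in> below G N" using x Suc Suc.prems(1) unfolding below_def by force
      then have "\<phi>1 x = \<phi>2 x" using \<phi>(3) by blast
      then have "l1 n = l2 n" using emb_nodes[OF \<phi>(1) x] emb_nodes[OF \<phi>(2) x] nodes_lev by metis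
      then show ?thesis using Suc by (simp add: top_level_def)
    qed
    then show ?thesis using homog[of "top_level l1 N" \<phi>2] \<phi> by metis
  qed
  define P where "P g \<phi> \<longleftrightarrow> (\<exists>l. emb l \<phi>) \<and> (\<forall>x\<in>below G N. \<phi> x = g x)" for g \<phi>
  \<comment> \<open>The induction hypothesis speaks of a colouring of all functions; those that
    agree with no embedding on \<open>below G N\<close> get a default.\<close>
  define \<chi>' where "\<chi>' g = (if \<exists>\<phi>. P g \<phi> then \<chi> (\<Omega> 0 \<circ> (SOME \<phi>. P g \<phi>)) else \<chi> id)" for g
  have loc': "\<chi>' g = \<chi>' g'" if "\<And>x. x \<in> below G N \<Longrightarrow> g x = g' x" for g g'
  proof -
    have "P g = P g'" using that by (simp add: P_def fun_eq_iff)
    then show ?thesis unfolding \<chi>'_def by (simp only:)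
  qed
  have bd': "\<chi>' g < K" for g using bd by (simp add: \<chi>'_def)
  have "N \<le> Suc G" using Suc.prems(1) by simp
  then have "\<exists>l \<Phi> \<epsilon>. emb l \<Phi> \<and> (\<forall>l' \<phi>. emb l' \<phi> \<longrightarrow> \<chi>' (\<Phi> \<circ> \<phi>) = \<epsilon>)"
  proof (rule Suc.IH)
    show "\<chi>' g = \<chi>' g'" if "\<And>x. x \<in> below G N \<Longrightarrow> g x = g' x" for g g'
      by (rule loc') (rule that)
  qed (rule bd')
  then obtain l0 \<Phi>0 \<epsilon> where \<Phi>0: "emb l0 \<Phi>0" "\<And>l' \<phi>. emb l' \<phi> \<Longrightarrow> \<chi>' (\<Phi>0 \<circ> \<phi>) = \<epsilon>"
    by blast
  have "\<chi> ((\<Omega> 0 \<circ> \<Phi>0) \<circ> \<phi>) = \<epsilon>" if \<phi>: "emb l' \<phi>" for l' \<phi>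
  proof -
    have E: "emb (l0 \<circ> l') (\<Phi>0 \<circ> \<phi>)" using emb_comp[OF \<Phi>0(1) \<phi>] .
    then have ex: "P (\<Phi>0 \<circ> \<phi>) (\<Phi>0 \<circ> \<phi>)" by (auto simp: P_def)
    define \<psi> where "\<psi> = (SOME \<psi>. P (\<Phi>0 \<circ> \<phi>) \<psi>)"
    have "P (\<Phi>0 \<circ> \<phi>) \<psi>" unfolding \<psi>_def by (rule someI[of "P (\<Phi>0 \<circ> \<phi>)", OF ex])
    then obtain l1 where "emb l1 \<psi>" "\<forall>x\<in>below G N. (\<Phi>0 \<circ> \<phi>) x = \<psi> x" by (auto simp: P_def)
    then have "\<chi> (\<Omega> 0 \<circ> (\<Phi>0 \<circ> \<phi>)) = \<chi> (\<Omega> 0 \<circ> \<psi>)" by (rule agree[OF E])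
    also have "\<dots> = \<chi>' (\<Phi>0 \<circ> \<phi>)" using ex unfolding \<chi>'_def \<psi>_def by (metis (no_types))
    also have "\<dots> = \<epsilon>" using \<Phi>0(2)[OF \<phi>] .
    finally show ?thesis by (simp add: comp_assoc)
  qed
  moreover have "emb (L 0 \<circ> l0) (\<Omega> 0 \<circ> \<Phi>0)" using emb_comp \<Omega>(1) \<Phi>0(1) by blast
  ultimately show ?case by blast
qed

end

section \<open>Envelopes\<close>

fun mk :: "nat \<Rightarrow> nat \<Rightarrow> (nat set \<Rightarrow> nat) \<Rightarrow> node" where
  "mk k 0 f = Leaf k (f {})"
| "mk k (Suc m) f = Node (mk k m f) (mk (Suc k) m (\<lambda>F. f (insert m F)))"

lemma lev_mk [simp]: "lev (mk k m f) = m"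
  by (induction k m f rule: mk.induct) auto

lemma grade_mk [simp]: "grade (mk k m f) = k"
  by (induction k m f rule: mk.induct) auto

lemma mk_cong: "(\<And>F. F \<subseteq> {..<m} \<Longrightarrow> f F = g F) \<Longrightarrow> mk k m f = mk k m g"
proof (induction m arbitrary: k f g)
  case (Suc m)
  have "mk k m f = mk k m g" by (rule Suc.IH) (rule Suc.prems, auto)
  moreover have "mk (Suc k) m (\<lambda>F. f (insert m F)) = mk (Suc k) m (\<lambda>F. g (insert m F))"
    by (rule Suc.IH) (rule Suc.prems, auto)
  ultimately show ?case by simp
qed simp

lemma val_mk: "F \<subseteq> {..<m} \<Longrightarrow> val (mk k m f) F = f F"
proof (induction m arbitrary: k f F)
  case (Suc m)
  show ?case
  proof (cases "m \<in> F")
    case True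
    \<comment> \<open>The label has level \<open>m\<close>, so \<open>m\<close> can be removed from
      the argument.\<close>
    have "val (mk (Suc k) m (\<lambda>F. f (insert m F))) F = val (mk (Suc k) m (\<lambda>F. f (insert m F))) (F - {m})"
    proof -
      have "val (mk k' m' g) F = val (mk k' m' g) (F - {m})" if "m' \<le> m" for k' m' g
        using that by (induction k' m' g rule: mk.induct) auto
      then show ?thesis by simp
    qed
    also have "\<dots> = f (insert m (F - {m}))" using Suc by (intro Suc.IH) auto
    finally show ?thesis using True by (simp add: insert_absorb)
  next
    case False
    then have "F \<subseteq> {..<m}" using Suc.prems by (auto simp: less_Suc_eq)
    then show ?thesis using False Suc.IH by simp
  qed
qed simp

lemma mk_inject: "mk k m f = mk k' m g \<Longrightarrow> F \<subseteq> {..<m} \<Longrightarrow> f F = g F"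
  by (metis val_mk)

lemma res_mk: "i \<le> m \<Longrightarrow> res i (mk k m f) = mk k i f"
proof (induction m)
  case (Suc m)
  then show ?case by (cases "i = Suc m") (auto simp: le_Suc_eq)
qed simp

context palette
begin

lemma mk_nodes: "(\<And>F. F \<subseteq> {..<m} \<Longrightarrow> f F < q (k + card F)) \<Longrightarrow> mk k m f \<in> nodes k m"
proof (induction m arbitrary: k f)
  case 0
  then show ?case using "0.prems"[of "{}"] by simp
next
  case (Suc m)
  have "mk k m f \<in> nodes k m" by (rule Suc.IH) (rule Suc.prems, auto)
  moreover have "mk (Suc k) m (\<lambda>F. f (insert m F)) \<in> nodes (Suc k) m"
  proof (rule Suc.IH)
    fix F :: "nat set" assume F: "F \<subseteq> {..<m}"
    then have "card (insert m F) = Suc (card F)" using finite_subset by (subst card_insert_disjoint) auto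
    moreover have "insert m F \<subseteq> {..<Suc m}" using F by auto
    ultimately show "f (insert m F) < q (Suc k + card F)" using Suc.prems[of "insert m F"] by simp
  qed
  ultimately show ?case by simp
qed

text \<open>The levels in the range of \<open>l\<close> give a compressed picture of each function
  of the family. By \<open>sep\<close> the picture determines the function up to level
  \<open>l m\<close>, so it has a well-defined image; by \<open>closed\<close> the label of the
  image at \<open>l m\<close> is the image of a picture of the next grade.\<close>

lemma emb_realizing:
  assumes l: "strict_mono l"
    and wf: "\<And>k e f F. Fam k e f \<Longrightarrow> F \<subseteq> {..<e} \<Longrightarrow> f F < q (k + card F)"
    and down: "\<And>k e e' f. Fam k e f \<Longrightarrow> e' \<le> e \<Longrightarrow> Fam k e' f"
    and closed: "\<And>k m f. Fam k (l (Suc m)) f \<Longrightarrow>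
      \<exists>g. Fam (Suc k) (l m) g \<and> (\<forall>F\<subseteq>{..<l m}. g F = f (insert (l m) F))"
    and sep: "\<And>k m f g F. Fam k (l m) f \<Longrightarrow> Fam k (l m) g \<Longrightarrow> (\<And>F. F \<subseteq> {..<m} \<Longrightarrow> f (l ` F) = g (l ` F)) \<Longrightarrow>
      F \<subseteq> {..<l m} \<Longrightarrow> f F = g F"
  shows "\<exists>\<Phi>. emb l \<Phi> \<and> (\<forall>k m f. Fam k (l m) f \<longrightarrow> mk k m (\<lambda>F. f (l ` F)) \<in> nodes k m \<and>
    \<Phi> (mk k m (\<lambda>F. f (l ` F))) = mk k (l m) f)"
proof -
  let ?mk = "\<lambda>k m f. mk k m (\<lambda>F. f (l ` F))"
  have img: "l ` F \<subseteq> {..<l m}" if "F \<subseteq> {..<m}" for F m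
    using that l by (auto simp: strict_mono_less)
  define Inv where "Inv x y \<longleftrightarrow> (\<forall>f. Fam (grade x) (l (lev x)) f \<longrightarrow> x = ?mk (grade x) (lev x) f \<longrightarrow>
     y = mk (grade x) (l (lev x)) f)" for x y
  define pick where "pick x z = (SOME y. y \<in> nodes (grade x) (l (lev x)) \<and> z \<sqsubseteq> y \<and> Inv x y)" for x z
  have pickI: "pick x z \<in> nodes k (l m) \<and> z \<sqsubseteq> pick x z \<and> Inv x (pick x z)"
    if x: "x \<in> nodes k m" and z: "z \<in> nodes k i" "i \<le> l m"
      and ext: "\<And>f. Fam k (l m) f \<Longrightarrow> x = ?mk k m f \<Longrightarrow> z \<sqsubseteq> mk k (l m) f" for x z k m i
  proof -
    have "\<exists>y. y \<in> nodes k (l m) \<and> z \<sqsubseteq> y \<and> Inv x y"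
    proof (cases "\<exists>f. Fam k (l m) f \<and> x = ?mk k m f")
      case True
      then obtain f where f: "Fam k (l m) f" "x = ?mk k m f" by blast
      have "Inv x (mk k (l m) f)"
        unfolding Inv_def nodes_lev[OF x] nodes_grade[OF x]
      proof (intro allI impI)
        fix g assume g: "Fam k (l m) g" "x = ?mk k m g"
        have "f (l ` F) = g (l ` F)" if "F \<subseteq> {..<m}" for F
          using trans[OF f(2)[symmetric] g(2)] that by (rule mk_inject)
        then show "mk k (l m) f = mk k (l m) g" using sep[OF f(1) g(1)] by (intro mk_cong) blast
      qed
      moreover have "mk k (l m) f \<in> nodes k (l m)" using wf[OF f(1)] by (rule mk_nodes)
      ultimately show ?thesis using ext[OF f] by blast
    next
      case False
      then have "Inv x y" for y unfolding Inv_def nodes_lev[OF x] nodes_grade[OF x] by blast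
      then show ?thesis using nodes_extend[OF z] by blast
    qed
    then show ?thesis
      unfolding pick_def nodes_lev[OF x] nodes_grade[OF x] by (rule someI_ex)
  qed
  have lifted: "emb l (lift pick) \<and> (\<forall>k m. \<forall>x\<in>nodes k m. Inv x (lift pick x))"
  proof (rule lift_inv[OF l])
    fix k x assume x: "x \<in> nodes k 0"
    show "pick x x \<in> nodes k (l 0) \<and> x \<sqsubseteq> pick x x \<and> Inv x (pick x x)"
      by (rule pickI[OF x x]) (simp_all add: ext_def res_mk)
  next
    fix k m x s y t
    assume x: "x \<in> nodes k m" "s \<in> nodes (Suc k) m" and y: "y \<in> nodes k (l m)" "t \<in> nodes (Suc k) (l m)"
      and I: "Inv x y" "Inv s t"
    have x': "Node x s \<in> nodes k (Suc m)" and z: "Node y t \<in> nodes k (Suc (l m))" using x y by auto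
    have le: "Suc (l m) \<le> l (Suc m)" using l by (simp add: Suc_le_eq strict_mono_less)
    show "pick (Node x s) (Node y t) \<in> nodes k (l (Suc m)) \<and> Node y t \<sqsubseteq> pick (Node x s) (Node y t) \<and>
       Inv (Node x s) (pick (Node x s) (Node y t))"
    proof (rule pickI[OF x' z le])
      fix f assume f: "Fam k (l (Suc m)) f" "Node x s = ?mk k (Suc m) f"
      then have xs: "x = ?mk k m f" "s = mk (Suc k) m (\<lambda>F. f (l ` insert m F))" by simp_all
      obtain g where g: "Fam (Suc k) (l m) g" "\<And>F. F \<subseteq> {..<l m} \<Longrightarrow> g F = f (insert (l m) F)"
        using closed[OF f(1)] by blast
      have "s = ?mk (Suc k) m g"
        unfolding xs(2) by (rule mk_cong) (simp add: g(2) img)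
      then have "t = mk (Suc k) (l m) g"
        using I(2) g(1) unfolding Inv_def nodes_lev[OF x(2)] nodes_grade[OF x(2)] by blast
      then have t: "t = mk (Suc k) (l m) (\<lambda>F. f (insert (l m) F))"
        using mk_cong[OF g(2)] by simp
      have "Fam k (l m) f" using down[OF f(1)] le by simp
      then have "y = mk k (l m) f"
        using I(1) xs(1) unfolding Inv_def nodes_lev[OF x(1)] nodes_grade[OF x(1)] by blast
      then have "Node y t = mk k (Suc (l m)) f" using t by simp
      moreover have "mk k (Suc (l m)) f \<sqsubseteq> mk k (l (Suc m)) f"
        unfolding ext_def lev_mk by (rule res_mk[OF le])
      ultimately show "Node y t \<sqsubseteq> mk k (l (Suc m)) f" by simp
    qed
  qed
  have mk_in: "?mk k m f \<in> nodes k m" if "Fam k (l m) f" for k m f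
  proof (rule mk_nodes)
    fix F :: "nat set" assume "F \<subseteq> {..<m}"
    moreover have "card (l ` F) = card F"
      using l by (intro card_image) (meson inj_on_subset strict_mono_imp_inj_on subset_UNIV)
    ultimately show "f (l ` F) < q (k + card F)" using wf[OF that img] by metis
  qed
  have "lift pick (?mk k m f) = mk k (l m) f" if f: "Fam k (l m) f" for k m f
  proof -
    have "Inv (?mk k m f) (lift pick (?mk k m f))" using lifted mk_in[OF f] by blast
    then show ?thesis using f unfolding Inv_def lev_mk grade_mk by blast
  qed
  then show ?thesis using lifted mk_in by blast
qed

end

text \<open>
A vertex \<open>v\<close> is coded by a node of odd level \<open>vl v\<close>. An even level \<open>question G c\<close> records the bit whether
\<open>G \<union> V\<close> has colour \<open>c\<close>. All questions about subsets of \<open>{..w}\<close> come before the level of \<open>w\<close>, so codes that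
differ at the level of a vertex already differ at some question, where they branch off with one of
two constant labels (\<open>spike\<close>). Hence the levels of the vertices and the first differences
form a bounded set of levels that is closed under taking labels.
\<close>

definition question :: "nat set \<Rightarrow> nat \<Rightarrow> nat" where
  "question G c = 2 * prod_encode (set_encode G, c)"

lemma vertex_levels_exist:
  fixes u :: "nat \<Rightarrow> nat" and q :: "nat \<Rightarrow> nat"
  shows "\<exists>vl. strict_mono vl \<and> (\<forall>w. odd (vl w)) \<and> (\<forall>w. u w \<le> vl w) \<and>
    (\<forall>w G c j. G \<subseteq> {..w} \<longrightarrow> j \<le> Suc w + n \<longrightarrow> c < q j \<longrightarrow> question G c < vl w)"
proof -
  define A where "A w = (\<lambda>(G, j, c). question G c) ` (SIGMA G:Pow {..w}. SIGMA j:{..Suc w + n}. {..<q j})" for w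
  have fin: "finite (A w)" for w unfolding A_def by (intro finite_imageI finite_SigmaI) auto
  define b where "b w = u w + \<Sum>(A w)" for w
  define vl where "vl w = 2 * (\<Sum>i\<le>w. Suc (b i)) + 1" for w
  have mono: "strict_mono vl" unfolding strict_mono_Suc_iff by (simp add: vl_def)
  have ge: "2 * Suc (b w) + 1 \<le> vl w" for w
    using member_le_sum[of w "{..w}" "\<lambda>i. Suc (b i)"] by (simp add: vl_def)
  have "question G c < vl w" if "G \<subseteq> {..w}" "j \<le> Suc w + n" "c < q j" for w G c j
  proof -
    have "question G c \<in> A w" unfolding A_def by (rule image_eqI[of _ _ "(G, j, c)"]) (use that in auto)
    then have "question G c \<le> \<Sum>(A w)" using member_le_sum[of "question G c" "A w" "\<lambda>x. x"] fin by simp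
    then show ?thesis using ge[of w] by (simp add: b_def)
  qed
  moreover have "u w \<le> vl w" for w using ge[of w] by (simp add: b_def)
  moreover have "odd (vl w)" for w by (simp add: vl_def)
  ultimately show ?thesis using mono by blast
qed

section \<open>Codes of vertices and their labels\<close>

locale coding = palette q for q :: "nat \<Rightarrow> nat" +
  fixes \<kappa> :: "nat set \<Rightarrow> nat" and n :: nat and vl :: "nat \<Rightarrow> nat"
  assumes \<kappa>_less: "finite W \<Longrightarrow> W \<noteq> {} \<Longrightarrow> \<kappa> W < q (card W)"
    and vl_mono: "strict_mono vl"
    and vl_odd: "odd (vl w)"
    and question_less: "G \<subseteq> {..w} \<Longrightarrow> j \<le> Suc w + n \<Longrightarrow> c < q j \<Longrightarrow> question G c < vl w"
begin

definition answer :: "nat \<Rightarrow> nat set \<Rightarrow> nat" where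
  "answer s V = (if \<exists>G. finite G \<and> G \<noteq> {} \<and> (\<forall>x\<in>G. \<forall>v\<in>V. x < v) \<and> s = question G (\<kappa> (G \<union> V)) then 1 else 0)"

text \<open>
\<open>code V\<close> is the type of the vertex set \<open>V\<close>; the code of \<open>v\<close> is that of \<open>{v}\<close>, and larger sets arise as
its labels at vertex levels.
\<close>

definition code :: "nat set \<Rightarrow> nat set \<Rightarrow> nat" where
  "code V F = (if F \<subseteq> range vl then \<kappa> (vl -` F \<union> V)
     else if F - range vl = {Min F} then answer (Min F) (vl -` F \<union> V) else 0)"

definition spike :: "nat \<Rightarrow> nat set \<Rightarrow> nat" where
  "spike a F = (if F = {} then a else 0)"

lemma answer_less: "answer s V < 2"
  by (simp add: answer_def)

lemma question_inject: "finite G \<Longrightarrow> finite G' \<Longrightarrow> question G c = question G' c' \<longleftrightarrow> G = G' \<and> c = c'"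
  by (auto simp: question_def set_encode_eq)

lemma question_not_vertex: "question G c \<noteq> vl w"
proof
  assume "question G c = vl w"
  moreover have "even (question G c)" by (simp add: question_def)
  ultimately show False using vl_odd by simp
qed

lemma vl_eq: "vl x = vl y \<longleftrightarrow> x = y"
  using vl_mono by (simp add: strict_mono_eq)

lemma vimage_insert_vl: "vl -` insert (vl w) F = insert w (vl -` F)"
  by (auto simp: vl_eq)

text \<open>The level \<open>vl w\<close> lies above all of \<open>F\<close> and cannot become the
  least element, so a bit recorded at \<open>Min F\<close> is still read after \<open>w\<close> has
  moved into the vertex set.\<close>

lemma code_vertex:
  assumes "F \<subseteq> {..<vl w}"
  shows "code V (insert (vl w) F) = code (insert w V) F"
proof (cases "F \<subseteq> range vl")
  case True
  then show ?thesis by (simp add: code_def vimage_insert_vl)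
next
  case False
  then have "F \<noteq> {}" by blast
  moreover have fin: "finite F" using assms finite_subset by blast
  ultimately have "Min F < vl w" using assms Min_in by blast
  then have "Min (insert (vl w) F) = Min F" using \<open>F \<noteq> {}\<close> fin by simp
  moreover have "insert (vl w) F - range vl = F - range vl" by blast
  ultimately show ?thesis using False by (simp add: code_def vimage_insert_vl)
qed

text \<open>A level that belongs to no vertex contributes only when it is least. If anything of
  \<open>F\<close> lies below \<open>s\<close> the value is 0, which leaves a constant label with
  one bit.\<close>

lemma code_split:
  assumes "s \<notin> range vl" "F \<subseteq> {..<s}"
  shows "code V (insert s F) = spike (answer s V) F"
proof -
  have fin: "finite F" using assms(2) finite_subset by blast
  show ?thesis
  proof (cases "F = {}")
    case True
    have "vl -` {s} = {}" "{s} - range vl = {s}" using assms(1) by auto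
    then show ?thesis using True assms(1) by (simp add: code_def spike_def)
  next
    case False
    then have "Min F < s" using assms(2) fin Min_in by blast
    then have "Min (insert s F) = Min F" using False fin by simp
    then have "s \<noteq> Min (insert s F)" using \<open>Min F < s\<close> by simp
    then have "insert s F - range vl \<noteq> {Min (insert s F)}" using assms(1) by blast
    then show ?thesis using False assms(1) by (auto simp: code_def spike_def)
  qed
qed

text \<open>Values of \<open>\<kappa>\<close> fit because the vertices read off from
  \<open>F\<close> lie below \<open>V\<close>, so cardinalities add; answers fit because the palette
  has at least two values.\<close>

lemma code_less:
  assumes V: "finite V" "V \<noteq> {}" and F: "F \<subseteq> {..<vl (Min V)}"
  shows "code V F < q (card V + card F)"
proof (cases "F \<subseteq> range vl")
  case True
  have fin: "finite F" using F finite_subset by blast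
  have im: "vl ` (vl -` F) = F" using True by blast
  have inj: "inj vl" using vl_mono strict_mono_imp_inj_on by blast
  have finv: "finite (vl -` F)" using fin inj by (simp add: finite_vimageI)
  have card: "card (vl -` F) = card F" using im inj by (metis card_image inj_on_subset subset_UNIV)
  have "x < Min V" if "x \<in> vl -` F" for x using that F vl_mono strict_mono_less by auto
  then have "vl -` F \<inter> V = {}" using V by (force simp: Min_gr_iff)
  then have "card (vl -` F \<union> V) = card V + card F" using card finv V by (simp add: card_Un_disjoint)
  then show ?thesis using \<kappa>_less[of "vl -` F \<union> V"] finv V True by (simp add: code_def)
next
  case False
  have "code V F < 2" using False answer_less by (simp add: code_def)
  then show ?thesis using q_ge_2[of "card V + card F"] by simp
qed

text \<open>Among the questions about \<open>G\<close> only the one with the true colour is answered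
  by 1, and it precedes \<open>vl w\<close>. Thus a code below \<open>vl w\<close> determines
  \<open>\<kappa> (G \<union> V)\<close> for all nonempty
  \<open>G \<subseteq> {..w}\<close>.\<close>

lemma answer_question:
  assumes G: "G \<subseteq> {..w}" "G \<noteq> {}" and V: "finite V" "card V \<le> n" "\<forall>v\<in>V. w < v"
  shows "question G (\<kappa> (G \<union> V)) < vl w"
    and "code V {question G (\<kappa> (G \<union> V))} = 1"
    and "code V {question G c} = 1 \<Longrightarrow> c = \<kappa> (G \<union> V)"
proof -
  have fin: "finite G" using G(1) finite_subset by blast
  have "card (G \<union> V) \<le> card G + card V" by (rule card_Un_le)
  also have "card G \<le> Suc w" using card_mono[OF _ G(1)] by simp
  finally have "card (G \<union> V) \<le> Suc w + n" using V(2) by simp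
  then show "question G (\<kappa> (G \<union> V)) < vl w"
    using question_less[OF G(1)] \<kappa>_less[of "G \<union> V"] fin V(1) G(2) by blast
  have *: "code V {question G c} = answer (question G c) V" for c
    using code_split[of "question G c" "{}" V] question_not_vertex by (auto simp: spike_def)
  have lt: "\<forall>x\<in>G. \<forall>v\<in>V. x < v" using G(1) V(3) by fastforce
  show "code V {question G (\<kappa> (G \<union> V))} = 1"
    unfolding * answer_def using fin G(2) lt by auto
  show "c = \<kappa> (G \<union> V)" if "code V {question G c} = 1"
    using that fin unfolding * answer_def by (auto simp: question_inject split: if_splits)
qed

text \<open>All values of \<open>\<kappa>\<close> that enter the labels at \<open>vl w\<close>
  concern sets \<open>G \<union> V\<close> with \<open>G \<subseteq> {..w}\<close>, and questions
  below \<open>vl w\<close> have settled them. Hence two codes never first differ at a vertex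
  level.\<close>

lemma code_agree_vertex:
  assumes V: "finite V" "card V \<le> n" "\<forall>v\<in>V. w < v" and V': "finite V'" "card V' \<le> n" "\<forall>v\<in>V'. w < v"
    and eq: "\<And>F. F \<subseteq> {..<vl w} \<Longrightarrow> code V F = code V' F" and F: "F \<subseteq> {..<vl w}"
  shows "code V (insert (vl w) F) = code V' (insert (vl w) F)"
proof -
  have \<kappa>: "\<kappa> (G \<union> V) = \<kappa> (G \<union> V')" if G: "G \<subseteq> {..w}" "G \<noteq> {}" for G
  proof -
    let ?s = "question G (\<kappa> (G \<union> V))"
    have "code V' {?s} = 1" using eq[of "{?s}"] answer_question(1,2)[OF G V] by simp
    then show ?thesis using answer_question(3)[OF G V'] by simp
  qed
  have W: "vl -` F \<subseteq> {..<w}" using F vl_mono strict_mono_less by auto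
  have answers: "answer s (vl -` F \<union> insert w V) = answer s (vl -` F \<union> insert w V')" for s
  proof -
    have "(finite G \<and> G \<noteq> {} \<and> (\<forall>x\<in>G. \<forall>v\<in>vl -` F \<union> insert w V. x < v) \<and>
        s = question G (\<kappa> (G \<union> (vl -` F \<union> insert w V)))) \<longleftrightarrow>
       (finite G \<and> G \<noteq> {} \<and> (\<forall>x\<in>G. \<forall>v\<in>vl -` F \<union> insert w V'. x < v) \<and>
        s = question G (\<kappa> (G \<union> (vl -` F \<union> insert w V'))))" for G
    proof (cases "\<forall>x\<in>G. x < w")
      case True
      have "\<forall>x\<in>G. \<forall>v\<in>V. x < v" "\<forall>x\<in>G. \<forall>v\<in>V'. x < v" using True V(3) V'(3) by fastforce+
      moreover have "\<kappa> ((G \<union> vl -` F \<union> {w}) \<union> V) = \<kappa> ((G \<union> vl -` F \<union> {w}) \<union> V')"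
        by (rule \<kappa>) (use True W in \<open>auto intro: less_imp_le\<close>)
      then have "\<kappa> (G \<union> (vl -` F \<union> insert w V)) = \<kappa> (G \<union> (vl -` F \<union> insert w V'))"
        by (simp add: Un_assoc)
      ultimately show ?thesis by auto
    qed auto
    then show ?thesis unfolding answer_def by simp
  qed
  have "\<kappa> ((vl -` F \<union> {w}) \<union> V) = \<kappa> ((vl -` F \<union> {w}) \<union> V')"
    by (rule \<kappa>) (use W in \<open>auto intro: less_imp_le\<close>)
  then have "\<kappa> (vl -` F \<union> insert w V) = \<kappa> (vl -` F \<union> insert w V')" by simp
  then show ?thesis
    unfolding code_vertex[OF F] unfolding code_def answers by (simp only:)
qed

text \<open>The question about \<open>{w}\<close> with the true colour gives the code the value 1 at
  a singleton, where every spike is 0.\<close>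

lemma code_not_spike:
  assumes V: "finite V" "card V \<le> n" "\<forall>v\<in>V. w < v"
  shows "\<exists>F\<subseteq>{..<vl w}. F \<noteq> {} \<and> code V F \<noteq> spike a F"
  using answer_question(1,2)[OF _ _ V, of "{w}"]
  by (intro exI[of _ "{question {w} (\<kappa> ({w} \<union> V))}"]) (auto simp: spike_def)

text \<open>The levels kept are those of the vertices in \<open>U\<close> and the first differences
  among the codes of subsets of \<open>U\<close> and the two spikes: at most \<open>n\<close>
  vertices, and at most \<open>(2 ^ n + 2)\<^sup>2\<close> pairs of functions.\<close>

lemma envelope:
  assumes U: "finite U" "card U \<le> n"
  shows "\<exists>l \<phi>. emb l \<phi> \<and> (\<forall>v\<in>U. \<exists>m\<le>n + (2 ^ n + 2)\<^sup>2. \<exists>x\<in>nodes 1 m. \<phi> x = mk 1 (vl v) (code {v}))"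
proof (cases "U = {}")
  case True
  then show ?thesis using emb_id by blast
next
  case False
  define \<Gamma> where "\<Gamma> = code ` (Pow U - {{}}) \<union> spike ` {..<2}"
  have \<Gamma>_fin: "finite \<Gamma>" using U(1) by (simp add: \<Gamma>_def)
  have "card \<Gamma> \<le> card (code ` (Pow U - {{}})) + card (spike ` {..<2})" unfolding \<Gamma>_def by (rule card_Un_le)
  also have "\<dots> \<le> card (Pow U - {{}}) + 2"
    using card_image_le[of "Pow U - {{}}" code] card_image_le[of "{..<2}" spike] U(1) by simp
  also have "\<dots> \<le> card (Pow U) + 2" using card_mono[of "Pow U" "Pow U - {{}}"] U(1) by simp
  also have "\<dots> \<le> 2 ^ n + 2" using U by (simp add: card_Pow)
  finally have \<Gamma>_card: "card \<Gamma> \<le> 2 ^ n + 2" .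
  \<comment> \<open>If \<open>g\<close> and \<open>h\<close> differ, but not at the empty set, this
    is the least possible maximum of a set on which they differ. For \<open>g = h\<close> the value
    is unspecified and only enters the count.\<close>
  define split where "split g h = (LEAST i. \<exists>F\<subseteq>{..<Suc i}. g F \<noteq> h F)" for g h :: "nat set \<Rightarrow> nat"
  \<comment> \<open>Vertex levels are removed from the differences: a vertex outside
    \<open>U\<close> would demand labels outside \<open>\<Gamma>\<close>.\<close>
  define E0 where "E0 = vl ` U \<union> ((\<lambda>(g, h). split g h) ` (\<Gamma> \<times> \<Gamma>) - range vl)"
  have E0_fin: "finite E0" using U(1) \<Gamma>_fin by (simp add: E0_def)
  have "card E0 \<le> card (vl ` U) + card ((\<lambda>(g, h). split g h) ` (\<Gamma> \<times> \<Gamma>) - range vl)"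
    unfolding E0_def by (rule card_Un_le)
  also have "\<dots> \<le> n + card (\<Gamma> \<times> \<Gamma>)"
  proof (rule add_mono)
    show "card (vl ` U) \<le> n" using card_image_le[OF U(1), of vl] U(2) by simp
    have "card ((\<lambda>(g, h). split g h) ` (\<Gamma> \<times> \<Gamma>) - range vl) \<le> card ((\<lambda>(g, h). split g h) ` (\<Gamma> \<times> \<Gamma>))"
      by (rule card_mono) (use \<Gamma>_fin in auto)
    also have "\<dots> \<le> card (\<Gamma> \<times> \<Gamma>)" by (rule card_image_le) (use \<Gamma>_fin in auto)
    finally show "card ((\<lambda>(g, h). split g h) ` (\<Gamma> \<times> \<Gamma>) - range vl) \<le> card (\<Gamma> \<times> \<Gamma>)" .
  qed
  also have "\<dots> \<le> n + (2 ^ n + 2)\<^sup>2"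
    using mult_mono[OF \<Gamma>_card \<Gamma>_card] by (simp add: card_cartesian_product power2_eq_square)
  finally have E0_card: "card E0 \<le> n + (2 ^ n + 2)\<^sup>2" .
  define b where "b = Max E0"
  have vl_E0: "vl v \<in> E0" if "v \<in> U" for v using that by (simp add: E0_def)
  have vl_b: "vl v \<le> b" if "v \<in> U" for v using vl_E0[OF that] E0_fin by (simp add: b_def)
  \<comment> \<open>The levels above \<open>b\<close> make the set infinite so that it can be
    enumerated; no code in the family below reaches beyond \<open>b\<close>.\<close>
  define E where "E = E0 \<union> {b<..}"
  have E_inf: "infinite E" using infinite_Ioi[of b] by (simp add: E_def)
  define l where "l = enumerate E"
  have l: "strict_mono l" unfolding l_def by (rule strict_mono_enumerate[OF E_inf])
  have l_range: "range l = E" unfolding l_def by (rule range_enumerate[OF E_inf])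
  have l_E0: "l m \<in> E0" if "l m < vl v" "v \<in> U" for m v
    using that vl_b[OF that(2)] l_range by (auto simp: E_def)
  define Fam where "Fam k e f \<longleftrightarrow>
    (\<exists>V. V \<subseteq> U \<and> V \<noteq> {} \<and> card V = k \<and> e \<le> vl (Min V) \<and> f = code V) \<or> (\<exists>a<2. f = spike a)" for k e f
  have finV: "finite V" "card V \<le> n" if "V \<subseteq> U" for V
    using finite_subset[OF that U(1)] card_mono[OF U(1) that] U(2) by auto
  have MinU: "Min V \<in> U" if "V \<subseteq> U" "V \<noteq> {}" for V
    using Min_in[OF finV(1)[OF that(1)] that(2)] that(1) by (rule rev_subsetD)
  have Fam_\<Gamma>: "f \<in> \<Gamma>" if "Fam k e f" for k e f using that by (auto simp: Fam_def \<Gamma>_def)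
  have "\<exists>\<Phi>. emb l \<Phi> \<and> (\<forall>k m f. Fam k (l m) f \<longrightarrow> mk k m (\<lambda>F. f (l ` F)) \<in> nodes k m \<and>
    \<Phi> (mk k m (\<lambda>F. f (l ` F))) = mk k (l m) f)"
  proof (rule emb_realizing[OF l])
    fix k e f F assume f: "Fam k e f" and F: "F \<subseteq> {..<e}"
    show "f F < q (k + card F)"
    proof (cases "\<exists>a<2. f = spike a")
      case True
      then have "f F < 2" by (auto simp: spike_def)
      then show ?thesis using q_ge_2[of "k + card F"] by simp
    next
      case False
      then obtain V where V: "V \<subseteq> U" "V \<noteq> {}" "card V = k" "e \<le> vl (Min V)" "f = code V"
        using f by (auto simp: Fam_def)
      have "F \<subseteq> {..<vl (Min V)}" using F V(4) by auto
      then show ?thesis using code_less[of V F] V finV by auto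
    qed
  next
    fix k e e' f assume "Fam k e f" "e' \<le> e"
    then show "Fam k e' f" unfolding Fam_def using order_trans[of e' e] by blast
  next
    fix k m f assume f: "Fam k (l (Suc m)) f"
    have lm: "l m < l (Suc m)" using l by (simp add: strict_mono_less)
    show "\<exists>g. Fam (Suc k) (l m) g \<and> (\<forall>F\<subseteq>{..<l m}. g F = f (insert (l m) F))"
    proof (cases "\<exists>a<2. f = spike a")
      case True
      then have "f (insert (l m) F) = spike 0 F" for F by (auto simp: spike_def)
      moreover have "Fam (Suc k) (l m) (spike 0)" unfolding Fam_def by (intro disjI2 exI[of _ 0]) simp
      ultimately show ?thesis by auto
    next
      case False
      then obtain V where V: "V \<subseteq> U" "V \<noteq> {}" "card V = k" "l (Suc m) \<le> vl (Min V)" "f = code V"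
        using f by (auto simp: Fam_def)
      have lt: "l m < vl (Min V)" using lm V(4) by simp
      have E0: "l m \<in> E0" using l_E0[OF lt MinU] V by blast
      show ?thesis
      proof (cases "l m \<in> range vl")
        case True
        then obtain w where w: "l m = vl w" by blast
        then have wU: "w \<in> U" using E0 by (auto simp: E0_def vl_eq)
        have "w < Min V" using lt w vl_mono by (simp add: strict_mono_less)
        then have wV: "\<forall>v\<in>V. w < v" using V finV by (meson Min_gr_iff)
        then have "Min (insert w V) = w" using V finV by (auto intro!: Min_eqI less_imp_le)
        moreover have "card (insert w V) = Suc k" using wV V finV[OF V(1)] by (subst card_insert_disjoint) auto
        ultimately have "Fam (Suc k) (l m) (code (insert w V))"
          unfolding Fam_def using wU V(1) w by (intro disjI1 exI[of _ "insert w V"]) simp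
        then show ?thesis using code_vertex[of _ w V] w V(5) by auto
      next
        case False
        have "Fam (Suc k) (l m) (spike (answer (l m) V))" unfolding Fam_def using answer_less by blast
        then show ?thesis using code_split[OF False] V(5) by metis
      qed
    qed
  next
    fix k m f g F assume f: "Fam k (l m) f" and g: "Fam k (l m) g"
      and agree: "\<And>F. F \<subseteq> {..<m} \<Longrightarrow> f (l ` F) = g (l ` F)" and F: "F \<subseteq> {..<l m}"
    \<comment> \<open>At a first difference \<open>i\<close> the labels are spikes, as
      \<open>i\<close> is not a vertex level. Since \<open>i\<close> is a kept level,
      \<open>{i}\<close> compares their bits, so the labels agree and there is no difference at
      \<open>i\<close>.\<close>
    show "f F = g F"
    proof (rule ccontr)
      assume neq: "f F \<noteq> g F"
      have empty: "f {} = g {}" using agree[of "{}"] by simp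
      define i where "i = split f g"
      have "F \<noteq> {}" using neq empty by auto
      then have "l m \<noteq> 0" using F by auto
      then have ex: "\<exists>F'\<subseteq>{..<Suc (l m - 1)}. f F' \<noteq> g F'" using F neq by (intro exI[of _ F]) simp
      have i_le: "i \<le> l m - 1" unfolding i_def split_def by (rule Least_le) (rule ex)
      then have i_lt: "i < l m" using \<open>l m \<noteq> 0\<close> by simp
      obtain F1 where F1: "F1 \<subseteq> {..<Suc i}" "f F1 \<noteq> g F1"
        using LeastI[of "\<lambda>i. \<exists>F\<subseteq>{..<Suc i}. f F \<noteq> g F", OF ex] unfolding i_def split_def by blast
      have before: "f F' = g F'" if "F' \<subseteq> {..<i}" for F'
      proof (cases i)
        case 0
        then show ?thesis using that empty by simp
      next
        case (Suc i')
        then have "\<not> (\<exists>F\<subseteq>{..<Suc i'}. f F \<noteq> g F)"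
          using not_less_Least[of i' "\<lambda>i. \<exists>F\<subseteq>{..<Suc i}. f F \<noteq> g F"] unfolding i_def split_def by simp
        then show ?thesis using that Suc by blast
      qed
      define F0 where "F0 = F1 - {i}"
      have "i \<in> F1" using F1 before by (metis lessThan_Suc subset_insert)
      then have F0: "F1 = insert i F0" "F0 \<subseteq> {..<i}" using F1(1) by (auto simp: F0_def)
      have i_range: "i \<notin> range vl"
      proof
        assume "i \<in> range vl"
        then obtain w where w: "i = vl w" by blast
        have wV: "\<forall>v\<in>V. w < v" if V: "V \<subseteq> U" "V \<noteq> {}" "l m \<le> vl (Min V)" for V
        proof -
          have "vl w < vl (Min V)" using i_lt V(3) w by simp
          then have "w < Min V" using vl_mono by (simp add: strict_mono_less)
          then show ?thesis using V finV by (meson Min_gr_iff)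
        qed
        have mixed: False
          if V: "V \<subseteq> U" "V \<noteq> {}" "l m \<le> vl (Min V)" and "\<And>F. F \<subseteq> {..<i} \<Longrightarrow> code V F = spike a F" for V a
          using code_not_spike[OF finV[OF V(1)] wV[OF V], of a] that(4) w by blast
        define br where "br h \<longleftrightarrow> (\<exists>V. V \<subseteq> U \<and> V \<noteq> {} \<and> l m \<le> vl (Min V) \<and> h = code V)" for h
        have br: "br h \<or> (\<exists>a. h = spike a)" if "Fam k (l m) h" for h
          using that unfolding Fam_def br_def by blast
        from br[OF f] br[OF g] consider "br f" "br g" | a where "br f" "g = spike a" | a where "f = spike a" "br g"
          | a a' where "f = spike a" "g = spike a'"
          by (elim disjE exE) auto
        then show False
        proof cases
          case 1
          obtain V where V: "V \<subseteq> U" "V \<noteq> {}" "l m \<le> vl (Min V)" "f = code V"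
            using 1(1) unfolding br_def by blast
          obtain V' where V': "V' \<subseteq> U" "V' \<noteq> {}" "l m \<le> vl (Min V')" "g = code V'"
            using 1(2) unfolding br_def by blast
          have "code V (insert (vl w) F0) = code V' (insert (vl w) F0)"
            by (rule code_agree_vertex[OF finV[OF V(1)] wV[OF V(1-3)] finV[OF V'(1)] wV[OF V'(1-3)]])
              (use before V(4) V'(4) w F0 in auto)
          then show ?thesis using F1(2) F0(1) V(4) V'(4) w by simp
        next
          case (2 a)
          then obtain V where "V \<subseteq> U" "V \<noteq> {}" "l m \<le> vl (Min V)" "f = code V" unfolding br_def by blast
          then show ?thesis using mixed[of V a] before 2 by simp
        next
          case (3 a)
          then obtain V where "V \<subseteq> U" "V \<noteq> {}" "l m \<le> vl (Min V)" "g = code V" unfolding br_def by blast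
          then show ?thesis using mixed[of V a] before 3 by simp
        next
          case (4 a a')
          then have "a = a'" using empty by (simp add: spike_def)
          then show ?thesis using 4 neq by simp
        qed
      qed
      have at: "\<exists>a. \<forall>F\<subseteq>{..<i}. h (insert i F) = spike a F" if h: "Fam k (l m) h" for h
      proof (cases "\<exists>a<2. h = spike a")
        case True
        then show ?thesis by (intro exI[of _ 0]) (auto simp: spike_def)
      next
        case False
        then show ?thesis using h code_split[OF i_range] unfolding Fam_def by blast
      qed
      obtain a a' where a: "\<And>F. F\<subseteq>{..<i} \<Longrightarrow> f (insert i F) = spike a F"
        "\<And>F. F\<subseteq>{..<i} \<Longrightarrow> g (insert i F) = spike a' F" using at[OF f] at[OF g] by blast
      have "i \<in> (\<lambda>(g, h). split g h) ` (\<Gamma> \<times> \<Gamma>)"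
        using Fam_\<Gamma>[OF f] Fam_\<Gamma>[OF g] unfolding i_def by (intro image_eqI[of _ _ "(f, g)"]) auto
      then have "i \<in> E" using i_range by (simp add: E_def E0_def)
      then obtain m' where m': "i = l m'" using l_range by blast
      then have "m' < m" using i_lt l by (simp add: strict_mono_less)
      then have "f {i} = g {i}" using agree[of "{m'}"] m' by simp
      then have "a = a'" using a[of "{}"] by (simp add: spike_def)
      then show False using a[OF F0(2)] F1(2) F0(1) by simp
    qed
  qed
  then obtain \<Phi> where \<Phi>: "emb l \<Phi>" and real: "\<And>k m f. Fam k (l m) f \<Longrightarrow> mk k m (\<lambda>F. f (l ` F)) \<in> nodes k m \<and>
    \<Phi> (mk k m (\<lambda>F. f (l ` F))) = mk k (l m) f" by blast
  have "\<exists>m\<le>n + (2 ^ n + 2)\<^sup>2. \<exists>x\<in>nodes 1 m. \<Phi> x = mk 1 (vl v) (code {v})" if v: "v \<in> U" for v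
  proof -
    have "vl v \<in> range l" using vl_E0[OF v] l_range by (simp add: E_def)
    then obtain m where m: "vl v = l m" by blast
    \<comment> \<open>The level \<open>m\<close> that \<open>l\<close> sends to \<open>vl v\<close>
      is the number of kept levels below \<open>vl v\<close>, and these all belong to
      \<open>E0\<close>.\<close>
    have "l ` {..<m} \<subseteq> E0"
    proof
      fix x assume "x \<in> l ` {..<m}"
      then obtain m' where m': "m' < m" "x = l m'" by blast
      then have "l m' < vl v" using m l by (simp add: strict_mono_less)
      then show "x \<in> E0" using l_E0 v m' by blast
    qed
    then have "card (l ` {..<m}) \<le> card E0" using E0_fin card_mono by blast
    moreover have "card (l ` {..<m}) = m"
      using l by (subst card_image) (auto intro: inj_on_subset strict_mono_imp_inj_on)
    ultimately have "m \<le> n + (2 ^ n + 2)\<^sup>2" using E0_card by simp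
    moreover have "Fam 1 (l m) (code {v})"
      unfolding Fam_def using v m by (intro disjI1 exI[of _ "{v}"]) simp
    ultimately show ?thesis using real[of 1 m "code {v}"] m by auto
  qed
  then show ?thesis using \<Phi> by blast
qed

end

section \<open>Hypergraphs\<close>

instance node :: countable
  by countable_datatype

section \<open>Hypergraphs as colour functions on finite vertex sets\<close>

lemma is_emb_trans:
  assumes f: "is_emb ar A B f" and g: "is_emb ar B C g"
  shows "is_emb ar A C (g \<circ> f)"
  unfolding is_emb_def
proof (intro conjI allI impI)
  show "(g \<circ> f) ` univ A \<subseteq> univ C" using f g by (force simp: is_emb_def)
  show "strict_mono_on (univ A) (g \<circ> f)"
    using f g unfolding is_emb_def strict_mono_on_def by (simp add: image_subset_iff)
  fix r xs assume xs: "length xs = ar r" "set xs \<subseteq> univ A"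
  have "set (map f xs) \<subseteq> univ B" using f xs unfolding is_emb_def by auto
  then show "xs \<in> rels A r \<longleftrightarrow> map (g \<circ> f) xs \<in> rels C r"
    using f g xs unfolding is_emb_def by (metis length_map map_map)
qed

locale language =
  fixes ar :: "'r \<Rightarrow> nat"
  assumes ar_pos: "1 \<le> ar r"
    and finite_arity: "2 \<le> n \<Longrightarrow> finite {r. ar r = n}"
    and countable_unary: "countable {r. ar r = 1}"
begin

text \<open>Relations are numbered within each arity, so the number together with the size of an
  edge identifies the relation.\<close>

definition rcode :: "'r \<Rightarrow> nat" where
  "rcode r = to_nat_on {s. ar s = ar r} r"

text \<open>
The summand 2 leaves room for the bits of the coding. The sum is 0 when the index set is infinite,
but this can only happen for unary relations, whose colours are not stored in nodes.
\<close>

definition bound :: "nat \<Rightarrow> nat" where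
  "bound k = 2 + (\<Sum>r | ar r = k. rcode r)"

definition colour :: "'r lstruct \<Rightarrow> nat set \<Rightarrow> nat" where
  "colour A W = (if \<exists>r xs. set xs = W \<and> xs \<in> rels A r
     then Suc (rcode (SOME r. \<exists>xs. set xs = W \<and> xs \<in> rels A r)) else 0)"

text \<open>Values that belong to no relation of the right arity count as non-edges, so every
  function gives a hypergraph.\<close>

definition coloured :: "(nat set \<Rightarrow> nat) \<Rightarrow> 'r lstruct" where
  "coloured c = \<lparr>univ = UNIV, rels = (\<lambda>r. {xs. distinct xs \<and> length xs = ar r \<and> c (set xs) = Suc (rcode r)})\<rparr>"

lemma rcode_inject:
  assumes "ar r = ar s" "rcode r = rcode s"
  shows "r = s"
proof -
  have "countable {t. ar t = ar r}"
    using finite_arity[of "ar r"] countable_unary ar_pos[of r]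
    by (cases "ar r = 1") (auto intro: countable_finite)
  then show ?thesis using assms unfolding rcode_def by (simp add: to_nat_on_inj)
qed

text \<open>Two injective enumerations of one set are permutations of each other, so by symmetry
  they lie in the same relations, of which there is at most one.\<close>

lemma colour_eq:
  assumes A: "is_hypergraph ar A" and xs: "xs \<in> rels A r"
  shows "colour A (set xs) = Suc (rcode r)"
proof -
  let ?P = "\<lambda>s. \<exists>ys. set ys = set xs \<and> ys \<in> rels A s"
  have "s = r" if s: "?P s" for s
  proof -
    obtain ys where ys: "set ys = set xs" "ys \<in> rels A s" using s by blast
    then have "distinct xs" "distinct ys" using A xs ys(2) unfolding is_hypergraph_def by blast+
    then have "mset xs = mset ys" using ys(1) by (simp add: set_eq_iff_mset_eq_distinct)
    then have "xs \<in> rels A s" using A ys(2) unfolding is_hypergraph_def by blast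
    then show ?thesis using A xs unfolding is_hypergraph_def by blast
  qed
  moreover have "?P r" using xs by blast
  ultimately have "(SOME s. ?P s) = r" by (intro some_equality)
  then show ?thesis using xs unfolding colour_def by auto
qed

lemma colour_SucE:
  assumes A: "is_hypergraph ar A" and W: "colour A W \<noteq> 0"
  obtains r xs where "set xs = W" "xs \<in> rels A r" "distinct xs" "ar r = card W" "colour A W = Suc (rcode r)"
proof -
  obtain r xs where xs: "set xs = W" "xs \<in> rels A r" using W unfolding colour_def by (auto split: if_splits)
  have "distinct xs" "length xs = ar r" using A xs(2) unfolding is_hypergraph_def is_struct_def by blast+
  then show ?thesis using that[OF xs] xs(1) colour_eq[OF A xs(2)] distinct_card[of xs] by simp
qed

lemma rels_iff_colour:
  assumes A: "is_hypergraph ar A"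
  shows "xs \<in> rels A r \<longleftrightarrow> distinct xs \<and> length xs = ar r \<and> colour A (set xs) = Suc (rcode r)"
proof
  assume "xs \<in> rels A r"
  then show "distinct xs \<and> length xs = ar r \<and> colour A (set xs) = Suc (rcode r)"
    using A colour_eq[OF A] unfolding is_hypergraph_def is_struct_def by blast
next
  assume xs: "distinct xs \<and> length xs = ar r \<and> colour A (set xs) = Suc (rcode r)"
  then have "colour A (set xs) \<noteq> 0" by simp
  then obtain s ys where ys: "set ys = set xs" "ys \<in> rels A s" "distinct ys" "ar s = card (set xs)"
    "colour A (set xs) = Suc (rcode s)" by (rule colour_SucE[OF A])
  then have "s = r" using xs distinct_card[of xs] by (intro rcode_inject) auto
  moreover have "mset xs = mset ys" using xs ys by (simp add: set_eq_iff_mset_eq_distinct)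
  ultimately show "xs \<in> rels A r" using A ys(2) unfolding is_hypergraph_def by blast
qed

lemma colour_less:
  assumes "is_hypergraph ar A" "2 \<le> card W"
  shows "colour A W < bound (card W)"
proof (cases "colour A W = 0")
  case False
  then obtain r where r: "ar r = card W" "colour A W = Suc (rcode r)" using colour_SucE[OF assms(1)] by metis
  have "rcode r \<le> (\<Sum>s | ar s = card W. rcode s)"
    using finite_arity[OF assms(2)] r(1) by (intro member_le_sum) auto
  then show ?thesis using r(2) by (simp add: bound_def)
qed (simp add: bound_def)

lemma coloured_hypergraph: "is_hypergraph ar (coloured c)"
  unfolding is_hypergraph_def
proof (intro conjI allI ballI impI)
  show "is_struct ar (coloured c)" by (auto simp: is_struct_def coloured_def)
  fix r xs assume xs: "xs \<in> rels (coloured c) r"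
  then show "distinct xs" by (simp add: coloured_def)
  fix ys assume ys: "mset ys = mset xs"
  then show "ys \<in> rels (coloured c) r"
    using xs mset_eq_setD[OF ys] mset_eq_length[OF ys] mset_eq_imp_distinct_iff[OF ys]
    by (simp add: coloured_def)
next
  fix r s xs assume "r \<noteq> s" "xs \<in> rels (coloured c) r"
  then show "xs \<notin> rels (coloured c) s" using rcode_inject[of r s] by (auto simp: coloured_def)
qed

lemma emb_coloured:
  assumes H: "is_hypergraph ar H" "univ H = UNIV" and f: "strict_mono f"
    and c: "\<And>W. finite W \<Longrightarrow> W \<noteq> {} \<Longrightarrow> c (f ` W) = colour H W"
  shows "is_emb ar H (coloured c) f"
  unfolding is_emb_def
proof (intro conjI allI impI)
  show "f ` univ H \<subseteq> univ (coloured c)" by (simp add: coloured_def)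
  show "strict_mono_on (univ H) f" using f by (simp add: H(2))
  fix r and xs :: "nat list" assume "length xs = ar r"
  then have xs: "xs \<noteq> []" using ar_pos[of r] by auto
  have "inj_on f (set xs)" using f by (meson inj_on_subset strict_mono_imp_inj_on subset_UNIV)
  then have "distinct (map f xs) \<longleftrightarrow> distinct xs" by (simp add: distinct_map)
  then show "xs \<in> rels H r \<longleftrightarrow> map f xs \<in> rels (coloured c) r"
    unfolding rels_iff_colour[OF H(1)] using xs c[of "set xs"] by (simp add: coloured_def)
qed

text \<open>The unary relation at a vertex is part of the structure \<open>A\<close>, so every copy
  shows the same one. This is why unary colours never multiply the number of classes of copies, even
  if there are infinitely many.\<close>

lemma emb_colour_singleton:
  assumes H: "is_hypergraph ar H" and e: "is_emb ar A H e" "is_emb ar A H e'" and i: "i \<in> univ A"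
  shows "colour H {e i} = colour H {e' i}"
proof -
  have *: "colour H {f' i} = colour H {f i}"
    if nz: "colour H {f i} \<noteq> 0" and f: "is_emb ar A H f" "is_emb ar A H f'" for f f'
  proof -
    obtain r xs where r: "set xs = {f i}" "xs \<in> rels H r" "distinct xs" "ar r = card {f i}"
      "colour H {f i} = Suc (rcode r)" using colour_SucE[OF H nz] by metis
    have "length xs = 1" using r(1,3) distinct_card[of xs] by simp
    then have "xs = [f i]" using r(1) by (cases xs) auto
    then have "[i] \<in> rels A r" using r f(1) i unfolding is_emb_def by simp
    then have "[f' i] \<in> rels H r" using r(4) f(2) i unfolding is_emb_def by simp
    then show ?thesis using colour_eq[OF H, of "[f' i]" r] r(5) by simp
  qed
  show ?thesis
  proof (cases "colour H {e i} = 0")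
    case True
    then show ?thesis using *[of e' e] e by force
  next
    case False
    then show ?thesis using *[of e e'] e by simp
  qed
qed

end

section \<open>The hypergraph on coded nodes\<close>

context palette
begin

text \<open>
Vertices of the universal hypergraph built from nodes are nodes with a unary colour. Admitting only
finitely many colours at each level allows an enumeration \<open>place\<close> along the levels.
\<close>

definition coded :: "nat \<Rightarrow> (node \<times> nat) set" where
  "coded m = nodes 1 m \<times> {..m}"

definition offset :: "nat \<Rightarrow> nat" where
  "offset m = (\<Sum>i<m. Suc (\<Sum>(to_nat ` coded i)))"

definition place :: "node \<times> nat \<Rightarrow> nat" where
  "place p = offset (lev (fst p)) + to_nat p"

text \<open>Each summand of \<open>offset\<close> exceeds every \<open>to_nat\<close> value on its
  level, so places increase with the level. This yields the monotonicity required of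
  embeddings.\<close>

lemma place_less:
  assumes p: "p \<in> coded m" "p' \<in> coded m'" and m: "m < m'"
  shows "place p < place p'"
proof -
  have lev: "lev (fst p) = m" "lev (fst p') = m'" using p by (auto simp: coded_def nodes_lev)
  have "finite (coded m)" by (simp add: coded_def nodes_finite)
  then have "to_nat p \<le> \<Sum>(to_nat ` coded m)" using p(1) member_le_sum[of "to_nat p" "to_nat ` coded m" "\<lambda>x. x"] by simp
  then have "place p < offset (Suc m)" using lev by (simp add: place_def offset_def)
  also have "offset (Suc m) \<le> offset m'" unfolding offset_def using m by (intro sum_mono2) auto
  also have "\<dots> \<le> place p'" using lev by (simp add: place_def)
  finally show ?thesis .
qed

lemma place_inj: "inj_on place (\<Union>m. coded m)"
proof (rule inj_onI)
  fix p p' assume p: "p \<in> (\<Union>m. coded m)" "p' \<in> (\<Union>m. coded m)" and eq: "place p = place p'"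
  obtain m m' where m: "p \<in> coded m" "p' \<in> coded m'" using p by blast
  then have "m = m'" using place_less[OF m] place_less[OF m(2,1)] eq by (metis less_irrefl linorder_neqE_nat)
  then have "lev (fst p) = lev (fst p')" using m by (auto simp: coded_def nodes_lev)
  then show "p = p'" using eq by (simp add: place_def)
qed

definition unplace :: "nat \<Rightarrow> node \<times> nat" where
  "unplace = inv_into (\<Union>m. coded m) place"

lemma unplace_place: "p \<in> coded m \<Longrightarrow> unplace (place p) = p"
  unfolding unplace_def using place_inj by (intro inv_into_f_f) auto

text \<open>The values at sets containing two vertices of the same level are irrelevant.\<close>

definition place_colour :: "nat set \<Rightarrow> nat" where
  "place_colour W = (if W = {Max W} then snd (unplace (Max W))
     else val (fst (unplace (Max W))) ((\<lambda>w. lev (fst (unplace w))) ` (W - {Max W})))"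

text \<open>Constancy for one colouring survives composition with a further embedding, so the
  colourings are treated in turn.\<close>

lemma milliken_family:
  fixes \<chi> :: "'b \<Rightarrow> (node \<Rightarrow> node) \<Rightarrow> nat"
  assumes "finite B" "N \<le> Suc G"
    and loc: "\<And>b \<phi> \<phi>'. b \<in> B \<Longrightarrow> (\<And>x. x \<in> below G N \<Longrightarrow> \<phi> x = \<phi>' x) \<Longrightarrow> \<chi> b \<phi> = \<chi> b \<phi>'"
    and bd: "\<And>b \<phi>. \<chi> b \<phi> < K"
  shows "\<exists>l \<Phi>. emb l \<Phi> \<and> (\<forall>b\<in>B. \<exists>\<epsilon>. \<forall>l' \<phi>. emb l' \<phi> \<longrightarrow> \<chi> b (\<Phi> \<circ> \<phi>) = \<epsilon>)"
  using assms(1) loc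
proof (induction B rule: finite_induct)
  case empty
  then show ?case using emb_id by blast
next
  case (insert b B)
  then obtain l \<Phi> where \<Phi>: "emb l \<Phi>" and old: "\<And>b. b\<in>B \<Longrightarrow> \<exists>\<epsilon>. \<forall>l' \<phi>. emb l' \<phi> \<longrightarrow> \<chi> b (\<Phi> \<circ> \<phi>) = \<epsilon>"
    by (metis insertCI)
  have "\<exists>l \<Psi> \<epsilon>. emb l \<Psi> \<and> (\<forall>l' \<phi>. emb l' \<phi> \<longrightarrow> \<chi> b (\<Phi> \<circ> (\<Psi> \<circ> \<phi>)) = \<epsilon>)"
  proof (rule milliken[OF assms(2)])
    show "\<chi> b (\<Phi> \<circ> \<phi>) = \<chi> b (\<Phi> \<circ> \<phi>')" if "\<And>x. x \<in> below G N \<Longrightarrow> \<phi> x = \<phi>' x" for \<phi> \<phi>'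
      by (rule insert.prems) (use that in auto)
  qed (rule bd)
  then obtain l' \<Psi> \<epsilon> where \<Psi>: "emb l' \<Psi>" and new: "\<forall>l' \<phi>. emb l' \<phi> \<longrightarrow> \<chi> b (\<Phi> \<circ> (\<Psi> \<circ> \<phi>)) = \<epsilon>" by blast
  have "\<exists>\<epsilon>. \<forall>l \<phi>. emb l \<phi> \<longrightarrow> \<chi> b' ((\<Phi> \<circ> \<Psi>) \<circ> \<phi>) = \<epsilon>" if b': "b' \<in> insert b B" for b'
  proof (cases "b' = b")
    case True
    then show ?thesis using new by (auto simp: comp_assoc)
  next
    case False
    then obtain \<delta> where "\<forall>l \<phi>. emb l \<phi> \<longrightarrow> \<chi> b' (\<Phi> \<circ> \<phi>) = \<delta>" using b' old[of b'] by blast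
    then have "\<forall>l \<phi>. emb l \<phi> \<longrightarrow> \<chi> b' (\<Phi> \<circ> (\<Psi> \<circ> \<phi>)) = \<delta>" using emb_comp[OF \<Psi>] by blast
    then show ?thesis by (auto simp: comp_assoc)
  qed
  then show ?case using emb_comp[OF \<Phi> \<Psi>] by blast
qed

end

section \<open>The given hypergraph inside the hypergraph on nodes\<close>

context coding
begin

lemma code_node: "mk 1 (vl v) (code {v}) \<in> nodes 1 (vl v)"
  by (rule mk_nodes) (use code_less[of "{v}"] in simp)

text \<open>Edges with largest vertex \<open>v\<close> are recorded in the code of \<open>v\<close>
  at vertex levels, and \<open>\<Phi>\<close> moves the node and these levels consistently.\<close>

lemma val_code_node:
  assumes \<Phi>: "emb l \<Phi>" and W: "\<forall>w\<in>W. w < v"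
  shows "val (\<Phi> (mk 1 (vl v) (code {v}))) ((\<lambda>w. l (vl w)) ` W) = \<kappa> (insert v W)"
proof -
  have sub: "vl ` W \<subseteq> {..<vl v}" using W vl_mono by (auto simp: strict_mono_less)
  have "val (\<Phi> (mk 1 (vl v) (code {v}))) (l ` vl ` W) = code {v} (vl ` W)"
    using emb_val[OF \<Phi> code_node sub] val_mk[OF sub] by simp
  moreover have "vl -` vl ` W = W" by (auto simp: vl_eq)
  moreover have "vl ` W \<subseteq> range vl" by blast
  ultimately show ?thesis by (simp add: code_def image_image)
qed

lemma place_colour_code:
  assumes \<Phi>: "emb l \<Phi>" and u: "\<And>v. u v \<le> vl v" and W: "finite W" "W \<noteq> {}"
  defines "\<eta> \<equiv> \<lambda>v. place (\<Phi> (mk 1 (vl v) (code {v})), u v)"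
  shows "strict_mono \<eta>"
    and "place_colour (\<eta> ` W) = (if W = {Max W} then u (Max W) else \<kappa> W)"
proof -
  let ?x = "\<lambda>v. \<Phi> (mk 1 (vl v) (code {v}))"
  have x: "?x v \<in> nodes 1 (l (vl v))" for v using emb_nodes[OF \<Phi> code_node] .
  have "vl v \<le> l (vl v)" for v using emb_mono[OF \<Phi>] strict_mono_imp_increasing by blast
  then have in_coded: "(?x v, u v) \<in> coded (l (vl v))" for v
    using x u order_trans unfolding coded_def by blast
  show mono: "strict_mono \<eta>"
  proof (rule strict_monoI)
    fix v w :: nat assume "v < w"
    then have "l (vl v) < l (vl w)" using emb_mono[OF \<Phi>] vl_mono by (simp add: strict_mono_less)
    then show "\<eta> v < \<eta> w" unfolding \<eta>_def using place_less in_coded by blast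
  qed
  have un: "unplace (\<eta> v) = (?x v, u v)" for v unfolding \<eta>_def using unplace_place in_coded by blast
  have inj: "inj \<eta>" using mono strict_mono_imp_inj_on by blast
  let ?v = "Max W"
  have v: "?v \<in> W" using W by simp
  have "Max (\<eta> ` W) = \<eta> ?v"
    using mono_Max_commute[of \<eta> W] strict_mono_mono[OF mono] W by simp
  moreover have "\<eta> ` W = {\<eta> ?v} \<longleftrightarrow> W = {?v}" using inj by (metis image_empty image_insert inj_image_eq_iff)
  moreover have "\<eta> ` W - {\<eta> ?v} = \<eta> ` (W - {?v})" using inj by (auto simp: inj_eq)
  moreover have "(\<lambda>w. lev (fst (unplace w))) ` \<eta> ` (W - {?v}) = (\<lambda>w. l (vl w)) ` (W - {?v})"
    using nodes_lev[OF x] by (simp add: image_image un)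
  moreover have "val (?x ?v) ((\<lambda>w. l (vl w)) ` (W - {?v})) = \<kappa> W"
  proof -
    have "\<forall>w\<in>W - {?v}. w < ?v" using W Max_ge by (metis DiffE insertI1 le_neq_implies_less)
    from val_code_node[OF \<Phi> this] show ?thesis using v by (simp add: insert_absorb)
  qed
  ultimately show "place_colour (\<eta> ` W) = (if W = {Max W} then u (Max W) else \<kappa> W)"
    unfolding place_colour_def by (simp add: un)
qed

end

section \<open>The bound on the big Ramsey degrees\<close>

context language
begin

lemma universal_finite_brd:
  assumes univ: "universal_hypergraph ar H"
  shows "finite_big_ramsey_degrees ar H"
  unfolding finite_big_ramsey_degrees_def
proof (intro allI impI)
  interpret palette bound by unfold_locales (simp add: bound_def)
  fix A :: "'r lstruct" assume A: "is_struct ar A \<and> finite (univ A)"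
  have H: "is_hypergraph ar H" using univ by (simp add: universal_hypergraph_def)
  obtain g where g: "is_emb ar (coloured place_colour) H g"
    using univ coloured_hypergraph unfolding universal_hypergraph_def by blast
  have gm: "strict_mono g" using g by (simp add: is_emb_def coloured_def)
  \<comment> \<open>A finite \<open>H\<close> could not contain the infinite hypergraph on
    nodes.\<close>
  have HU: "univ H = UNIV"
  proof (rule ccontr)
    assume "univ H \<noteq> UNIV"
    then have "finite (univ H)" using H by (auto simp: is_hypergraph_def is_struct_def)
    moreover have "range g \<subseteq> univ H" using g by (simp add: is_emb_def coloured_def)
    moreover have "infinite (range g)" using gm strict_mono_imp_inj_on range_inj_infinite by blast
    ultimately show False using finite_subset by blast
  qed
  obtain n where n: "univ A = {..<n}" using A by (auto simp: is_struct_def)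
  show "\<exists>l. brd_le ar A H l"
  proof (cases "emb_set ar A H = {}")
    case True
    have "is_emb ar H H id" by (simp add: is_emb_def strict_mono_on_def)
    then have "brd_le ar A H 0" using True unfolding brd_le_def by auto
    then show ?thesis by blast
  next
    case False
    then obtain e0 where e0: "is_emb ar A H e0" by (auto simp: emb_set_def)
    define u where "u v = colour H {v}" for v
    \<comment> \<open>Unary colours may be unbounded and would not fit into nodes; they travel
      separately through \<open>u\<close>.\<close>
    define \<kappa> where "\<kappa> W = (if card W \<le> 1 then 0 else colour H W)" for W
    obtain vl where vl: "strict_mono vl" "\<And>w. odd (vl w)" "\<And>w. u w \<le> vl w"
      "\<And>w G c j. G \<subseteq> {..w} \<Longrightarrow> j \<le> Suc w + n \<Longrightarrow> c < bound j \<Longrightarrow> question G c < vl w"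
      using vertex_levels_exist[of u n bound] by blast
    interpret coding bound \<kappa> n vl
    proof
      show "\<kappa> W < bound (card W)" if "finite W" "W \<noteq> {}" for W
        using colour_less[OF H, of W] by (simp add: \<kappa>_def bound_def)
    qed (use vl in auto)
    \<comment> \<open>One more than the largest level in \<open>envelope\<close>; as the nodes there
      have grade 1, it also bounds grade plus level.\<close>
    define N where "N = Suc (n + (2 ^ n + 2)\<^sup>2)"
    define B where "B = Pi\<^sub>E {..<n} (\<lambda>_. below N N)"
    have B_fin: "finite B" unfolding B_def by (intro finite_PiE below_finite) simp
    \<comment> \<open>Unary colours are read from the fixed copy \<open>e0\<close>, since all copies
      have the same ones; \<open>\<phi>\<close> and \<open>b\<close> then determine the
      copy.\<close>
    define copy where "copy \<phi> b = restrict (\<lambda>i. g (place (\<phi> (b i), u (e0 i)))) {..<n}" for \<phi> :: "node \<Rightarrow> node" and b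
    have "brd_le ar A H (card B)"
      unfolding brd_le_def
    proof (intro allI impI)
      fix k :: nat and \<chi> :: "(nat \<Rightarrow> nat) \<Rightarrow> nat" assume \<chi>: "\<forall>e\<in>emb_set ar A H. \<chi> e < k"
      \<comment> \<open>Where \<open>b\<close> does not yield a copy of \<open>A\<close>,
        \<open>\<chi>\<close> may exceed \<open>k\<close>; truncation keeps the colouring
        bounded.\<close>
      define \<chi>' where "\<chi>' b \<phi> = (if \<chi> (copy \<phi> b) < k then \<chi> (copy \<phi> b) else 0)" for b \<phi>
      have "\<exists>l \<Phi>. emb l \<Phi> \<and> (\<forall>b\<in>B. \<exists>\<epsilon>. \<forall>l' \<phi>. emb l' \<phi> \<longrightarrow> \<chi>' b (\<Phi> \<circ> \<phi>) = \<epsilon>)"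
      proof (rule milliken_family[OF B_fin, of N N _ "Suc k"])
        fix b and \<phi> \<phi>' :: "node \<Rightarrow> node"
        assume b: "b \<in> B" and eq: "\<And>x. x \<in> below N N \<Longrightarrow> \<phi> x = \<phi>' x"
        have "copy \<phi> b = copy \<phi>' b"
          unfolding copy_def by (rule restrict_ext) (use b eq in \<open>auto simp: B_def PiE_iff\<close>)
        then show "\<chi>' b \<phi> = \<chi>' b \<phi>'" by (simp add: \<chi>'_def)
      qed (auto simp: \<chi>'_def)
      then obtain l \<Phi> where \<Phi>: "emb l \<Phi>"
        and "\<forall>b\<in>B. \<exists>\<epsilon>. \<forall>l' \<phi>. emb l' \<phi> \<longrightarrow> \<chi>' b (\<Phi> \<circ> \<phi>) = \<epsilon>" by blast
      then obtain \<epsilon> where \<epsilon>: "\<And>b l' \<phi>. b \<in> B \<Longrightarrow> emb l' \<phi> \<Longrightarrow> \<chi>' b (\<Phi> \<circ> \<phi>) = \<epsilon> b" by metis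
      define \<eta> where "\<eta> v = place (\<Phi> (mk 1 (vl v) (code {v})), u v)" for v
      have \<eta>_col: "place_colour (\<eta> ` W) = colour H W" if "finite W" "W \<noteq> {}" for W
      proof -
        have "place_colour (\<eta> ` W) = (if W = {Max W} then u (Max W) else \<kappa> W)"
          unfolding \<eta>_def by (rule place_colour_code(2)[OF \<Phi> vl(3) that])
        moreover have "card W \<noteq> 0" "card W = 1 \<Longrightarrow> W = {Max W}"
          using that by (auto simp: card_1_singleton_iff)
        ultimately show ?thesis by (auto simp: u_def \<kappa>_def)
      qed
      have \<eta>_mono: "strict_mono \<eta>" unfolding \<eta>_def by (rule place_colour_code(1)[OF \<Phi> vl(3), of "{0}"]) auto
      define f where "f = g \<circ> \<eta>"
      have f: "is_emb ar H H f"
        unfolding f_def using is_emb_trans[OF emb_coloured[OF H HU \<eta>_mono \<eta>_col] g] .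
      have "\<chi> e \<in> \<epsilon> ` B" if e: "e \<in> emb_set ar A H" "e ` univ A \<subseteq> f ` univ H" for e
      proof -
        have e_emb: "is_emb ar A H e" and e_ext: "e \<in> extensional {..<n}"
          using e(1) n by (auto simp: emb_set_def)
        have "\<forall>i<n. \<exists>v. e i = f v" using e(2) n by auto
        then obtain v where v: "\<And>i. i < n \<Longrightarrow> e i = f (v i)" by metis
        \<comment> \<open>A copy inside the image of \<open>f\<close> involves at most
          \<open>n\<close> vertices, so an envelope exhibits their codes as the image of a
          configuration from \<open>B\<close>.\<close>
        have fin: "finite (v ` {..<n})" and card: "card (v ` {..<n}) \<le> n"
          using card_image_le[of "{..<n}" v] by auto
        from envelope[OF fin card] obtain l' \<phi> where \<phi>: "emb l' \<phi>"
          and ex: "\<forall>w\<in>v ` {..<n}. \<exists>m\<le>n + (2 ^ n + 2)\<^sup>2. \<exists>x\<in>nodes 1 m. \<phi> x = mk 1 (vl w) (code {w})"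
          by (elim exE conjE) (rule that)
        have "\<exists>x\<in>below N N. \<phi> x = mk 1 (vl (v i)) (code {v i})" if "i < n" for i
        proof -
          obtain m x where m: "m \<le> n + (2 ^ n + 2)\<^sup>2" "x \<in> nodes 1 m" "\<phi> x = mk 1 (vl (v i)) (code {v i})"
            using ex \<open>i < n\<close> by blast
          then have "m < N" "1 + m \<le> N" by (auto simp: N_def)
          then have "x \<in> below N N" using m(2) unfolding below_def by blast
          then show ?thesis using m(3) by blast
        qed
        then obtain b0 where b0: "\<And>i. i < n \<Longrightarrow> b0 i \<in> below N N"
          "\<And>i. i < n \<Longrightarrow> \<phi> (b0 i) = mk 1 (vl (v i)) (code {v i})" by metis
        define b where "b = restrict b0 {..<n}"
        have b: "b \<in> B" using b0(1) by (simp add: b_def B_def)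
        have "u (e0 i) = u (v i)" if i: "i < n" for i
        proof -
          have "u (e0 i) = u (e i)" unfolding u_def
            by (rule emb_colour_singleton[OF H e0 e_emb]) (simp add: n i)
          also have "\<dots> = u (f (v i))" using v[OF i] by simp
          \<comment> \<open>Both \<open>f\<close> and the identity embed \<open>H\<close> into
            itself, so \<open>emb_colour_singleton\<close> applies with \<open>H\<close> in place of
            \<open>A\<close>.\<close>
          also have "\<dots> = u (v i)" unfolding u_def
            using emb_colour_singleton[OF H f, of id "v i"] HU by (simp add: is_emb_def strict_mono_on_def)
          finally show ?thesis .
        qed
        then have "copy (\<Phi> \<circ> \<phi>) b i = e i" for i
          using v b0(2) e_ext by (auto simp: copy_def b_def f_def \<eta>_def extensional_def)
        then have "copy (\<Phi> \<circ> \<phi>) b = e" by blast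
        then have "\<epsilon> b = \<chi> e" using \<epsilon>[OF b \<phi>] \<chi> e(1) by (simp add: \<chi>'_def)
        then show ?thesis using b by (metis imageI)
      qed
      then have "\<chi> ` {e \<in> emb_set ar A H. e ` univ A \<subseteq> f ` univ H} \<subseteq> \<epsilon> ` B" by blast
      then have "card (\<chi> ` {e \<in> emb_set ar A H. e ` univ A \<subseteq> f ` univ H}) \<le> card (\<epsilon> ` B)"
        using B_fin by (intro card_mono) auto
      also have "\<dots> \<le> card B" using card_image_le[OF B_fin] .
      finally show "\<exists>f. is_emb ar H H f \<and> card (\<chi> ` {e \<in> emb_set ar A H. e ` univ A \<subseteq> f ` univ H}) \<le> card B"
        using f by blast
    qed
    then show ?thesis by blast
  qed
qed

end

theorem theorem5p1:
  fixes ar :: "'r \<Rightarrow> nat" and H :: "'r lstruct"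
  assumes "\<forall>r. 1 \<le> ar r"
    and "\<forall>n \<ge> 2. finite {r. ar r = n}"
    and "countable {r. ar r = 1}"
    and "universal_hypergraph ar H"
  shows "finite_big_ramsey_degrees ar H"
proof -
  interpret language ar using assms(1-3) by unfold_locales auto
  show ?thesis using assms(4) by (rule universal_finite_brd)
qed

end
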